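(* Let $f=h+\overline{g}\in\mathcal{K}^0_H$ and let $\theta\in\mathbb{R}$. Then $s_{n,n}(f;\theta)(z)=s_n(h)(z)+e^{i\theta}\,\overline{s_n(g)(z)}$ is univalent in the disk (i) $|z|<1/4$, whenever $n\ge 2$; (ii) $|z|<1/2$, whenever $n\ge 17$; (iii) $|z|<3/4$, whenever $n\ge 46$.
   Context: $\mathbb{D}=\{z\in\mathbb{C}:|z|<1\}$. $\mathcal{H}$ is the class of complex-valued harmonic functions $f=h+\overline{g}$ on $\mathbb{D}$, with $h,g$ analytic on $\mathbb{D}$, normalized by $h(0)=g(0)=0$ and $h'(0)=1$. Such an $f$ is sense-preserving if $|h'(z)|^2-|g'(z)|^2>0$ on $\mathbb{D}$. $\mathcal{S}_H$ is the class of all sense-preserving univalent (injective) $f\in\mathcal{H}$, and $\mathcal{S}^0_H=\{f\in\mathcal{S}_H: f_{\overline z}(0)=0\}$, i.e. those with $g'(0)=0$. $\mathcal{K}_H^0$ is the set of $f\in\mathcal{S}_H^0$ for which $f(\mathbb{D})$ is convex. Sections: for an analytic function $\phi(z)=\sum_{k\ge1}c_kz^k$, $s_n(\phi)(z)=\sum_{k=1}^nc_kz^k$. *)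

theory Defs
  imports "HOL-Complex_Analysis.Complex_Analysis"
begin

abbreviation unit_disk :: "complex set" where
  "unit_disk \<equiv> ball 0 1"

(* Members of the classes below are total functions on the complex plane; only their
   values on the open unit disk matter. *)

definition decomposition :: "(complex \<Rightarrow> complex) \<Rightarrow> (complex \<Rightarrow> complex) \<Rightarrow> (complex \<Rightarrow> complex) \<Rightarrow> bool" where
  "decomposition f h g \<longleftrightarrow>
     h holomorphic_on unit_disk \<and> g holomorphic_on unit_disk \<and>
     h 0 = 0 \<and> g 0 = 0 \<and> deriv h 0 = 1 \<and>
     (\<forall>z\<in>unit_disk. f z = h z + cnj (g z))"

definition class_H :: "(complex \<Rightarrow> complex) set" where
  "class_H = {f. \<exists>h g. decomposition f h g}"

(* On the disk h and g are determined by f (lemma decomposition_unique), so the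
   existential quantifier does not involve a choice. *)
definition sense_preserving :: "(complex \<Rightarrow> complex) \<Rightarrow> bool" where
  "sense_preserving f \<longleftrightarrow>
     (\<exists>h g. decomposition f h g \<and>
        (\<forall>z\<in>unit_disk. (cmod (deriv h z))\<^sup>2 - (cmod (deriv g z))\<^sup>2 > 0))"

definition class_S_H :: "(complex \<Rightarrow> complex) set" where
  "class_S_H = {f \<in> class_H. sense_preserving f \<and> inj_on f unit_disk}"

(* The Wirtinger derivative (f_x + i f_y) / 2 with respect to the conjugate variable. *)
definition dzbar :: "(complex \<Rightarrow> complex) \<Rightarrow> complex \<Rightarrow> complex" where
  "dzbar f z = (frechet_derivative f (at z) 1 + \<i> * frechet_derivative f (at z) \<i>) / 2"

definition class_S_H0 :: "(complex \<Rightarrow> complex) set" where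
  "class_S_H0 = {f \<in> class_S_H. dzbar f 0 = 0}"

definition class_K_H0 :: "(complex \<Rightarrow> complex) set" where
  "class_K_H0 = {f \<in> class_S_H0. convex (f ` unit_disk)}"

(* The sum starts at k = 1, since sections are taken of functions vanishing at 0. *)
definition section_of :: "nat \<Rightarrow> (complex \<Rightarrow> complex) \<Rightarrow> complex \<Rightarrow> complex" where
  "section_of n \<phi> z = (\<Sum>k=1..n. fps_nth (fps_expansion \<phi> 0) k * z ^ k)"

definition harmonic_section ::
    "nat \<Rightarrow> (complex \<Rightarrow> complex) \<Rightarrow> (complex \<Rightarrow> complex) \<Rightarrow> real \<Rightarrow> complex \<Rightarrow> complex" where
  "harmonic_section n h g \<theta> z = section_of n h z + exp (\<i> * of_real \<theta>) * cnj (section_of n g z)"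

lemma decomposition_has_derivative:
  assumes "decomposition f h g" and z: "z \<in> unit_disk"
  shows "(f has_derivative (\<lambda>w. deriv h z * w + cnj (deriv g z * w))) (at z)"
proof -
  have h: "(h has_derivative (\<lambda>w. deriv h z * w)) (at z)"
    and g: "(g has_derivative (\<lambda>w. deriv g z * w)) (at z)"
    using assms holomorphic_derivI[of _ unit_disk z]
    by (auto simp: decomposition_def has_field_derivative_def)
  have "((\<lambda>w. h w + cnj (g w)) has_derivative (\<lambda>w. deriv h z * w + cnj (deriv g z * w))) (at z)"
    by (intro has_derivative_add h has_derivative_cnj g)
  moreover have "f w = h w + cnj (g w)" if "w \<in> unit_disk" for w
    using assms that by (auto simp: decomposition_def)
  ultimately show ?thesis
    using has_derivative_transform_within_open[of _ _ z UNIV unit_disk f] z by auto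
qed

lemma dzbar_decomposition:
  assumes "decomposition f h g" and "z \<in> unit_disk"
  shows "dzbar f z = cnj (deriv g z)"
  using frechet_derivative_at[OF decomposition_has_derivative[OF assms], symmetric]
  by (simp add: dzbar_def algebra_simps)

lemma decomposition_unique:
  assumes d1: "decomposition f h g" and d2: "decomposition f h' g'" and z: "z \<in> unit_disk"
  shows "h z = h' z" and "g z = g' z"
proof -
  have eq: "deriv h w = deriv h' w" if w: "w \<in> unit_disk" for w
  proof -
    have "(\<lambda>v. deriv h w * v + cnj (deriv g w * v)) = (\<lambda>v. deriv h' w * v + cnj (deriv g' w * v))"
      using has_derivative_unique decomposition_has_derivative d1 d2 w by blast
    from fun_cong[OF this, of 1] fun_cong[OF this, of \<i>] show ?thesis
      by (auto simp: complex_eq_iff)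
  qed
  have "((\<lambda>z. h z - h' z) has_field_derivative 0) (at w within unit_disk)" if w: "w \<in> unit_disk" for w
  proof -
    have "(h has_field_derivative deriv h w) (at w)" "(h' has_field_derivative deriv h' w) (at w)"
      using d1 d2 w holomorphic_derivI[of _ unit_disk w] by (auto simp: decomposition_def)
    then show ?thesis
      using DERIV_diff[of h "deriv h w" w unit_disk h' "deriv h' w"] eq[OF w]
      by (auto intro: has_field_derivative_at_within)
  qed
  then obtain c where c: "\<And>w. w \<in> unit_disk \<Longrightarrow> h w - h' w = c"
    using has_field_derivative_zero_constant[of unit_disk "\<lambda>z. h z - h' z"] by auto
  have "c = 0" using c[of 0] d1 d2 by (auto simp: decomposition_def)
  with c z show hz: "h z = h' z" by auto
  have "f z = h z + cnj (g z)" "f z = h' z + cnj (g' z)"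
    using d1 d2 z unfolding decomposition_def by blast+
  with hz have "cnj (g z) = cnj (g' z)" by simp
  then show "g z = g' z" by simp
qed

end

theory Submission
  imports Defs "HOL-Real_Asymp.Real_Asymp"
begin

text \<open>
  For unimodular \<open>\<epsilon>\<close> put \<open>F = h + \<epsilon> g\<close>. After a rotation of \<open>f\<close>, the functions \<open>f\<close> and \<open>F\<close> (up to a
  unimodular factor) have the same imaginary part \<open>v\<close>, and convexity of the range makes all the sets
  \<open>{v > c}\<close> and \<open>{v < c}\<close> connected. Hence the radial limits of \<open>v\<close> rise and fall only once around the
  circle, and the Poisson formula yields unimodular \<open>\<kappa>\<close>, \<open>p\<close>, \<open>q\<close> with
  \<open>Re (\<kappa> (1 - p z) (1 - q z) F'(z)) > 0\<close>. Radial limits are available almost everywhere once \<open>f\<close> is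
  composed with Riemann maps onto the preimages of convex sets exhausting \<open>f(D)\<close>.

  This inequality bounds the coefficients of \<open>F\<close> by those of the Koebe function. It also bounds
  \<open>|F(z) - F(w)|\<close> from below by a multiple of \<open>|z - w|\<close>, by comparing \<open>F\<close> with the convex univalent
  primitive of \<open>1 / ((1 - p z) (1 - q z))\<close>. The lower bound exceeds the contribution of the tail of the
  power series in all cases but \<open>n = 2, 3\<close> of the first disk; these follow from \<open>|a\<^sub>2| \<le> 2\<close> and
  \<open>|a\<^sub>3 - a\<^sub>2\<^sup>2| \<le> 1\<close>. Sections of \<open>F\<close> being injective for all \<open>\<epsilon>\<close>, so are those of \<open>f\<close>.
\<close>

section \<open>Functions with values in a half-plane\<close>

text \<open>The obstacle is the boundary: \<open>f\<close> is merely a homeomorphism onto a convex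
  set that may be unbounded, so \<open>v\<close> need not have radial limits. On the preimage of a
  compact convex part of the range all values stay in a compact subset of the disk, and a radial
  limit of the Riemann map yields one of \<open>v\<close>. Infimum and supremum of these limits need
  not be attained, which costs an error \<epsilon> in the half-plane inequality; it disappears when
  the compact sets exhaust the range, while \<kappa>, \<open>p\<close>, \<open>q\<close> have limit
  points because the circle is compact.

  Univalence of sections is then a numerical comparison. Divided differences of the tail on the disk
  of radius r are at most the sum of k^2 r^(k-1) over k > n. Those of \<open>F\<close> are bounded
  below by the product of (1 - r) / (1 + r), which stems from the half-plane, and (5 - r) / (5 (5 r
  + 1)), which stems from the convex primitive. For r = 1/2 and r = 3/4 the lower bound wins at n =
  17 and n = 46, hence for all larger n.\<close>

lemma half_plane_subordination:
  assumes holo: "P holomorphic_on ball 0 1" and P0: "P 0 = 1" and \<kappa>: "cmod \<kappa> = 1"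
    and pos: "\<And>z. z \<in> ball 0 1 \<Longrightarrow> Re (\<kappa> * P z) > 0"
  obtains \<mu> \<omega> where "cmod \<mu> = 1" "\<omega> holomorphic_on ball 0 1" "\<omega> 0 = 0"
    "\<And>z. z \<in> ball 0 1 \<Longrightarrow> cmod (\<omega> z) < 1" "\<And>z. z \<in> ball 0 1 \<Longrightarrow> cmod (\<omega> z) \<le> cmod z"
    "\<And>z. z \<in> ball 0 1 \<Longrightarrow> P z * (1 - \<omega> z) = 1 + \<mu> * \<omega> z"
proof
  \<comment> \<open>The half-plane Re w > 0 is mapped into the disk by w -> (w - \<kappa>) / (w +
    cnj \<kappa>), which sends the value \<kappa> of \<open>\<kappa> * P\<close> at 0 to 0. Solving
    for \<open>P\<close> gives (1 + \<mu> \<omega>) / (1 - \<omega>): the tilt of the half-plane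
    survives only in the unimodular \<mu>.\<close>
  define \<mu> where "\<mu> = cnj \<kappa> / \<kappa>"
  define \<omega> where "\<omega> z = (\<kappa> * P z - \<kappa>) / (\<kappa> * P z + cnj \<kappa>)" for z
  have \<kappa>0: "\<kappa> \<noteq> 0" using \<kappa> by auto
  have Re\<kappa>: "Re \<kappa> > 0" using pos[of 0] P0 by simp
  have den: "\<kappa> * P z + cnj \<kappa> \<noteq> 0" if "z \<in> ball 0 1" for z
  proof
    assume "\<kappa> * P z + cnj \<kappa> = 0"
    then have "Re (\<kappa> * P z + cnj \<kappa>) = 0" by simp
    then show False using pos[OF that] Re\<kappa> by simp
  qed
  show "cmod \<mu> = 1" using \<kappa> by (simp add: \<mu>_def norm_divide)
  show hol: "\<omega> holomorphic_on ball 0 1"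
    unfolding \<omega>_def by (intro holomorphic_intros holo) (use den in auto)
  show \<omega>0: "\<omega> 0 = 0" by (simp add: \<omega>_def P0)
  show lt: "cmod (\<omega> z) < 1" if "z \<in> ball 0 1" for z
  proof -
    have "(cmod (\<kappa> * P z + cnj \<kappa>))\<^sup>2 - (cmod (\<kappa> * P z - \<kappa>))\<^sup>2 = 4 * (Re (\<kappa> * P z) * Re \<kappa>)"
      unfolding cmod_power2 by (simp add: power2_eq_square algebra_simps)
    moreover have "Re (\<kappa> * P z) * Re \<kappa> > 0" using pos[OF that] Re\<kappa> by (rule mult_pos_pos)
    ultimately have "(cmod (\<kappa> * P z - \<kappa>))\<^sup>2 < (cmod (\<kappa> * P z + cnj \<kappa>))\<^sup>2" by linarith
    then have "cmod (\<kappa> * P z - \<kappa>) < cmod (\<kappa> * P z + cnj \<kappa>)" by (rule power2_less_imp_less) simp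
    then show ?thesis using den[OF that] by (simp add: \<omega>_def norm_divide)
  qed
  show "cmod (\<omega> z) \<le> cmod z" if "z \<in> ball 0 1" for z
    by (rule Schwarz_Lemma(1)[OF hol \<omega>0]) (use lt that in auto)
  show "P z * (1 - \<omega> z) = 1 + \<mu> * \<omega> z" if "z \<in> ball 0 1" for z
  proof -
    have "1 - \<omega> z = (\<kappa> + cnj \<kappa>) / (\<kappa> * P z + cnj \<kappa>)"
      using den[OF that] by (simp add: \<omega>_def field_simps)
    moreover have "1 + \<mu> * \<omega> z = P z * (\<kappa> + cnj \<kappa>) / (\<kappa> * P z + cnj \<kappa>)"
      using den[OF that] \<kappa>0 by (simp add: \<omega>_def \<mu>_def divide_simps) (simp add: algebra_simps)
    ultimately show ?thesis by simp
  qed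
qed

text \<open>The growth bounds for positive real part persist for a tilted half-plane, since \<mu>
  enters the estimates only through its modulus.\<close>

lemma half_plane_bounds:
  assumes holo: "P holomorphic_on ball 0 1" and P0: "P 0 = 1" and \<kappa>: "cmod \<kappa> = 1"
    and pos: "\<And>z. z \<in> ball 0 1 \<Longrightarrow> Re (\<kappa> * P z) > 0" and z: "z \<in> ball 0 1"
  shows "cmod (P z) \<le> (1 + cmod z) / (1 - cmod z)" "cmod (P z) \<ge> (1 - cmod z) / (1 + cmod z)"
proof -
  obtain \<mu> \<omega> where \<mu>: "cmod \<mu> = 1" and \<omega>': "\<And>z. z \<in> ball 0 1 \<Longrightarrow> cmod (\<omega> z) \<le> cmod z"
    "\<And>z. z \<in> ball 0 1 \<Longrightarrow> P z * (1 - \<omega> z) = 1 + \<mu> * \<omega> z"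
    using half_plane_subordination[OF holo P0 \<kappa> pos] by metis
  note \<omega> = \<omega>'[OF z]
  define x where "x = cmod z"
  have x: "0 \<le> x" "x < 1" using z by (auto simp: x_def)
  have m: "cmod (\<mu> * \<omega> z) \<le> x" using \<mu> \<omega> by (simp add: norm_mult x_def)
  have n1: "1 - x \<le> cmod (1 - \<omega> z)" "cmod (1 - \<omega> z) \<le> 1 + x"
    using norm_triangle_ineq2[of 1 "\<omega> z"] norm_triangle_ineq4[of 1 "\<omega> z"] \<omega>(1) by (auto simp: x_def)
  have n2: "1 - x \<le> cmod (1 + \<mu> * \<omega> z)" "cmod (1 + \<mu> * \<omega> z) \<le> 1 + x"
    using norm_diff_ineq[of 1 "\<mu> * \<omega> z"] norm_triangle_ineq[of 1 "\<mu> * \<omega> z"] m by auto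
  have eq: "cmod (P z) * cmod (1 - \<omega> z) = cmod (1 + \<mu> * \<omega> z)"
    using arg_cong[OF \<omega>(2), of cmod] by (simp only: norm_mult)
  have "cmod (P z) * (1 - x) \<le> cmod (P z) * cmod (1 - \<omega> z)" using n1 by (intro mult_left_mono) auto
  then have "cmod (P z) * (1 - x) \<le> 1 + x" using eq n2 by linarith
  then show "cmod (P z) \<le> (1 + cmod z) / (1 - cmod z)" using x by (simp add: x_def pos_le_divide_eq)
  have "cmod (P z) * cmod (1 - \<omega> z) \<le> cmod (P z) * (1 + x)" using n1 by (intro mult_left_mono) auto
  then have "1 - x \<le> cmod (P z) * (1 + x)" using eq n2 by linarith
  then show "cmod (P z) \<ge> (1 - cmod z) / (1 + cmod z)" using x by (simp add: x_def pos_divide_le_eq add_pos_nonneg)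
qed

text \<open>Stability in the Schwarz lemma. Applied to \<open>\<phi>\<close> and to its rescaled
  inverse, that lemma confines the derivative at 0, nonnegative by normalization, to [r, 1]. So
  \<open>\<tau>\<close> = \<phi>(z) / z has modulus at most 1 and is close to 1 at 0; the growth
  bound for the half-plane function 1 - \<tau> keeps it close to 1 locally uniformly.\<close>

lemma close_to_identity:
  assumes holo: "\<phi> holomorphic_on ball 0 1" and im: "\<phi> ` ball 0 1 \<subseteq> ball 0 1" and inj: "inj_on \<phi> (ball 0 1)"
    and \<phi>0: "\<phi> 0 = 0" and r: "0 < r" "r < 1" and cover: "ball 0 r \<subseteq> \<phi> ` ball 0 1"
    and d: "deriv \<phi> 0 = of_real (cmod (deriv \<phi> 0))" and z: "z \<in> ball 0 1"
  shows "cmod (\<phi> z - z) \<le> 6 * (1 - r) / (1 - cmod z)"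
    and "cmod (deriv \<phi> z - 1) \<le> 24 * (1 - r) / (1 - cmod z)\<^sup>2"
proof -
  obtain \<psi> where \<psi>: "\<psi> holomorphic_on (\<phi> ` ball 0 1)"
    "\<And>z. z \<in> ball 0 1 \<Longrightarrow> deriv \<phi> z * deriv \<psi> (\<phi> z) = 1" "\<And>z. z \<in> ball 0 1 \<Longrightarrow> \<psi> (\<phi> z) = z"
    using holomorphic_has_inverse[OF holo open_ball inj] by metis
  have \<psi>_in: "\<psi> w \<in> ball 0 1" if w: "w \<in> ball 0 r" for w
  proof -
    obtain u where "u \<in> ball 0 1" "w = \<phi> u" using cover w by blast
    then show ?thesis using \<psi>(3) by simp
  qed
  have hol\<psi>: "\<psi> holomorphic_on ball 0 r" by (rule holomorphic_on_subset[OF \<psi>(1) cover])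
  define \<omega> where "\<omega> w = \<psi> (of_real r * w)" for w
  have rw: "of_real r * w \<in> ball 0 r" if "w \<in> ball 0 1" for w :: complex using that r by (simp add: norm_mult)
  have hol\<omega>: "\<omega> holomorphic_on ball 0 1"
  proof -
    have "(\<psi> \<circ> (\<lambda>w. of_real r * w)) holomorphic_on ball 0 1"
      by (rule holomorphic_on_compose_gen[OF _ hol\<psi>]) (use rw in \<open>auto intro!: holomorphic_intros simp del: mem_ball\<close>)
    then show ?thesis by (simp only: \<omega>_def[abs_def] o_def)
  qed
  have \<omega>0: "\<omega> 0 = 0" using \<psi>(3)[of 0] \<phi>0 by (simp add: \<omega>_def)
  have "cmod (deriv \<omega> 0) \<le> 1"
  proof (rule Schwarz_Lemma(2)[OF hol\<omega> \<omega>0, of 0])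
    show "cmod (\<omega> w) < 1" if "cmod w < 1" for w
    proof -
      have "\<psi> (of_real r * w) \<in> ball 0 1" by (rule \<psi>_in[OF rw]) (use that in simp)
      then show ?thesis by (simp add: \<omega>_def)
    qed
  qed simp
  moreover have "deriv \<omega> 0 = deriv \<psi> 0 * of_real r"
  proof (rule DERIV_imp_deriv)
    have "(\<psi> has_field_derivative deriv \<psi> 0) (at (of_real r * 0))"
      using holomorphic_derivI[OF hol\<psi> open_ball, of 0] r by simp
    moreover have "((\<lambda>w. of_real r * w) has_field_derivative of_real r) (at (0::complex))"
      by (auto intro!: derivative_eq_intros)
    ultimately show "(\<omega> has_field_derivative deriv \<psi> 0 * of_real r) (at 0)"
      unfolding \<omega>_def[abs_def] by (rule DERIV_chain2[where g="\<lambda>w. of_real r * w"])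
  qed
  ultimately have le1: "cmod (deriv \<psi> 0) * r \<le> 1" using r by (simp add: norm_mult)
  define D where "D = cmod (deriv \<phi> 0)"
  have "D * cmod (deriv \<psi> 0) = 1" using arg_cong[OF \<psi>(2)[of 0], of cmod] \<phi>0 by (simp add: D_def norm_mult)
  then have "r = D * (cmod (deriv \<psi> 0) * r)" by simp
  also have "\<dots> \<le> D * 1" using le1 by (intro mult_left_mono) (auto simp: D_def)
  finally have Dr: "r \<le> D" by simp
  have \<phi>lt: "cmod (\<phi> w) < 1" if "cmod w < 1" for w using im that by force
  have D1: "D \<le> 1" unfolding D_def by (rule Schwarz_Lemma(2)[OF holo \<phi>0 \<phi>lt, of 0]) auto
  obtain \<tau> where \<tau>: "\<tau> holomorphic_on ball 0 1" "\<And>w. cmod w < 1 \<Longrightarrow> \<phi> w = w * \<tau> w" "deriv \<phi> 0 = \<tau> 0"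
    using Schwarz3[OF holo \<phi>0] by auto
  have \<chi>le: "cmod (\<tau> w) \<le> 1" if "cmod w < 1" for w
  proof (cases "w = 0")
    case True
    then show ?thesis using D1 \<tau>(3) by (simp add: D_def)
  next
    case False
    have "cmod w * cmod (\<tau> w) \<le> cmod w * 1"
      using Schwarz_Lemma(1)[OF holo \<phi>0 \<phi>lt that] \<tau>(2)[OF that] by (simp add: norm_mult)
    then show ?thesis using False by simp
  qed
  \<comment> \<open>The summand 1 - r makes the real part of \<open>R\<close> strictly positive even
    if \<tau> takes the value 1; division by \<open>c\<close> normalizes R at 0.\<close>
  define c where "c = 1 - D + (1 - r)"
  have c: "0 < c" "c \<le> 2 * (1 - r)" using D1 Dr r by (auto simp: c_def)
  define R where "R w = (1 - \<tau> w + of_real (1 - r)) / of_real c" for w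
  have R_pos: "Re (1 * R w) > 0" if "w \<in> ball 0 1" for w
  proof -
    have "Re (\<tau> w) \<le> 1" using \<chi>le[of w] complex_Re_le_cmod[of "\<tau> w"] that by auto
    then show ?thesis using r c by (simp add: R_def)
  qed
  have R0: "R 0 = 1"
  proof -
    have "\<tau> 0 = of_real D" using \<tau>(3) d by (simp add: D_def)
    then have "1 - \<tau> 0 + of_real (1 - r) = of_real c" by (simp add: c_def)
    then show ?thesis using c by (simp add: R_def)
  qed
  have holR: "R holomorphic_on ball 0 1" unfolding R_def using c by (intro holomorphic_intros \<tau>) auto
  have main: "cmod (\<phi> w - w) \<le> 6 * (1 - r) / (1 - cmod w)" if w: "w \<in> ball 0 1" for w
  proof -
    define x where "x = cmod w"
    have x: "0 \<le> x" "x < 1" using w by (auto simp: x_def)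
    have "cmod (R w) \<le> (1 + x) / (1 - x)" unfolding x_def
      by (rule half_plane_bounds(1)[OF holR R0 _ R_pos w]) auto
    moreover have "cmod (R w) = cmod (1 - \<tau> w + of_real (1 - r)) / c" using c by (simp add: R_def norm_divide)
    ultimately have "cmod (1 - \<tau> w + of_real (1 - r)) \<le> c * ((1 + x) / (1 - x))"
      using c by (simp add: field_simps)
    also have "\<dots> \<le> 2 * (1 - r) * (2 / (1 - x))"
      using c x r by (intro mult_mono divide_right_mono) auto
    finally have a: "cmod (1 - \<tau> w + of_real (1 - r)) \<le> 4 * (1 - r) / (1 - x)" by simp
    have "1 - \<tau> w = (1 - \<tau> w + of_real (1 - r)) - of_real (1 - r)" by simp
    then have "cmod (1 - \<tau> w) \<le> cmod (1 - \<tau> w + of_real (1 - r)) + cmod (of_real (1 - r) :: complex)"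
      by (metis norm_triangle_ineq4)
    then have "cmod (1 - \<tau> w) \<le> 4 * (1 - r) / (1 - x) + (1 - r)" using a r by (simp del: of_real_diff)
    also have "\<dots> \<le> 4 * (1 - r) / (1 - x) + 2 * (1 - r) / (1 - x)"
    proof -
      have "(1 - r) * (1 - x) \<le> (1 - r) * 2" using x r by (intro mult_left_mono) auto
      then have "1 - r \<le> 2 * (1 - r) / (1 - x)" using x by (subst pos_le_divide_eq) auto
      then show ?thesis by simp
    qed
    also have "\<dots> = 6 * (1 - r) / (1 - x)" by (simp add: add_divide_distrib[symmetric])
    finally have b: "cmod (1 - \<tau> w) \<le> 6 * (1 - r) / (1 - x)" .
    have "\<phi> w - w = - (w * (1 - \<tau> w))" using \<tau>(2)[of w] w by (simp add: algebra_simps)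
    then have "cmod (\<phi> w - w) = x * cmod (1 - \<tau> w)" by (simp add: norm_mult x_def)
    also have "\<dots> \<le> 1 * cmod (1 - \<tau> w)" using x by (intro mult_right_mono) auto
    finally show ?thesis using b by (simp add: x_def)
  qed
  then show "cmod (\<phi> z - z) \<le> 6 * (1 - r) / (1 - cmod z)" using z .
  \<comment> \<open>On the circle of radius \<rho> about \<open>z\<close> the distance to the unit
    circle is still at least \<rho>. This turns 6 into 12, and the division by \<rho> in Cauchy's
    inequality turns 12 into 24.\<close>
  define \<rho> where "\<rho> = (1 - cmod z) / 2"
  have \<rho>: "0 < \<rho>" using z by (simp add: \<rho>_def)
  have sub: "cball z \<rho> \<subseteq> ball 0 1"
  proof
    fix w assume "w \<in> cball z \<rho>"
    then have "cmod w \<le> cmod z + \<rho>" using norm_triangle_ineq2[of w z] by (simp add: dist_norm norm_minus_commute)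
    then show "w \<in> ball 0 1" using z by (simp add: \<rho>_def field_simps)
  qed
  have hold: "(\<lambda>w. \<phi> w - w) holomorphic_on cball z \<rho>"
    by (intro holomorphic_intros holomorphic_on_subset[OF holo sub])
  have "cmod ((deriv ^^ 1) (\<lambda>w. \<phi> w - w) z) \<le> fact 1 * (12 * (1 - r) / (1 - cmod z)) / \<rho> ^ 1"
  proof (rule Cauchy_inequality)
    show "(\<lambda>w. \<phi> w - w) holomorphic_on ball z \<rho>" by (rule holomorphic_on_subset[OF hold ball_subset_cball])
    show "continuous_on (cball z \<rho>) (\<lambda>w. \<phi> w - w)" by (rule holomorphic_on_imp_continuous_on[OF hold])
    show "cmod (\<phi> w - w) \<le> 12 * (1 - r) / (1 - cmod z)" if "cmod (z - w) = \<rho>" for w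
    proof -
      have w: "w \<in> ball 0 1" using sub that by (auto simp: dist_norm)
      have "cmod w \<le> cmod z + \<rho>" using norm_triangle_ineq2[of w z] that by (simp add: norm_minus_commute)
      then have "1 - cmod w \<ge> \<rho>" by (simp add: \<rho>_def field_simps)
      then have "6 * (1 - r) / (1 - cmod w) \<le> 6 * (1 - r) / \<rho>" using \<rho> r by (intro divide_left_mono mult_pos_pos) auto
      also have "\<dots> = 12 * (1 - r) / (1 - cmod z)" by (simp add: \<rho>_def)
      finally show ?thesis using main[OF w] by linarith
    qed
  qed (rule \<rho>)
  moreover have "deriv (\<lambda>w. \<phi> w - w) z = deriv \<phi> z - 1"
    using holomorphic_derivI[OF holo open_ball z] by (intro DERIV_imp_deriv) (auto intro!: derivative_eq_intros)
  ultimately show "cmod (deriv \<phi> z - 1) \<le> 24 * (1 - r) / (1 - cmod z)\<^sup>2"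
    by (simp add: \<rho>_def power2_eq_square)
qed

section \<open>Crossing paths and radial limits\<close>

text \<open>The Cayley map with pole \<open>cis t0\<close> unrolls the circle onto the real line by
  an increasing tangent, so that cyclic order becomes linear order.\<close>

lemma cayley_cis:
  fixes t t0 :: real
  assumes "t < t0" "t0 < t + 2*pi"
  shows "\<i> * (1 + cis (t - t0)) / (1 - cis (t - t0)) = of_real (tan ((t - t0 + pi) / 2))"
    and "cis t \<noteq> cis t0"
proof -
  define u where "u = (t - t0 + pi) / 2"
  have u: "- (pi/2) < u" "u < pi/2" using assms by (auto simp: u_def)
  have c: "cos u > 0" using u by (intro cos_gt_zero_pi) auto
  have eq: "cis (t - t0) = - cis (2 * u)"
  proof -
    have "2 * u = (t - t0) + pi" by (simp add: u_def)
    then show ?thesis by (simp only: cis_mult[symmetric]) simp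
  qed
  have e2: "cis (2*u) = cis u * cis u" by (simp add: cis_mult)
  have one: "cis u * cis (-u) = 1" by (simp add: cis_mult)
  have d: "1 + cis (2*u) = cis u * (2 * of_real (cos u))"
    unfolding complex_eq_iff by (simp add: cos_double_cos sin_double power2_eq_square)
  have n: "1 - cis (2*u) = cis u * (- 2 * \<i> * of_real (sin u))"
    unfolding complex_eq_iff by (simp add: cos_double_sin sin_double power2_eq_square)
  have "\<i> * (1 + cis (t - t0)) / (1 - cis (t - t0)) = \<i> * (1 - cis (2*u)) / (1 + cis (2*u))"
    by (simp add: eq)
  also have "\<dots> = of_real (tan u)"
    using c by (simp only: d n tan_def) (simp add: field_simps)
  finally show "\<i> * (1 + cis (t - t0)) / (1 - cis (t - t0)) = of_real (tan ((t - t0 + pi) / 2))"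
    by (simp add: u_def)
  have "1 - cis (t - t0) \<noteq> 0"
    using c by (simp only: eq) (simp add: d)
  then show "cis t \<noteq> cis t0"
    by (metis cis_divide cis_neq_zero diff_self divide_self_if)
qed

lemma Im_cayley:
  fixes z :: complex
  assumes "cmod z \<le> 1"
  shows "0 \<le> Im (\<i> * (1 + z) / (1 - z))"
proof -
  have "Im (\<i> * (1 + z) / (1 - z)) = (1 - (cmod z)\<^sup>2) / (cmod (1 - z))\<^sup>2"
    unfolding Im_divide cmod_power2 by (simp add: power2_eq_square algebra_simps)
  also have "\<dots> \<ge> 0" using assms by (simp add: power_le_one)
  finally show ?thesis .
qed

text \<open>The paths are carried to the closed upper half-plane, where their end points interlace
  on the real axis. A box standing on the axis has them on its bottom side, which is the setting of
  \<open>fashoda_interlace\<close>.\<close>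

lemma crossing_in_disc:
  fixes g1 g2 :: "real \<Rightarrow> complex"
  assumes "path g1" "path g2"
    and im1: "path_image g1 \<subseteq> cball 0 1" and im2: "path_image g2 \<subseteq> cball 0 1"
    and ends: "pathstart g1 = cis t1" "pathstart g2 = cis t2" "pathfinish g1 = cis t3" "pathfinish g2 = cis t4"
    and ord: "t1 < t2" "t2 < t3" "t3 < t4" "t4 < t1 + 2*pi"
    and sph1: "path_image g1 \<inter> sphere 0 1 \<subseteq> {cis t1, cis t3}"
    and sph2: "path_image g2 \<inter> sphere 0 1 \<subseteq> {cis t2, cis t4}"
  shows "path_image g1 \<inter> path_image g2 \<noteq> {}"
proof -
  \<comment> \<open>Midpoint of the arc from \<open>t4\<close> to \<open>t1 + 2*pi\<close>. The
    paths touch the circle only at their end points, so both avoid the pole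
    \<open>cis t0\<close>.\<close>
  define t0 where "t0 = (t4 + t1) / 2 + pi"
  have t0: "t1 < t0" "t2 < t0" "t3 < t0" "t4 < t0" "t0 < t1 + 2*pi" "t0 < t2 + 2*pi" "t0 < t3 + 2*pi" "t0 < t4 + 2*pi"
    using ord pi_gt_zero by (auto simp: t0_def field_simps)
  note ne = cayley_cis(2)[OF t0(1,5)] cayley_cis(2)[OF t0(2,6)] cayley_cis(2)[OF t0(3,7)] cayley_cis(2)[OF t0(4,8)]
  have av1: "z \<noteq> cis t0" if "z \<in> path_image g1" for z
    using sph1 that ne by fastforce
  have av2: "z \<noteq> cis t0" if "z \<in> path_image g2" for z
    using sph2 that ne by fastforce
  define C where "C z = \<i> * (1 + z * cis (-t0)) / (1 - z * cis (-t0))" for z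
  define V :: "complex \<Rightarrow> real^2" where "V z = vector [Re (C z), Im (C z)]" for z
  have den: "1 - z * cis (-t0) \<noteq> 0" if "z \<noteq> cis t0" for z
    using that by (simp add: cis_mult cis_inverse[symmetric] field_simps)
  have V1: "V z $ 1 = Re (C z)" and V2: "V z $ 2 = Im (C z)" for z
    by (simp_all add: V_def)
  have V_eq: "V = (\<lambda>z. (Re (C z)) *\<^sub>R axis 1 1 + (Im (C z)) *\<^sub>R axis 2 1)"
    by (simp add: fun_eq_iff vec_eq_iff V_def axis_def forall_2)
  have contV: "continuous_on S V" if "cis t0 \<notin> S" for S
    unfolding V_eq C_def using that by (intro continuous_intros ballI den) auto
  have pV1: "path (V \<circ> g1)" and pV2: "path (V \<circ> g2)"
    using assms(1,2) av1 av2 by (auto intro!: path_continuous_image contV)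
  have "compact (path_image (V \<circ> g1) \<union> path_image (V \<circ> g2))"
    using pV1 pV2 by auto
  then obtain M where M: "\<And>x. x \<in> path_image (V \<circ> g1) \<union> path_image (V \<circ> g2) \<Longrightarrow> norm x \<le> M"
    by (meson bounded_iff compact_imp_bounded)
  define a :: "real^2" where "a = vector [-M, 0]"
  define b :: "real^2" where "b = vector [M, M]"
  have ImC: "Im (C z) \<ge> 0" if "z \<in> cball 0 1" for z
    using Im_cayley[of "z * cis (-t0)"] that by (simp add: C_def norm_mult)
  have box: "V z \<in> cbox a b" if "z \<in> path_image g1 \<union> path_image g2" for z
  proof -
    have "norm (V z) \<le> M" using M that by (auto simp: path_image_compose)
    moreover have "\<bar>V z $ i\<bar> \<le> norm (V z)" for i by (rule component_le_norm_cart)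
    ultimately have "\<bar>V z $ 1\<bar> \<le> M" "\<bar>V z $ 2\<bar> \<le> M" by (meson order_trans)+
    moreover have "V z $ 2 \<ge> 0" using that im1 im2 by (auto simp: V2 intro!: ImC)
    ultimately show ?thesis by (auto simp: a_def b_def mem_box_cart forall_2)
  qed
  have Ccis: "C (cis t) = of_real (tan ((t - t0 + pi) / 2))" if "t < t0" "t0 < t + 2*pi" for t
    using cayley_cis(1)[OF that] by (simp add: C_def cis_mult)
  have Cmono: "Re (C (cis s)) < Re (C (cis t))" if "s < t" "t < t0" "t0 < s + 2*pi" for s t
    using that by (auto simp: Ccis intro!: tan_monotone)
  obtain x where "x \<in> path_image (V \<circ> g1)" "x \<in> path_image (V \<circ> g2)"
  proof (rule fashoda_interlace[of "V \<circ> g1" "V \<circ> g2" a b])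
    show "path_image (V \<circ> g1) \<subseteq> cbox a b" "path_image (V \<circ> g2) \<subseteq> cbox a b"
      using box by (auto simp: path_image_compose)
  qed (use pV1 pV2 t0 ord in \<open>auto simp: pathstart_compose pathfinish_compose ends V1 V2 Ccis a_def intro!: tan_monotone\<close>)
  then obtain z1 z2 where z: "z1 \<in> path_image g1" "z2 \<in> path_image g2" "V z1 = V z2"
    by (auto simp: path_image_compose)
  then have "C z1 = C z2" by (metis V1 V2 complex_eqI)
  then have "(1 + z1 * cis (-t0)) * (1 - z2 * cis (-t0)) = (1 + z2 * cis (-t0)) * (1 - z1 * cis (-t0))"
    using den[OF av1[OF z(1)]] den[OF av2[OF z(2)]] by (simp add: C_def field_simps)
  then have "z1 * cis (-t0) = z2 * cis (-t0)" by (simp add: algebra_simps)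
  then have "z1 = z2" by simp
  then show ?thesis using z by auto
qed

text \<open>If the limits alternated about \<open>c\<close>, the radii at \<open>t1\<close>,
  \<open>t3\<close> could be joined inside v > c and those at \<open>t2\<close>, \<open>t4\<close>
  inside v < c. Two such paths must cross, but these sets are disjoint.\<close>

lemma radial_limits_not_alternating:
  fixes v :: "complex \<Rightarrow> real"
  assumes conn: "path_connected {z\<in>ball 0 1. v z > c}" "path_connected {z\<in>ball 0 1. v z < c}"
    and lim: "((\<lambda>\<rho>. v (of_real \<rho> * cis t1)) \<longlongrightarrow> L1) (at_left 1)"
      "((\<lambda>\<rho>. v (of_real \<rho> * cis t2)) \<longlongrightarrow> L2) (at_left 1)"
      "((\<lambda>\<rho>. v (of_real \<rho> * cis t3)) \<longlongrightarrow> L3) (at_left 1)"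
      "((\<lambda>\<rho>. v (of_real \<rho> * cis t4)) \<longlongrightarrow> L4) (at_left 1)"
    and ord: "t1 < t2" "t2 < t3" "t3 < t4" "t4 < t1 + 2*pi"
  shows "\<not> (L1 > c \<and> L2 < c \<and> L3 > c \<and> L4 < c)"
proof -
  have path: "\<exists>g. path g \<and> pathstart g = cis s \<and> pathfinish g = cis t \<and>
      path_image g \<inter> sphere 0 1 \<subseteq> {cis s, cis t} \<and> path_image g \<subseteq> X \<union> {cis s, cis t}"
    if X: "path_connected X" "X \<subseteq> ball 0 1"
      and s: "\<forall>\<^sub>F \<rho> in at_left 1. of_real \<rho> * cis s \<in> X"
      and t: "\<forall>\<^sub>F \<rho> in at_left 1. of_real \<rho> * cis t \<in> X" for X :: "complex set" and s t :: real
  proof -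
    obtain a where a: "a < 1" "\<And>\<rho>. a < \<rho> \<Longrightarrow> \<rho> < 1 \<Longrightarrow> of_real \<rho> * cis s \<in> X"
      using s unfolding eventually_at_left_field by blast
    obtain b where b: "b < 1" "\<And>\<rho>. b < \<rho> \<Longrightarrow> \<rho> < 1 \<Longrightarrow> of_real \<rho> * cis t \<in> X"
      using t unfolding eventually_at_left_field by blast
    \<comment> \<open>From this radius on, both radii stay in \<open>X\<close>; a path in
      \<open>X\<close> joins the two inner points, and radial segments lead out to the
      circle.\<close>
    define r where "r = (max (max a b) 0 + 1) / 2"
    have r: "r < 1" "a < r" "b < r" "0 < r" using a b by (auto simp: r_def)
    have seg: "path_image (linepath (cis u) (of_real r * cis u)) \<subseteq> X \<union> {cis u}"
      if "\<And>\<rho>. r \<le> \<rho> \<Longrightarrow> \<rho> < 1 \<Longrightarrow> of_real \<rho> * cis u \<in> X" for u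
    proof -
      have "linepath (cis u) (of_real r * cis u) x \<in> X \<union> {cis u}" if x: "x \<in> {0..1}" for x
      proof -
        have "linepath (cis u) (of_real r * cis u) x = of_real (1 - x * (1 - r)) * cis u"
          by (simp add: linepath_def algebra_simps scaleR_conv_of_real)
        moreover have "r \<le> 1 - x * (1 - r)"
        proof -
          have "x * (1 - r) \<le> 1 - r" using x r by (intro mult_left_le_one_le) auto
          then show ?thesis by simp
        qed
        ultimately show ?thesis
          using \<open>\<And>\<rho>. r \<le> \<rho> \<Longrightarrow> \<rho> < 1 \<Longrightarrow> of_real \<rho> * cis u \<in> X\<close>[of "1 - x * (1 - r)"] r x
          by (cases "x = 0") (auto simp: linepath_def)
      qed
      then show ?thesis unfolding path_image_def by blast
    qed
    have "of_real r * cis s \<in> X" "of_real r * cis t \<in> X" using a b r by auto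
    then have "\<exists>g. path g \<and> path_image g \<subseteq> X \<and> pathstart g = of_real r * cis s \<and> pathfinish g = of_real r * cis t"
      using X(1) by (simp only: path_connected_def)
    then obtain g where g: "path g" "path_image g \<subseteq> X" "pathstart g = of_real r * cis s" "pathfinish g = of_real r * cis t"
      by (elim exE conjE) (rule that)
    define G where "G = linepath (cis s) (of_real r * cis s) +++ (g +++ reversepath (linepath (cis t) (of_real r * cis t)))"
    have 1: "path_image (linepath (cis s) (of_real r * cis s)) \<subseteq> X \<union> {cis s, cis t}"
      using seg[of s] a r by auto
    have 2: "path_image (reversepath (linepath (cis t) (of_real r * cis t))) \<subseteq> X \<union> {cis s, cis t}"
      unfolding path_image_reversepath using seg[of t] b r by auto
    have 3: "path_image g \<subseteq> X \<union> {cis s, cis t}"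
      using g(2) by (rule le_supI1)
    have G: "path_image G \<subseteq> X \<union> {cis s, cis t}"
      unfolding G_def by (intro subset_path_image_join 1 2 3)
    have "path G" "pathstart G = cis s" "pathfinish G = cis t" using g by (auto simp: G_def)
    moreover have "X \<inter> sphere 0 1 = {}"
      using X(2) by force
    then have "path_image G \<inter> sphere 0 1 \<subseteq> {cis s, cis t}"
      using G by blast
    ultimately show ?thesis using G by blast
  qed
  have main: False
    if P: "path_connected X" "path_connected Y" "X \<subseteq> ball 0 1" "Y \<subseteq> ball 0 1" "X \<inter> Y = {}"
      and ev: "\<forall>\<^sub>F \<rho> in at_left 1. of_real \<rho> * cis t1 \<in> X" "\<forall>\<^sub>F \<rho> in at_left 1. of_real \<rho> * cis t2 \<in> Y"
        "\<forall>\<^sub>F \<rho> in at_left 1. of_real \<rho> * cis t3 \<in> X" "\<forall>\<^sub>F \<rho> in at_left 1. of_real \<rho> * cis t4 \<in> Y" for X Y :: "complex set"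
  proof -
    obtain g where g: "path g" "pathstart g = cis t1" "pathfinish g = cis t3"
      "path_image g \<inter> sphere 0 1 \<subseteq> {cis t1, cis t3}" "path_image g \<subseteq> X \<union> {cis t1, cis t3}"
      using path[OF P(1,3) ev(1,3)] by blast
    obtain k where k: "path k" "pathstart k = cis t2" "pathfinish k = cis t4"
      "path_image k \<inter> sphere 0 1 \<subseteq> {cis t2, cis t4}" "path_image k \<subseteq> Y \<union> {cis t2, cis t4}"
      using path[OF P(2,4) ev(2,4)] by blast
    have "path_image g \<inter> path_image k \<noteq> {}"
    proof (rule crossing_in_disc[OF g(1) k(1) _ _ g(2) k(2) g(3) k(3) ord g(4) k(4)])
      have "cis t \<in> cball 0 1" "X \<subseteq> cball 0 1" "Y \<subseteq> cball 0 1" for t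
        using P(3,4) ball_subset_cball by (auto simp: subset_iff)
      then show "path_image g \<subseteq> cball 0 1" "path_image k \<subseteq> cball 0 1"
        using g(5) k(5) by (auto simp: subset_iff)
    qed
    then obtain x where x: "x \<in> path_image g" "x \<in> path_image k" by blast
    have n: "cis t1 \<noteq> cis t2" "cis t1 \<noteq> cis t4" "cis t3 \<noteq> cis t4" "cis t2 \<noteq> cis t3"
      using cayley_cis(2)[of t1 t2] cayley_cis(2)[of t1 t4] cayley_cis(2)[of t3 t4] cayley_cis(2)[of t2 t3] ord by auto
    have m: "cis t \<notin> X" "cis t \<notin> Y" for t using P(3,4) by (auto simp: subset_iff)
    have "x \<in> X \<or> x = cis t1 \<or> x = cis t3" using g(5) x(1) by auto
    moreover have "x \<in> Y \<or> x = cis t2 \<or> x = cis t4" using k(5) x(2) by auto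
    moreover have "x \<notin> X \<or> x \<notin> Y" using P(5) by auto
    ultimately show False using n m by (elim disjE) simp_all
  qed
  have in_disc: "\<forall>\<^sub>F \<rho> in at_left (1::real). of_real \<rho> * cis t \<in> ball 0 1" for t
    unfolding eventually_at_left_field by (rule exI[of _ 0]) (auto simp: norm_mult)
  have ev_gt: "\<forall>\<^sub>F \<rho> in at_left 1. of_real \<rho> * cis t \<in> {z\<in>ball 0 1. v z > c}"
    if "((\<lambda>\<rho>. v (of_real \<rho> * cis t)) \<longlongrightarrow> L) (at_left 1)" "L > c" for t L
    using order_tendstoD(1)[OF that] in_disc[of t] by eventually_elim simp
  have ev_lt: "\<forall>\<^sub>F \<rho> in at_left 1. of_real \<rho> * cis t \<in> {z\<in>ball 0 1. v z < c}"
    if "((\<lambda>\<rho>. v (of_real \<rho> * cis t)) \<longlongrightarrow> L) (at_left 1)" "L < c" for t L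
    using order_tendstoD(2)[OF that] in_disc[of t] by eventually_elim simp
  show "\<not> (L1 > c \<and> L2 < c \<and> L3 > c \<and> L4 < c)"
  proof
    assume h: "L1 > c \<and> L2 < c \<and> L3 > c \<and> L4 < c"
    show False
      by (rule main[OF conn _ _ _ ev_gt[OF lim(1)] ev_lt[OF lim(2)] ev_gt[OF lim(3)] ev_lt[OF lim(4)]]) (use h in auto)
  qed
qed

section \<open>Unimodal boundary values\<close>

text \<open>Radial limits exist only on a set \<open>A\<close> of full measure, whereas the second
  mean value theorem wants a function that is monotone on a whole interval. A running supremum fills
  the gaps; \<open>a\<close> in \<open>A\<close> keeps it nonempty and \<open>b\<close> in
  \<open>A\<close> keeps it bounded.\<close>

lemma monotone_extension:
  fixes f :: "real \<Rightarrow> real"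
  assumes "a \<in> A" "\<And>s t. \<lbrakk>s \<in> A; t \<in> A; a \<le> s; s \<le> t; t \<le> b\<rbrakk> \<Longrightarrow> f s \<le> f t" "b \<in> A"
  obtains w where "\<And>s t. \<lbrakk>a \<le> s; s \<le> t; t \<le> b\<rbrakk> \<Longrightarrow> w s \<le> w t"
    "\<And>t. \<lbrakk>t \<in> A; a \<le> t; t \<le> b\<rbrakk> \<Longrightarrow> w t = f t"
proof
  define w where "w t = (SUP s\<in>A \<inter> {a..t}. f s)" for t
  have bdd: "bdd_above (f ` (A \<inter> {a..t}))" if "t \<le> b" for t
    using assms that by (intro bdd_aboveI[of _ "f b"]) auto
  show "w s \<le> w t" if "a \<le> s" "s \<le> t" "t \<le> b" for s t
    unfolding w_def using that assms by (intro cSUP_subset_mono bdd) auto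
  show "w t = f t" if "t \<in> A" "a \<le> t" "t \<le> b" for t
    unfolding w_def using that assms(2) by (intro cSup_eq_maximum) auto
qed

text \<open>Truncating \<open>L\<close> at two values \<open>L a\<close>, \<open>L b\<close> close to its infimum and supremum makes it monotone on both
  arcs, since a violation would alternate with \<open>a\<close> and \<open>b\<close>.\<close>

lemma unimodal_approximation:
  fixes L :: "real \<Rightarrow> real"
  assumes per: "\<And>t. t \<in> A \<Longrightarrow> t + 2*pi \<in> A" "\<And>t. t \<in> A \<Longrightarrow> t - 2*pi \<in> A"
    and Lper: "\<And>t. t \<in> A \<Longrightarrow> L (t + 2*pi) = L t"
    and two: "s0 \<in> A" "t0 \<in> A" "s0 < t0" "t0 < s0 + 2*pi"
    and bdd: "\<And>t. t \<in> A \<Longrightarrow> \<bar>L t\<bar> \<le> B"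
    and alt: "\<And>c t1 t2 t3 t4. \<lbrakk>{t1,t2,t3,t4} \<subseteq> A; t1 < t2; t2 < t3; t3 < t4; t4 < t1 + 2*pi\<rbrakk> \<Longrightarrow>
        \<not> (L t1 > c \<and> L t2 < c \<and> L t3 > c \<and> L t4 < c)"
    and "\<epsilon> > 0"
  obtains a b w1 w2 where "a < b" "b < a + 2*pi"
    "\<And>s t. \<lbrakk>a \<le> s; s \<le> t; t \<le> b\<rbrakk> \<Longrightarrow> w1 s \<le> w1 t"
    "\<And>s t. \<lbrakk>b \<le> s; s \<le> t; t \<le> a + 2*pi\<rbrakk> \<Longrightarrow> w2 t \<le> (w2 s :: real)"
    "\<And>t. \<lbrakk>t \<in> A; a \<le> t; t \<le> b\<rbrakk> \<Longrightarrow> \<bar>L t - w1 t\<bar> \<le> \<epsilon>"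
    "\<And>t. \<lbrakk>t \<in> A; b \<le> t; t \<le> a + 2*pi\<rbrakk> \<Longrightarrow> \<bar>L t - w2 t\<bar> \<le> \<epsilon>"
proof -
  have shift_int: "t + of_int k * (2*pi) \<in> A \<and> L (t + of_int k * (2*pi)) = L t" if "t \<in> A" for t k
  proof (induction k rule: int_induct[where k=0])
    case base
    then show ?case using that by simp
  next
    case (step1 i)
    then show ?case using per(1)[of "t + of_int i * (2*pi)"] Lper[of "t + of_int i * (2*pi)"] by (simp add: algebra_simps)
  next
    case (step2 i)
    then show ?case using per(2)[of "t + of_int i * (2*pi)"] Lper[of "t + of_int i * (2*pi) - 2*pi"] by (simp add: algebra_simps)
  qed
  have shift: "\<exists>t'\<in>A. s \<le> t' \<and> t' < s + 2*pi \<and> L t' = L t" if "t \<in> A" for s t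
  proof -
    define k where "k = \<lceil>(s - t) / (2*pi)\<rceil>"
    have "(s - t) / (2*pi) \<le> of_int k" "of_int k < (s - t) / (2*pi) + 1"
      unfolding k_def by linarith+
    then have "s - t \<le> of_int k * (2*pi)" "of_int k * (2*pi) < s - t + 2*pi"
      by (simp_all add: field_simps)
    then show ?thesis using shift_int[OF that, of k] by (intro bexI[of _ "t + of_int k * (2*pi)"]) auto
  qed
  have ne: "L ` A \<noteq> {}" using two by auto
  have ba: "bdd_above (L ` A)" using bdd by (intro bdd_aboveI[of _ B]) (auto simp: abs_le_iff)
  have bb: "bdd_below (L ` A)" using bdd by (intro bdd_belowI[of _ "-B"]) (force simp: abs_le_iff)
  obtain a where a: "a \<in> A" "L a < Inf (L ` A) + \<epsilon>"
    using cInf_lessD[OF ne, of "Inf (L ` A) + \<epsilon>"] \<open>\<epsilon> > 0\<close> by auto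
  obtain b0 where b0: "b0 \<in> A" "L b0 > Sup (L ` A) - \<epsilon>"
    using less_cSupD[OF ne, of "Sup (L ` A) - \<epsilon>"] \<open>\<epsilon> > 0\<close> by auto
  obtain b1 where b1: "b1 \<in> A" "a \<le> b1" "b1 < a + 2*pi" "L b1 = L b0" using shift[OF b0(1)] by blast
  have inf: "Inf (L ` A) \<le> L t" and sup: "L t \<le> Sup (L ` A)" if "t \<in> A" for t
    using that ba bb by (auto intro: cInf_lower cSup_upper)
  \<comment> \<open>If the near-minimal and the near-maximal point coincide modulo 2 pi, then
    \<open>L a\<close> is within \<epsilon> of both the infimum and the supremum, and a constant
    serves on both arcs.\<close>
  consider (flat) "\<And>t. t \<in> A \<Longrightarrow> \<bar>L t - L a\<bar> \<le> \<epsilon>"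
    | (main) b where "b \<in> A" "a < b" "b < a + 2*pi" "L b > Sup (L ` A) - \<epsilon>"
  proof (cases "b1 = a")
    case True
    then have "L a = L b0" using b1 by simp
    then have "\<bar>L t - L a\<bar> \<le> \<epsilon>" if "t \<in> A" for t
      using inf[OF that] sup[OF that] a b0 by linarith
    then show ?thesis using that(1) by blast
  next
    case False
    then show ?thesis using b1 b0 that(2)[of b1] by simp
  qed
  then show thesis
  proof cases
    case flat
    show ?thesis
      by (rule that[of a "a + pi" "\<lambda>_. L a" "\<lambda>_. L a"]) (use flat in auto)
  next
    case (main b)
    define f where "f t = max (L a) (min (L b) (L t))" for t
    have fL: "\<bar>L t - f t\<bar> \<le> \<epsilon>" if "t \<in> A" for t
      using inf[OF that] sup[OF that] inf[OF a(1)] sup[OF a(1)] inf[OF main(1)] sup[OF main(1)] a main \<open>\<epsilon> > 0\<close>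
      unfolding f_def max_def min_def by (auto split: if_splits)
    \<comment> \<open>A strict inequality between truncated values leaves a level \<open>c\<close>
      strictly between \<open>L a\<close> and \<open>L b\<close> that also separates the values of
      \<open>L\<close> itself. On either arc the two offending points, together with
      \<open>b\<close> and \<open>a + 2*pi\<close>, then alternate about \<open>c\<close>.\<close>
    have sep: "\<exists>c. L a < c \<and> c < L b \<and> L t < c \<and> c < L s" if "f t < f s" "s \<in> A" "t \<in> A" for s t
    proof -
      obtain c where "f t < c" "c < f s" using dense \<open>f t < f s\<close> by blast
      then show ?thesis
        by (intro exI[of _ c]) (auto simp: f_def max_def min_def split: if_splits)
    qed
    have a2: "a + 2*pi \<in> A" "L (a + 2*pi) = L a" using per Lper a by auto
    have m1: "f s \<le> f t" if "s \<in> A" "t \<in> A" "a \<le> s" "s \<le> t" "t \<le> b" for s t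
    proof (rule ccontr)
      assume "\<not> f s \<le> f t"
      then have "f t < f s" by simp
      from sep[OF this that(1,2)] obtain c where c: "L a < c" "c < L b" "L t < c" "c < L s" by blast
      then have "a < s" "s < t" "t < b" using that by (smt (verit))+
      then show False using alt[of s t b "a + 2*pi" c] c that a2 main by auto
    qed
    have m2: "f t \<le> f s" if "s \<in> A" "t \<in> A" "b \<le> s" "s \<le> t" "t \<le> a + 2*pi" for s t
    proof (rule ccontr)
      assume "\<not> f t \<le> f s"
      then have "f s < f t" by simp
      from sep[OF this that(2,1)] obtain c where c: "L a < c" "c < L b" "L s < c" "c < L t" by blast
      then have "b < s" "s < t" "t < a + 2*pi" using that a2 by (smt (verit))+
      then show False using alt[of b s t "a + 2*pi" c] c that a2 main by auto
    qed
    obtain w1 where w1: "\<And>s t. \<lbrakk>a \<le> s; s \<le> t; t \<le> b\<rbrakk> \<Longrightarrow> w1 s \<le> w1 t"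
      "\<And>t. \<lbrakk>t \<in> A; a \<le> t; t \<le> b\<rbrakk> \<Longrightarrow> w1 t = f t"
      by (rule monotone_extension[of a A b f]) (use a main m1 in auto)
    obtain w2 where w2: "\<And>s t. \<lbrakk>b \<le> s; s \<le> t; t \<le> a + 2*pi\<rbrakk> \<Longrightarrow> w2 s \<le> w2 t"
      "\<And>t. \<lbrakk>t \<in> A; b \<le> t; t \<le> a + 2*pi\<rbrakk> \<Longrightarrow> w2 t = - f t"
      by (rule monotone_extension[of b A "a + 2*pi" "\<lambda>t. - f t"]) (use a2 main m2 in auto)
    show ?thesis
      by (rule that[of a b w1 "\<lambda>t. - w2 t"]) (use main w1 w2 fL in auto)
  qed
qed

text \<open>Integration by parts against a monotone \<open>w\<close> that need not even be
  continuous: the second mean value theorem evaluates the integral as (w a - w b) \<Psi>(c) for some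
  intermediate c.\<close>

lemma integral_mono_times_deriv_nonpos:
  fixes w \<Psi> :: "real \<Rightarrow> real"
  assumes "a \<le> b" and mono: "\<And>s t. \<lbrakk>a \<le> s; s \<le> t; t \<le> b\<rbrakk> \<Longrightarrow> w s \<le> w t"
    and deriv: "\<And>t. (\<Psi> has_real_derivative \<Psi>' t) (at t)"
    and ends: "\<Psi> a = 0" "\<Psi> b = 0" and nonneg: "\<And>t. \<lbrakk>a \<le> t; t \<le> b\<rbrakk> \<Longrightarrow> \<Psi> t \<ge> 0"
  obtains I where "((\<lambda>t. w t * \<Psi>' t) has_integral I) {a..b}" "I \<le> 0"
proof -
  have int: "(\<Psi>' has_integral (\<Psi> t - \<Psi> s)) {s..t}" if "s \<le> t" for s t
    using that deriv by (intro fundamental_theorem_of_calculus)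
      (auto simp: has_real_derivative_iff_has_vector_derivative[symmetric] intro: has_field_derivative_at_within)
  obtain c where c: "c \<in> {a..b}"
    "((\<lambda>t. w t * \<Psi>' t) has_integral (w a * integral {a..c} \<Psi>' + w b * integral {c..b} \<Psi>')) {a..b}"
    using second_mean_value_theorem_full[of \<Psi>' a b w] int[OF \<open>a \<le> b\<close>] mono \<open>a \<le> b\<close>
    by (metis has_integral_integrable)
  have "integral {a..c} \<Psi>' = \<Psi> c" "integral {c..b} \<Psi>' = - \<Psi> c"
    using c int[of a c] int[of c b] ends by (auto intro!: integral_unique)
  then have "w a * integral {a..c} \<Psi>' + w b * integral {c..b} \<Psi>' = (w a - w b) * \<Psi> c"
    by (simp add: algebra_simps)
  also have "\<dots> \<le> 0"
    using c mono[of a b] nonneg \<open>a \<le> b\<close> by (intro mult_nonpos_nonneg) auto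
  finally show thesis using c that by blast
qed

section \<open>Poisson integrals and the half-plane inequality for unimodal boundary values\<close>

lemma Poisson_formula:
  assumes holo: "T holomorphic_on ball 0 R" and "R > 1" and z: "cmod z < 1"
  shows "((\<lambda>t. T (cis t) * of_real ((1 - (cmod z)\<^sup>2) / (cmod (cis t - z))\<^sup>2)) has_integral (2 * of_real pi * T z)) {0..2*pi}"
proof -
  have sub: "cball 0 1 \<subseteq> ball (0::complex) R" using \<open>R > 1\<close> by auto
  \<comment> \<open>The Cauchy kernel at \<open>z\<close> plus a term with its pole at the reflected
    point 1 / cnj z. The extra term integrates to 0, and on the circle the sum is the Poisson
    kernel.\<close>
  define K where "K w = T w / (w - z) + T w * cnj z / (1 - cnj z * w)" for w
  have den: "1 - cnj z * w \<noteq> 0" if "cmod w \<le> 1" for w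
  proof
    assume "1 - cnj z * w = 0"
    then have "cmod z * cmod w = 1" by (metis complex_mod_cnj eq_iff_diff_eq_0 norm_mult norm_one)
    moreover have "cmod z * cmod w \<le> cmod z * 1" using that by (intro mult_left_mono) auto
    ultimately show False using z by linarith
  qed
  have 1: "((\<lambda>w. T w / (w - z)) has_contour_integral (2 * of_real pi * \<i> * T z)) (circlepath 0 1)"
    using z holo sub by (intro Cauchy_integral_circlepath_simple)
      (auto intro: holomorphic_on_subset)
  have 2: "((\<lambda>w. T w * cnj z / (1 - cnj z * w)) has_contour_integral 0) (circlepath 0 1)"
  \<comment> \<open>The radius stops short of the reflected point. The case z = 0 is separate
    because division by 0 gives 0.\<close>
  proof (rule Cauchy_theorem_disc_simple[where a=0 and e="min R (if z = 0 then R else 1 / cmod z)"])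
    have "cmod w * cmod z < 1" if "cmod w < (if z = 0 then R else 1 / cmod z)" for w
      using that by (cases "z = 0") (auto simp: field_simps)
    then have "1 - cnj z * w \<noteq> 0" if "cmod w < (if z = 0 then R else 1 / cmod z)" for w
      using that by (metis complex_mod_cnj eq_iff_diff_eq_0 less_irrefl mult.commute norm_mult norm_one)
    then show "(\<lambda>w. T w * cnj z / (1 - cnj z * w)) holomorphic_on ball 0 (min R (if z = 0 then R else 1 / cmod z))"
      by (intro holomorphic_intros holomorphic_on_subset[OF holo]) auto
    show "path_image (circlepath 0 1) \<subseteq> ball 0 (min R (if z = 0 then R else 1 / cmod z))"
      using \<open>R > 1\<close> z by (auto simp: field_simps)
  qed auto
  have "(K has_contour_integral (2 * of_real pi * \<i> * T z)) (part_circlepath 0 1 0 (2*pi))"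
    using has_contour_integral_add[OF 1 2] by (simp add: K_def[abs_def] circlepath_def)
  then have "((\<lambda>t. K (cis t) * \<i> * cis t) has_integral (2 * of_real pi * \<i> * T z)) {0..2*pi}"
    by (subst (asm) has_contour_integral_part_circlepath_iff) auto
  then have "((\<lambda>t. - \<i> * (K (cis t) * \<i> * cis t)) has_integral - \<i> * (2 * of_real pi * \<i> * T z)) {0..2*pi}"
    by (rule has_integral_mult_right)
  moreover have "- \<i> * (x * \<i> * y) = x * y" for x y :: complex
    by (simp add: algebra_simps)
  ultimately have "((\<lambda>t. K (cis t) * cis t) has_integral (2 * of_real pi * T z)) {0..2*pi}"
    by simp
  moreover have "K (cis t) * cis t = T (cis t) * of_real ((1 - (cmod z)\<^sup>2) / (cmod (cis t - z))\<^sup>2)" for t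
  proof -
    have n1: "cis t - z \<noteq> 0" using z by (metis eq_iff_diff_eq_0 less_irrefl norm_cis)
    have n2: "1 - cnj z * cis t \<noteq> 0" using den by simp
    have cc: "cis t * cnj (cis t) = 1" by (simp add: complex_norm_square[symmetric])
    have e: "1 - cnj z * cis t = cis t * cnj (cis t - z)" using cc by (simp add: algebra_simps)
    have "K (cis t) * cis t = T (cis t) * (cis t * (1 - cnj z * cis t) + cnj z * cis t * (cis t - z)) / ((cis t - z) * (1 - cnj z * cis t))"
      using n1 n2 by (simp add: K_def field_simps)
    also have "cis t * (1 - cnj z * cis t) + cnj z * cis t * (cis t - z) = cis t * (1 - z * cnj z)"
      by (simp add: algebra_simps)
    also have "(cis t - z) * (1 - cnj z * cis t) = cis t * of_real ((cmod (cis t - z))\<^sup>2)"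
      by (simp only: e complex_norm_square mult.left_commute)
    also have "1 - z * cnj z = of_real (1 - (cmod z)\<^sup>2)"
      by (simp only: of_real_diff of_real_1 complex_norm_square)
    finally show ?thesis by simp
  qed
  ultimately show ?thesis by simp
qed

lemma Poisson_formula_shifted:
  assumes holo: "T holomorphic_on ball 0 R" and "R > 1" and z: "cmod z < 1"
  shows "((\<lambda>t. T (cis t) * of_real ((1 - (cmod z)\<^sup>2) / (cmod (cis t - z))\<^sup>2)) has_integral (2 * of_real pi * T z)) {a..a+2*pi}"
proof -
  have "(\<lambda>w. T (w * cis a)) holomorphic_on ball 0 R"
    by (rule holomorphic_on_compose_gen[unfolded o_def, OF _ holo]) (auto intro!: holomorphic_intros simp: norm_mult)
  from Poisson_formula[OF this \<open>R > 1\<close>, of "z * cis (-a)"] z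
  have "((\<lambda>t. T (cis t * cis a) * of_real ((1 - (cmod z)\<^sup>2) / (cmod (cis t - z * cis (-a)))\<^sup>2)) has_integral (2 * of_real pi * T z)) {0..2*pi}"
    by (simp add: norm_mult cis_mult mult.assoc)
  moreover have "cmod (cis t - z * cis (-a)) = cmod (cis (t + a) - z)" for t
  proof -
    have "cis (t + a) - z = cis a * (cis t - z * cis (-a))"
      by (simp add: algebra_simps cis_mult)
    then show ?thesis by (simp add: norm_mult)
  qed
  ultimately have "((\<lambda>t. T (cis (t + a)) * of_real ((1 - (cmod z)\<^sup>2) / (cmod (cis (t + a) - z))\<^sup>2)) has_integral (2 * of_real pi * T z)) {0..2*pi}"
    by (simp add: cis_mult)
  then show ?thesis
    by (subst has_integral_shift_real_ivl_iff[where c = a]) (simp add: add.commute)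
qed

text \<open>Formally, on the circle the real part in question is \<open>lam t\<close> times the
  derivative in t of Im B, and both factors change sign exactly at \<open>a\<close> and
  \<open>b\<close>, so the product is nonnegative and the Poisson formula carries this inside. Since
  the boundary values have no derivative in general, the argument is run on smaller circles after an
  integration by parts, and monotonicity enters through the second mean value theorem.\<close>

lemma half_plane_of_unimodal_boundary_values:
  fixes L w1 w2 :: "real \<Rightarrow> real"
  assumes holo: "B holomorphic_on ball 0 1" and bdd: "\<And>z. cmod z < 1 \<Longrightarrow> \<bar>Im (B z)\<bar> \<le> M"
    and lim: "\<And>t. t \<in> A \<Longrightarrow> ((\<lambda>\<rho>. Im (B (of_real \<rho> * cis t))) \<longlongrightarrow> L t) (at_left 1)"
    and neg: "negligible (- A)"
    and ab: "a < b" "b < a + 2*pi"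
    and w1: "\<And>s t. \<lbrakk>a \<le> s; s \<le> t; t \<le> b\<rbrakk> \<Longrightarrow> w1 s \<le> w1 t"
    and w2: "\<And>s t. \<lbrakk>b \<le> s; s \<le> t; t \<le> a + 2*pi\<rbrakk> \<Longrightarrow> w2 t \<le> w2 s"
    and L1: "\<And>t. \<lbrakk>t \<in> A; a \<le> t; t \<le> b\<rbrakk> \<Longrightarrow> \<bar>L t - w1 t\<bar> \<le> \<epsilon>"
    and L2: "\<And>t. \<lbrakk>t \<in> A; b \<le> t; t \<le> a + 2*pi\<rbrakk> \<Longrightarrow> \<bar>L t - w2 t\<bar> \<le> \<epsilon>"
    and z: "cmod z < 1" and "\<epsilon> > 0"
  shows "Re (cis (-(a+b)/2) * (z - cis a) * (z - cis b) * deriv B z) \<ge> - (20 * \<epsilon> / (1 - cmod z)^4)"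
proof -
  define \<kappa> where "\<kappa> = cis (-(a+b)/2)"
  \<comment> \<open>This is \<open>\<kappa> * (cis t - cis a) * (cis t - cis b)\<close> divided by
    \<open>cis t\<close>: the choice of \<kappa> makes it real, positive on (a, b) and negative on
    (b, a + 2 pi).\<close>
  define lam where "lam t = -4 * sin ((t-a)/2) * sin ((t-b)/2)" for t
  define lam' where "lam' t = -2 * (cos ((t-a)/2) * sin ((t-b)/2) + sin ((t-a)/2) * cos ((t-b)/2))" for t
  define D where "D t = (cos t - Re z)\<^sup>2 + (sin t - Im z)\<^sup>2" for t
  define D' where "D' t = 2 * (sin t * Re z - cos t * Im z)" for t
  define P where "P t = (1 - (cmod z)\<^sup>2) / D t" for t
  define P' where "P' t = - (1 - (cmod z)\<^sup>2) * D' t / (D t)\<^sup>2" for t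
  define \<Psi> where "\<Psi> t = lam t * P t" for t
  define \<Psi>' where "\<Psi>' t = lam' t * P t + lam t * P' t" for t
  define d where "d = 1 - cmod z"
  have d: "0 < d" "d \<le> 1" using z by (auto simp: d_def)
  have D_eq: "D t = (cmod (cis t - z))\<^sup>2" for t
    by (simp add: D_def cmod_power2)
  have D_ge: "D t \<ge> d\<^sup>2" for t
  proof -
    have "cmod (cis t - z) \<ge> d" using norm_triangle_ineq2[of "cis t" z] by (simp add: d_def)
    then show ?thesis using d by (simp add: D_eq power_mono)
  qed
  have D_pos: "D t > 0" for t using D_ge[of t] d by (meson less_le_trans zero_less_power)
  have num: "0 < 1 - (cmod z)\<^sup>2" "1 - (cmod z)\<^sup>2 \<le> 1"
    using z by (auto simp: abs_square_less_1 power_less_one_iff)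
  have dlam: "(lam has_real_derivative lam' t) (at t)" for t
    unfolding lam_def lam'_def by (auto intro!: derivative_eq_intros simp: field_simps)
  have dD: "(D has_real_derivative D' t) (at t)" for t
    unfolding D_def D'_def by (auto intro!: derivative_eq_intros simp: algebra_simps)
  have dP: "(P has_real_derivative P' t) (at t)" for t
    unfolding P_def P'_def using D_pos[of t] 
    by (auto intro!: derivative_eq_intros dD simp: field_simps power2_eq_square)
  have d\<Psi>: "(\<Psi> has_real_derivative \<Psi>' t) (at t)" for t
    unfolding \<Psi>_def \<Psi>'_def by (auto intro!: derivative_eq_intros dlam dP)
  \<comment> \<open>With \<open>d\<close> the distance of \<open>z\<close> to the circle,
    \<open>lam' * P\<close> contributes 4 / d^4 and \<open>lam * P'\<close> contributes 16 /
    d^4.\<close>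
  define K where "K = 20 / d^4"
  have \<Psi>'_bound: "\<bar>\<Psi>' t\<bar> \<le> K" for t
  proof -
    have l': "\<bar>lam' t\<bar> \<le> 4"
    proof -
      have "\<bar>cos ((t-a)/2) * sin ((t-b)/2)\<bar> \<le> 1 * 1" "\<bar>sin ((t-a)/2) * cos ((t-b)/2)\<bar> \<le> 1 * 1"
        unfolding abs_mult by (intro mult_mono; simp)+
      moreover have "lam' t = -2 * (cos ((t-a)/2) * sin ((t-b)/2)) - 2 * (sin ((t-a)/2) * cos ((t-b)/2))"
        by (simp add: lam'_def algebra_simps)
      ultimately show ?thesis by linarith
    qed
    have l: "\<bar>lam t\<bar> \<le> 4"
    proof -
      have "\<bar>sin ((t-a)/2) * sin ((t-b)/2)\<bar> \<le> 1 * 1"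
        unfolding abs_mult by (intro mult_mono; simp)
      then show ?thesis unfolding lam_def by linarith
    qed
    have D': "\<bar>D' t\<bar> \<le> 4"
    proof -
      have "\<bar>sin t * Re z\<bar> \<le> 1 * 1" "\<bar>cos t * Im z\<bar> \<le> 1 * 1"
        unfolding abs_mult using abs_Re_le_cmod[of z] abs_Im_le_cmod[of z] z by (intro mult_mono; simp)+
      moreover have "D' t = 2 * (sin t * Re z) - 2 * (cos t * Im z)"
        by (simp add: D'_def algebra_simps)
      ultimately show ?thesis by linarith
    qed
    have d42: "d^4 \<le> d^2" using d by (intro power_decreasing) auto
    have Pb: "\<bar>P t\<bar> \<le> 1 / d^4"
    proof -
      have "\<bar>P t\<bar> = (1 - (cmod z)\<^sup>2) / D t" using num D_pos[of t] by (simp add: P_def)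
      also have "\<dots> \<le> 1 / d^4"
        using num D_ge[of t] d42 d by (intro frac_le) auto
      finally show ?thesis .
    qed
    have P'b: "\<bar>P' t\<bar> \<le> 4 / d^4"
    proof -
      have "(d\<^sup>2)\<^sup>2 \<le> (D t)\<^sup>2" using D_ge by (intro power_mono) auto
      then have "d^4 \<le> (D t)\<^sup>2" by (simp add: power_mult[symmetric])
      moreover have "(1 - (cmod z)\<^sup>2) * \<bar>D' t\<bar> \<le> 1 * 4" using num D' by (intro mult_mono) auto
      moreover have "\<bar>P' t\<bar> = (1 - (cmod z)\<^sup>2) * \<bar>D' t\<bar> / (D t)\<^sup>2"
        using num by (simp add: P'_def abs_mult)
      ultimately show ?thesis using d by (simp only:) (intro frac_le, auto)
    qed
    have "\<bar>lam' t * P t\<bar> \<le> 4 * (1 / d^4)" "\<bar>lam t * P' t\<bar> \<le> 4 * (4 / d^4)"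
      unfolding abs_mult using l l' Pb P'b by (intro mult_mono; simp)+
    then show ?thesis unfolding \<Psi>'_def K_def by (simp add: field_simps)
  qed
  have lam_cis: "\<kappa> * (cis t - cis a) * (cis t - cis b) = of_real (lam t) * cis t" for t
  proof -
    have e: "cis t - cis s = 2 * \<i> * of_real (sin ((t-s)/2)) * cis ((t+s)/2)" for s
    proof -
      have "cis t = cis ((t+s)/2) * cis ((t-s)/2)" "cis s = cis ((t+s)/2) * cis (-((t-s)/2))"
        by (simp_all add: cis_mult field_simps)
      moreover have "cis x - cis (-x) = 2 * \<i> * of_real (sin x)" for x
        by (simp add: complex_eq_iff)
      ultimately show ?thesis by (metis mult.commute right_diff_distrib)
    qed
    have c: "\<kappa> * cis ((t+a)/2) * cis ((t+b)/2) = cis t"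
      by (simp add: \<kappa>_def cis_mult field_simps)
    have "\<kappa> * (cis t - cis a) * (cis t - cis b) =
        (2 * \<i>) * (2 * \<i>) * of_real (sin ((t-a)/2)) * of_real (sin ((t-b)/2)) * (\<kappa> * cis ((t+a)/2) * cis ((t+b)/2))"
      unfolding e by (simp only: mult_ac)
    also have "\<dots> = of_real (lam t) * cis t"
      unfolding c by (simp add: lam_def)
    finally show ?thesis .
  qed
  define r where "r n = 1 - 1 / real (n+2)" for n :: nat
  have r: "0 < r n" "r n < 1" for n by (auto simp: r_def)
  have r_lim: "r \<longlonglongrightarrow> 1" unfolding r_def by real_asymp
  have r_left: "filterlim r (at_left 1) sequentially"
    using r_lim r by (intro tendsto_imp_filterlim_at_left) auto
  define u where "u n t = Im (B (of_real (r n) * cis t))" for n t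
  define u' where "u' n t = Re (cis t * of_real (r n) * deriv B (of_real (r n) * cis t))" for n t
  have in_disc: "of_real (r n) * cis t \<in> ball 0 1" for n t using r[of n] by (simp add: norm_mult)
  have du: "(u n has_real_derivative u' n t) (at t)" for n t
  proof -
    have "(B has_field_derivative deriv B (of_real (r n) * cis t)) (at (of_real (r n) * cis t))"
      by (rule holomorphic_derivI[OF holo _ in_disc]) simp
    moreover have "((\<lambda>t. of_real (r n) * cis t) has_vector_derivative (of_real (r n) * (\<i> * cis t))) (at t)"
      by (auto intro!: derivative_eq_intros simp: has_vector_derivative_def scaleR_conv_of_real algebra_simps)
    ultimately have "((B \<circ> (\<lambda>t. of_real (r n) * cis t)) has_vector_derivative (of_real (r n) * (\<i> * cis t)) * deriv B (of_real (r n) * cis t)) (at t)"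
      by (rule field_vector_diff_chain_at[rotated])
    then have "((\<lambda>t. B (of_real (r n) * cis t)) has_vector_derivative (\<i> * (cis t * of_real (r n) * deriv B (of_real (r n) * cis t)))) (at t)"
      by (simp add: o_def mult_ac)
    from has_field_derivative_Im[OF this] show ?thesis
      by (simp add: u_def[abs_def] u'_def)
  qed
  \<comment> \<open>The radius \<open>r n\<close> enters the argument of \<open>deriv B\<close>
    only. The two linear factors stay on the unit circle, where they combine to \<open>lam\<close>,
    and \<open>T n\<close> is holomorphic beyond the closed disk.\<close>
  define T where "T n w = \<kappa> * (w - cis a) * (w - cis b) * (of_real (r n) * deriv B (of_real (r n) * w))" for n w
  have holT: "T n holomorphic_on ball 0 (1 / r n)" for n
  proof -
    have "of_real (r n) * w \<in> ball 0 1" if "w \<in> ball 0 (1 / r n)" for w :: complex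
      using that r[of n] by (simp add: norm_mult field_simps)
    moreover have "deriv B holomorphic_on ball 0 1" using holo by (intro holomorphic_deriv) auto
    ultimately have "(deriv B \<circ> (\<lambda>w. of_real (r n) * w)) holomorphic_on ball 0 (1 / r n)"
      by (intro holomorphic_on_compose_gen[of "\<lambda>w. of_real (r n) * w" _ "deriv B" "ball 0 1"]) (auto intro!: holomorphic_intros simp del: mem_ball)
    then have "(\<lambda>w. deriv B (of_real (r n) * w)) holomorphic_on ball 0 (1 / r n)"
      by (simp only: o_def)
    then show ?thesis unfolding T_def by (intro holomorphic_intros)
  qed
  have ReT: "Re (T n (cis t)) = lam t * u' n t" for n t
  proof -
    have "T n (cis t) = of_real (lam t) * (cis t * (of_real (r n) * deriv B (of_real (r n) * cis t)))"
      unfolding T_def lam_cis by (simp only: mult_ac)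
    moreover have "Re (of_real x * w) = x * Re w" for x w by simp
    ultimately show ?thesis by (simp only: u'_def mult.assoc)
  qed
  have I1: "((\<lambda>t. \<Psi> t * u' n t) has_integral (2 * pi * Re (T n z))) {a..a+2*pi}" for n
  proof -
    have "((\<lambda>t. T n (cis t) * of_real (P t)) has_integral (2 * of_real pi * T n z)) {a..a+2*pi}"
      using Poisson_formula_shifted[OF holT _ z, of n a] r[of n] by (simp add: P_def D_eq)
    from has_integral_linear[OF this bounded_linear_Re]
    show ?thesis by (simp add: o_def ReT \<Psi>_def mult_ac)
  qed
  have ends: "\<Psi> a = 0" "\<Psi> b = 0" "\<Psi> (a + 2*pi) = 0"
    by (auto simp: \<Psi>_def lam_def)
  \<comment> \<open>The derivative moves from the boundary values to the smooth
    \<open>\<Psi>\<close>, so that the limit n -> infinity can be taken by dominated convergence. No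
    boundary terms arise, as \<open>\<Psi>\<close> vanishes at both ends.\<close>
  have I2: "((\<lambda>t. \<Psi>' t * u n t) has_integral (- 2 * pi * Re (T n z))) {a..a+2*pi}" for n
  proof -
    have "((\<lambda>t. \<Psi>' t * u n t + \<Psi> t * u' n t) has_integral (\<Psi> (a+2*pi) * u n (a+2*pi) - \<Psi> a * u n a)) {a..a+2*pi}"
    proof (rule fundamental_theorem_of_calculus)
      show "((\<lambda>t. \<Psi> t * u n t) has_vector_derivative \<Psi>' t * u n t + \<Psi> t * u' n t) (at t within {a..a+2*pi})" for t
        unfolding has_real_derivative_iff_has_vector_derivative[symmetric]
        using DERIV_mult[OF d\<Psi>[of t] du[of n t]] by (auto intro: has_field_derivative_at_within simp: algebra_simps)
    qed simp
    from has_integral_diff[OF this I1[of n]] show ?thesis by (simp add: ends)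
  qed
  define I where "I = - 2 * pi * Re (\<kappa> * (z - cis a) * (z - cis b) * deriv B z)"
  have contdB: "continuous (at z) (deriv B)"
    using continuous_on_eq_continuous_at[of "ball 0 1" "deriv B"] z
      holomorphic_on_imp_continuous_on[OF holomorphic_deriv[OF holo open_ball]] by auto
  have limT: "(\<lambda>n. - 2 * pi * Re (T n z)) \<longlonglongrightarrow> I"
  proof -
    have "(\<lambda>n. of_real (r n) * z) \<longlonglongrightarrow> of_real 1 * z" by (intro tendsto_intros r_lim)
    then have "(\<lambda>n. deriv B (of_real (r n) * z)) \<longlonglongrightarrow> deriv B z"
      using isCont_tendsto_compose[OF contdB] by simp
    then have "(\<lambda>n. - 2 * pi * Re (T n z)) \<longlonglongrightarrow> - 2 * pi * Re (\<kappa> * (z - cis a) * (z - cis b) * (of_real 1 * deriv B z))"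
      unfolding T_def by (intro tendsto_intros r_lim)
    then show ?thesis by (simp add: I_def)
  qed
  define g where "g t = (if t \<in> A then \<Psi>' t * L t else 0)" for t
  have g: "(g has_integral I) {a..a+2*pi}"
  proof (rule has_integral_dominated_convergence[OF _ _ _ _ limT])
    show "((\<lambda>t. if t \<in> A then \<Psi>' t * u n t else 0) has_integral - 2 * pi * Re (T n z)) {a..a+2*pi}" for n
      by (rule has_integral_spike[OF neg _ I2]) auto
    show "(\<lambda>_. K * M) integrable_on {a..a+2*pi}" by (rule integrable_const_ivl)
    have M: "0 \<le> M" using bdd[of 0] by simp
    have K: "0 \<le> K" using \<Psi>'_bound[of 0] by linarith
    have "\<bar>\<Psi>' t * u n t\<bar> \<le> K * M" for n t
    proof -
      have "cmod (of_real (r n) * cis t) < 1" using in_disc[of n t] by (simp only: mem_ball_0)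
      then have "\<bar>u n t\<bar> \<le> M" unfolding u_def by (rule bdd)
      then show ?thesis unfolding abs_mult using \<Psi>'_bound[of t] K by (intro mult_mono) auto
    qed
    moreover have "0 \<le> K * M" using M K by simp
    ultimately show "\<forall>t\<in>{a..a+2*pi}. norm (if t \<in> A then \<Psi>' t * u n t else 0) \<le> K * M" for n
      by auto
    show "\<forall>t\<in>{a..a+2*pi}. (\<lambda>n. if t \<in> A then \<Psi>' t * u n t else 0) \<longlonglongrightarrow> g t"
    proof
      fix t
      show "(\<lambda>n. if t \<in> A then \<Psi>' t * u n t else 0) \<longlonglongrightarrow> g t"
        using filterlim_compose[OF lim[of t] r_left] by (auto simp: g_def u_def intro!: tendsto_intros)
    qed
  qed
  \<comment> \<open>Replacing \<open>L\<close> by the monotone \<open>w\<close> costs at most K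
    \<epsilon> per unit length, while the integral \<open>j\<close> with \<open>w\<close> itself is
    nonpositive.\<close>
  have est: "i \<le> K * \<epsilon> * (y - x)"
    if "x \<le> y" "(g has_integral i) {x..y}" "((\<lambda>t. w t * \<Psi>' t) has_integral j) {x..y}" "j \<le> 0"
      "\<And>t. \<lbrakk>t \<in> A; x \<le> t; t \<le> y\<rbrakk> \<Longrightarrow> \<bar>L t - w t\<bar> \<le> \<epsilon>" for x y i j and w :: "real \<Rightarrow> real"
  proof -
    have "((\<lambda>t. w t * \<Psi>' t + K * \<epsilon>) has_integral (j + K * \<epsilon> * (y - x))) {x..y}"
      using has_integral_add[OF that(3) has_integral_const_real[of "K * \<epsilon>" x y]] \<open>x \<le> y\<close> by (simp add: mult.commute)
    then have "((\<lambda>t. if t \<in> A then w t * \<Psi>' t + K * \<epsilon> else 0) has_integral (j + K * \<epsilon> * (y - x))) {x..y}"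
      by (rule has_integral_spike[OF neg, rotated]) auto
    note this' = this
    have "i \<le> j + K * \<epsilon> * (y - x)"
    proof (rule has_integral_le[OF that(2) this'])
      fix t assume t: "t \<in> {x..y}"
      have "(L t - w t) * \<Psi>' t \<le> K * \<epsilon>" if "t \<in> A"
      proof -
        have "\<bar>(L t - w t) * \<Psi>' t\<bar> \<le> \<epsilon> * K"
          unfolding abs_mult using \<open>t \<in> A\<close> t \<Psi>'_bound[of t]
          by (intro mult_mono) (use \<open>\<And>t. \<lbrakk>t \<in> A; x \<le> t; t \<le> y\<rbrakk> \<Longrightarrow> \<bar>L t - w t\<bar> \<le> \<epsilon>\<close> \<open>\<epsilon> > 0\<close> in auto)
        then show ?thesis by (simp add: mult.commute)
      qed
      then show "g t \<le> (if t \<in> A then w t * \<Psi>' t + K * \<epsilon> else 0)"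
        by (auto simp: g_def algebra_simps)
    qed
    then show ?thesis using \<open>j \<le> 0\<close> by linarith
  qed
  have P_pos: "P t > 0" for t using num D_pos by (simp add: P_def)
  obtain j1 where j1: "((\<lambda>t. w1 t * \<Psi>' t) has_integral j1) {a..b}" "j1 \<le> 0"
  proof (rule integral_mono_times_deriv_nonpos[where w=w1, OF _ _ d\<Psi> ends(1,2)])
    fix t assume t: "a \<le> t" "t \<le> b"
    have "sin ((t-a)/2) \<ge> 0" "sin ((b-t)/2) \<ge> 0" using t ab by (auto intro!: sin_ge_zero)
    moreover have "sin ((t-b)/2) = - sin ((b-t)/2)" by (metis minus_diff_eq minus_divide_left sin_minus)
    ultimately show "\<Psi> t \<ge> 0" using P_pos[of t] by (simp add: \<Psi>_def lam_def)
  qed (use ab w1 in auto)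
  \<comment> \<open>On the falling arc \<open>w2\<close> decreases and \<open>\<Psi>\<close> is
    nonpositive; changing both signs restores the hypotheses of the monotone case.\<close>
  obtain j2 where j2: "((\<lambda>t. - w2 t * - \<Psi>' t) has_integral j2) {b..a+2*pi}" "j2 \<le> 0"
  proof (rule integral_mono_times_deriv_nonpos[where w="\<lambda>t. - w2 t" and \<Psi>="\<lambda>t. - \<Psi> t" and \<Psi>'="\<lambda>t. - \<Psi>' t" and a=b and b="a+2*pi"])
    fix t assume t: "b \<le> t" "t \<le> a + 2*pi"
    have "sin ((t-a)/2) \<ge> 0" "sin ((t-b)/2) \<ge> 0" using t ab by (auto intro!: sin_ge_zero)
    then show "- \<Psi> t \<ge> 0" using P_pos[of t] by (simp add: \<Psi>_def lam_def)
  qed (use ab w2 ends in \<open>auto intro!: derivative_eq_intros d\<Psi>\<close>)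
  obtain i1 where i1: "(g has_integral i1) {a..b}"
    using g integrable_on_subinterval[of g "{a..a+2*pi}" a b] ab by (auto simp: integrable_on_def)
  obtain i2 where i2: "(g has_integral i2) {b..a+2*pi}"
    using g integrable_on_subinterval[of g "{a..a+2*pi}" b "a+2*pi"] ab by (auto simp: integrable_on_def)
  have "(g has_integral (i1 + i2)) {a..a+2*pi}"
    by (rule has_integral_combine[OF _ _ i1 i2]) (use ab in auto)
  with g have "I = i1 + i2" by (rule has_integral_unique)
  moreover have "i1 \<le> K * \<epsilon> * (b - a)" using est[OF _ i1 j1] ab L1 by simp
  moreover have "i2 \<le> K * \<epsilon> * (a + 2*pi - b)"
    using est[OF _ i2, of w2 j2] j2 ab L2 by simp
  ultimately have "I \<le> K * \<epsilon> * (2*pi)" by (simp add: algebra_simps)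
  moreover define R where "R = Re (\<kappa> * (z - cis a) * (z - cis b) * deriv B z)"
  ultimately have le: "-2 * pi * R \<le> K * \<epsilon> * (2 * pi)" by (simp only: I_def)
  have "- R \<le> K * \<epsilon>"
  proof (rule ccontr)
    assume "\<not> - R \<le> K * \<epsilon>"
    then have "2 * pi * (K * \<epsilon>) < 2 * pi * (- R)" by (intro mult_strict_left_mono) auto
    with le show False by (simp add: mult_ac)
  qed
  then show ?thesis unfolding R_def K_def d_def \<kappa>_def by simp
qed

section \<open>Almost everywhere existence of radial limits\<close>

text \<open>By Bloch's theorem the image of \<open>ball \<zeta> \<delta>\<close> contains a disc of radius \<open>\<delta> |\<Phi>'(\<zeta>)| / 12\<close>, and these
  disjoint discs lie in the unit disk. Averaging over all translates of a grid turns this into an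
  area bound for univalent functions without any change of variables.\<close>

lemma sum_deriv_squared_le:
  fixes \<Phi> :: "complex \<Rightarrow> complex"
  assumes "finite Z" "\<delta> > 0"
    and holo: "\<Phi> holomorphic_on S" and inj: "inj_on \<Phi> S" and im: "\<Phi> ` S \<subseteq> ball 0 1"
    and balls: "\<And>\<zeta>. \<zeta> \<in> Z \<Longrightarrow> ball \<zeta> \<delta> \<subseteq> S"
    and sep: "\<And>\<zeta> \<xi>. \<lbrakk>\<zeta> \<in> Z; \<xi> \<in> Z; \<zeta> \<noteq> \<xi>\<rbrakk> \<Longrightarrow> dist \<zeta> \<xi> \<ge> 2 * \<delta>"
  shows "(\<Sum>\<zeta>\<in>Z. (cmod (deriv \<Phi> \<zeta>))\<^sup>2) \<le> 144 / \<delta>\<^sup>2"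
proof -
  define \<rho> where "\<rho> \<zeta> = \<delta> * cmod (deriv \<Phi> \<zeta>) / 12" for \<zeta>
  have "\<exists>b. ball b (\<rho> \<zeta>) \<subseteq> \<Phi> ` ball \<zeta> \<delta>" if "\<zeta> \<in> Z" for \<zeta>
    by (rule Bloch[OF holomorphic_on_subset[OF holo balls[OF that]] \<open>\<delta> > 0\<close>, of "\<rho> \<zeta>"]) (auto simp: \<rho>_def)
  then obtain b where b: "\<And>\<zeta>. \<zeta> \<in> Z \<Longrightarrow> ball (b \<zeta>) (\<rho> \<zeta>) \<subseteq> \<Phi> ` ball \<zeta> \<delta>" by metis
  define V where "V = measure lborel (ball (0::complex) 1)"
  have V: "V > 0" by (simp add: V_def content_ball_pos)
  have disj: "disjoint_family_on (\<lambda>\<zeta>. ball (b \<zeta>) (\<rho> \<zeta>)) Z"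
    unfolding disjoint_family_on_def
  proof (intro ballI impI)
    fix \<zeta> \<xi> assume Z: "\<zeta> \<in> Z" "\<xi> \<in> Z" "\<zeta> \<noteq> \<xi>"
    have "ball \<zeta> \<delta> \<inter> ball \<xi> \<delta> = {}" using sep[OF Z] by (intro disjoint_ballI) auto
    then have "\<Phi> ` ball \<zeta> \<delta> \<inter> \<Phi> ` ball \<xi> \<delta> = {}"
      using inj_on_image_Int[OF inj balls[OF Z(1)] balls[OF Z(2)]] by simp
    then show "ball (b \<zeta>) (\<rho> \<zeta>) \<inter> ball (b \<xi>) (\<rho> \<xi>) = {}" using b[OF Z(1)] b[OF Z(2)] by blast
  qed
  have "(\<Sum>\<zeta>\<in>Z. measure lborel (ball (b \<zeta>) (\<rho> \<zeta>))) = measure lborel (\<Union>\<zeta>\<in>Z. ball (b \<zeta>) (\<rho> \<zeta>))"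
  proof (rule measure_finite_Union[symmetric, OF \<open>finite Z\<close> _ disj])
    show "emeasure lborel (ball (b \<zeta>) (\<rho> \<zeta>)) \<noteq> \<infinity>" for \<zeta>
      using emeasure_lborel_ball_finite[of "b \<zeta>" "\<rho> \<zeta>"] by simp
  qed auto
  also have "\<dots> \<le> measure lborel (ball (0::complex) 1)"
  proof (rule measure_mono_fmeasurable)
    show "(\<Union>\<zeta>\<in>Z. ball (b \<zeta>) (\<rho> \<zeta>)) \<subseteq> ball 0 1"
      using b balls im by blast
  qed (auto simp: fmeasurable_def emeasure_lborel_ball_finite[simplified] \<open>finite Z\<close> intro!: sets.finite_UN)
  finally have "(\<Sum>\<zeta>\<in>Z. measure lborel (ball (b \<zeta>) (\<rho> \<zeta>))) \<le> V" by (simp add: V_def)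
  moreover have "measure lborel (ball (b \<zeta>) (\<rho> \<zeta>)) = (\<rho> \<zeta>)\<^sup>2 * V" for \<zeta>
    using content_ball_conv_unit_ball[of "\<rho> \<zeta>" "b \<zeta>"] \<open>\<delta> > 0\<close> by (simp add: V_def \<rho>_def)
  ultimately have "(\<Sum>\<zeta>\<in>Z. (\<rho> \<zeta>)\<^sup>2) * V \<le> 1 * V" by (simp add: sum_distrib_right)
  then have "(\<Sum>\<zeta>\<in>Z. (\<rho> \<zeta>)\<^sup>2) \<le> 1" using V by (rule mult_right_le_imp_le)
  moreover have "(\<Sum>\<zeta>\<in>Z. (\<rho> \<zeta>)\<^sup>2) = \<delta>\<^sup>2 / 144 * (\<Sum>\<zeta>\<in>Z. (cmod (deriv \<Phi> \<zeta>))\<^sup>2)"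
    by (simp add: \<rho>_def sum_distrib_left power_mult_distrib power_divide)
  ultimately show ?thesis using \<open>\<delta> > 0\<close> by (simp add: field_simps)
qed

text \<open>Superposing the cells of a grid lets a bound for sums over separated points act on an
  integral.\<close>

lemma integral_eq_integral_grid_sum:
  fixes f :: "real \<Rightarrow> real"
  assumes "continuous_on {a..a + real N * s} f" "s \<ge> 0"
  shows "integral {a..a + real N * s} f = integral {0..s} (\<lambda>o'. \<Sum>j<N. f (a + real j * s + o'))"
  using assms(1)
proof (induction N)
  case 0
  then show ?case by simp
next
  case (Suc N)
  have le: "a + real N * s \<le> a + real (Suc N) * s" "a \<le> a + real N * s"
    using \<open>s \<ge> 0\<close> by (auto simp: algebra_simps)
  have int: "f integrable_on {a..a + real (Suc N) * s}"
    using Suc.prems by (rule integrable_continuous_interval)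
  have c: "continuous_on {a..a + real N * s} f" by (rule continuous_on_subset[OF Suc.prems]) (use le in auto)
  have piece: "(\<lambda>o'. f (a + real j * s + o')) integrable_on {0..s}" if "j < Suc N" for j
  proof (rule integrable_continuous_interval)
    have "real j * s + o' \<le> real (Suc N) * s" if "o' \<le> s" for o'
    proof -
      have "real (Suc j) * s \<le> real (Suc N) * s" using \<open>j < Suc N\<close> \<open>s \<ge> 0\<close> by (intro mult_right_mono) auto
      then show ?thesis using that by (simp add: algebra_simps)
    qed
    then show "continuous_on {0..s} (\<lambda>o'. f (a + real j * s + o'))"
      using \<open>s \<ge> 0\<close> by (intro continuous_on_compose2[OF Suc.prems]) (auto intro!: continuous_intros simp: add.assoc)
  qed
  have "integral {a..a + real (Suc N) * s} f =
      integral {a..a + real N * s} f + integral {a + real N * s..a + real (Suc N) * s} f"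
    by (rule Henstock_Kurzweil_Integration.integral_combine[OF le(2,1) int, symmetric])
  also have "integral {a + real N * s..a + real (Suc N) * s} f = integral {0..s} (\<lambda>o'. f (a + real N * s + o'))"
  proof -
    have "f integrable_on {a + real N * s..a + real (Suc N) * s}"
      by (rule integrable_on_subinterval[OF int]) (use le in auto)
    then have "(f has_integral integral {a + real N * s..a + real (Suc N) * s} f) {a + real N * s..a + real (Suc N) * s}"
      by (rule integrable_integral)
    then have "((\<lambda>x. f (x + (a + real N * s))) has_integral integral {a + real N * s..a + real (Suc N) * s} f) {0..s}"
      by (subst (asm) has_integral_shift_real_ivl_iff[where c = "a + real N * s"]) (simp add: algebra_simps)
    then show ?thesis by (simp add: add_ac integral_unique)
  qed
  also have "integral {a..a + real N * s} f = integral {0..s} (\<lambda>o'. \<Sum>j<N. f (a + real j * s + o'))"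
    by (rule Suc.IH[OF c])
  also have "\<dots> + integral {0..s} (\<lambda>o'. f (a + real N * s + o')) = integral {0..s} (\<lambda>o'. \<Sum>j<Suc N. f (a + real j * s + o'))"
    by (subst integral_add[symmetric]) (auto intro!: integrable_sum piece)
  finally show ?case .
qed

text \<open>The point is a bound independent of \<open>m\<close>, so that the inner interval may
  grow to [-1, 0). Every grid sum is at most 576 / sx^2; integrating over the offsets in a cell with
  sides \<open>sx\<close> and \<open>sy\<close> gives 576 sy / sx, and sx >= 1 / (2 m) makes this at
  most 2304 pi.\<close>

lemma iterated_integral_deriv_squared_le:
  fixes \<Phi> :: "complex \<Rightarrow> complex" and c :: real
  assumes holo: "\<Phi> holomorphic_on {z. Re z < 0}"
    and inj: "\<And>c. inj_on \<Phi> {z. Re z < 0 \<and> c < Im z \<and> Im z < c + 2*pi}"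
    and im: "\<Phi> ` {z. Re z < 0} \<subseteq> ball 0 1"
    and "m \<ge> (2::nat)"
  shows "integral {c..c+2*pi} (\<lambda>y. integral {-1..-1/real m} (\<lambda>x. (cmod (deriv \<Phi> (Complex x y)))\<^sup>2)) \<le> 2304 * pi"
proof -
  define G where "G y x = (cmod (deriv \<Phi> (Complex x y)))\<^sup>2" for y x
  define sx where "sx = (1 - 1 / real m) / real m"
  define sy where "sy = 2 * pi / real m"
  \<comment> \<open>Distinct grid points differ by at least \<open>sx\<close> in some coordinate, so
    discs of radius sx / 2 about them are disjoint; as sx < 1 / m, these discs stay in the left
    half-plane.\<close>
  define \<delta> where "\<delta> = sx / 2"
  have m: "real m \<ge> 2" using \<open>m \<ge> 2\<close> by simp
  have sx: "0 < sx" "sx < 1 / real m" "sx \<ge> 1 / (2 * real m)"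
    using m by (auto simp: sx_def field_simps)
  have pi: "1 < pi" using pi_gt3 by simp
  have sy: "sx \<le> sy" "0 < sy" 
    using m sx pi by (auto simp: sy_def intro!: order_trans[OF less_imp_le[OF sx(2)]] divide_right_mono)
  have mx: "real m * sx = 1 - 1 / real m" and my: "real m * sy = 2 * pi"
    using m by (auto simp: sx_def sy_def)
  have openH: "open {z. Re z < 0}" by (rule open_halfspace_Re_lt)
  have contd: "continuous_on {z. Re z < 0} (deriv \<Phi>)"
    by (intro holomorphic_on_imp_continuous_on holomorphic_deriv holo openH)
  have contG: "continuous_on (UNIV \<times> {x. x < 0}) (\<lambda>(y, x). G y x)"
    unfolding G_def case_prod_unfold Complex_eq
    by (intro continuous_intros continuous_on_compose2[OF contd]) auto
  have contGx: "continuous_on {x. x < 0} (G y)" for y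
    unfolding G_def Complex_eq by (intro continuous_intros continuous_on_compose2[OF contd]) auto
  have contH: "continuous_on UNIV (\<lambda>y. integral (cbox (-1) (-1 / real m)) (G y))"
    using m by (intro integral_continuous_on_param continuous_on_subset[OF contG]) (auto simp: divide_neg_pos elim!: le_less_trans)
  have bound: "(\<Sum>k<m. \<Sum>j<m. G (c + real k * sy + p) (-1 + real j * sx + q)) \<le> 576 / sx\<^sup>2"
    if p: "0 \<le> p" "p \<le> sy" and q: "0 \<le> q" "q \<le> sx" for p q
  proof -
    define pt where "pt = (\<lambda>(k, j). Complex (-1 + real j * sx + q) (c + real k * sy + p))"
    have sep: "real j * s + s \<le> real j' * s" if "j < j'" "0 \<le> s" for j j' :: nat and s :: real
    proof -
      have "real (Suc j) * s \<le> real j' * s" using that by (intro mult_right_mono) auto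
      then show ?thesis by (simp add: algebra_simps)
    qed
    note sepx = sep[where s=sx, OF _ less_imp_le[OF sx(1)]] and sepy = sep[where s=sy, OF _ less_imp_le[OF sy(2)]]
    have far: "dist (pt kj) (pt kj') \<ge> 2 * \<delta>" if "kj \<noteq> kj'" for kj kj'
    proof -
      obtain k j k' j' where e: "kj = (k, j)" "kj' = (k', j')" by (cases kj, cases kj')
      have "\<bar>Re (pt kj - pt kj')\<bar> \<ge> sx \<or> \<bar>Im (pt kj - pt kj')\<bar> \<ge> sx"
        using that sepx[of j j'] sepx[of j' j] sepy[of k k'] sepy[of k' k] sy(1)
        unfolding e pt_def by (cases "j = j'"; cases "k = k'") (auto simp: abs_if, linarith+)
      then show ?thesis
        using abs_Re_le_cmod[of "pt kj - pt kj'"] abs_Im_le_cmod[of "pt kj - pt kj'"]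
        by (auto simp: dist_norm \<delta>_def)
    qed
    have inj_pt: "inj_on pt ({..<m} \<times> {..<m})"
    proof (rule inj_onI, rule ccontr)
      fix x y assume "pt x = pt y" "x \<noteq> y"
      then show False using far[of x y] sx by (simp add: \<delta>_def)
    qed
    \<comment> \<open>The strip of height 2 pi begins \<delta> below the lowest row of grid points;
      the discs of the top row still fit because sy >= 2 \<delta>.\<close>
    define S where "S = {z. Re z < 0 \<and> c + p - \<delta> < Im z \<and> Im z < c + p - \<delta> + 2*pi}"
    have "(\<Sum>\<zeta>\<in>pt ` ({..<m} \<times> {..<m}). (cmod (deriv \<Phi> \<zeta>))\<^sup>2) \<le> 144 / \<delta>\<^sup>2"
    proof (rule sum_deriv_squared_le)
      show "\<Phi> holomorphic_on S" using holo by (rule holomorphic_on_subset) (auto simp: S_def)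
      show "inj_on \<Phi> S" unfolding S_def by (rule inj)
      show "\<Phi> ` S \<subseteq> ball 0 1" using im by (auto simp: S_def)
      show "ball \<zeta> \<delta> \<subseteq> S" if Z: "\<zeta> \<in> pt ` ({..<m} \<times> {..<m})" for \<zeta>
      proof
        fix z assume "z \<in> ball \<zeta> \<delta>"
        then have d: "cmod (z - \<zeta>) < \<delta>" by (simp add: dist_norm norm_minus_commute)
        obtain k j where kj: "k < m" "j < m" "\<zeta> = pt (k, j)" using Z by auto
        have "\<bar>Re z - Re \<zeta>\<bar> < \<delta>" "\<bar>Im z - Im \<zeta>\<bar> < \<delta>"
          using d abs_Re_le_cmod[of "z - \<zeta>"] abs_Im_le_cmod[of "z - \<zeta>"] by auto
        moreover have "real j * sx + sx \<le> 1 - 1 / real m" using sepx[OF kj(2)] mx by simp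
        moreover have "real k * sy + sy \<le> 2 * pi" using sepy[OF kj(1)] my by simp
        moreover have "0 \<le> real k * sy" using sy by simp
        moreover have "Re \<zeta> = -1 + real j * sx + q" "Im \<zeta> = c + real k * sy + p"
          by (simp_all add: kj(3) pt_def)
        ultimately show "z \<in> S" using q p sx sy unfolding S_def mem_Collect_eq \<delta>_def
          by (intro conjI; linarith)
      qed
      show "dist \<zeta> \<xi> \<ge> 2 * \<delta>" if "\<zeta> \<in> pt ` ({..<m} \<times> {..<m})" "\<xi> \<in> pt ` ({..<m} \<times> {..<m})" "\<zeta> \<noteq> \<xi>" for \<zeta> \<xi>
        using that far by (metis imageE)
    qed (use sx in \<open>auto simp: \<delta>_def\<close>)
    also have "144 / \<delta>\<^sup>2 = 576 / sx\<^sup>2" by (simp add: \<delta>_def power_divide)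
    also have "(\<Sum>\<zeta>\<in>pt ` ({..<m} \<times> {..<m}). (cmod (deriv \<Phi> \<zeta>))\<^sup>2) = (\<Sum>kj\<in>{..<m} \<times> {..<m}. (cmod (deriv \<Phi> (pt kj)))\<^sup>2)"
      by (simp add: sum.reindex[OF inj_pt] o_def)
    finally show ?thesis
      by (simp add: sum.cartesian_product G_def pt_def case_prod_unfold)
  qed
  have neg: "-1 / real m < 0" using m by simp
  have eqm: "-1 + real m * sx = -1 / real m" using mx by simp
  have contGm: "continuous_on {-1..-1/real m} (G y)" for y
  proof (rule continuous_on_subset[OF contGx], rule subsetI)
    fix x assume "x \<in> {-1..-1/real m}"
    then have "x \<le> -1 / real m" unfolding atLeastAtMost_iff by (rule conjunct2)
    then show "x \<in> {x. x < 0}" using neg unfolding mem_Collect_eq by linarith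
  qed
  have ix: "integral {-1..-1/real m} (G y) = integral {0..sx} (\<lambda>q. \<Sum>j<m. G y (-1 + real j * sx + q))" for y
    using integral_eq_integral_grid_sum[of "-1" m sx "G y"] contGm sx unfolding eqm by simp
  have contGj: "continuous_on {0..sx} (\<lambda>q. G y (-1 + real j * sx + q))" if "j < m" for y j
  proof (rule continuous_on_compose2[OF contGx])
    have "real (Suc j) * sx \<le> real m * sx" using that sx by (intro mult_right_mono) auto
    moreover have "real (Suc j) * sx = real j * sx + sx" by (simp add: algebra_simps)
    moreover have "1 / real m > 0" using m by simp
    ultimately have "real j * sx + sx < 1" using mx by linarith
    then show "(\<lambda>q. -1 + real j * sx + q) ` {0..sx} \<subseteq> {x. x < 0}" by auto
  qed (auto intro!: continuous_intros)
  have contGs: "(\<lambda>q. \<Sum>j<m. G y (-1 + real j * sx + q)) integrable_on {0..sx}" for y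
    by (intro integrable_continuous_interval continuous_on_sum contGj) simp
  have "integral {c..c+2*pi} (\<lambda>y. integral {-1..-1/real m} (G y)) =
      integral {0..sy} (\<lambda>p. \<Sum>k<m. integral {-1..-1/real m} (G (c + real k * sy + p)))"
    using integral_eq_integral_grid_sum[of c m sy "\<lambda>y. integral {-1..-1/real m} (G y)"] my sy contH
    by (auto intro: continuous_on_subset)
  also have "\<dots> \<le> integral {0..sy} (\<lambda>p. 576 / sx)"
  proof (rule integral_le)
    show "(\<lambda>p. \<Sum>k<m. integral {-1..-1/real m} (G (c + real k * sy + p))) integrable_on {0..sy}"
      using contH by (intro integrable_continuous_interval continuous_intros continuous_on_compose2[OF contH[unfolded cbox_interval]]) auto
    fix p assume "p \<in> {0..sy}"
    then have p: "0 \<le> p" "p \<le> sy" by auto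
    have "(\<Sum>k<m. integral {-1..-1/real m} (G (c + real k * sy + p))) =
        integral {0..sx} (\<lambda>q. \<Sum>k<m. \<Sum>j<m. G (c + real k * sy + p) (-1 + real j * sx + q))"
      unfolding ix by (rule integral_sum[symmetric]) (simp, intro contGs)
    also have "\<dots> \<le> integral {0..sx} (\<lambda>q. 576 / sx\<^sup>2)"
    proof (rule integral_le)
      show "(\<lambda>q. \<Sum>k<m. \<Sum>j<m. G (c + real k * sy + p) (-1 + real j * sx + q)) integrable_on {0..sx}"
        by (rule integrable_sum) (simp, intro contGs)
    qed (use bound[OF p] in auto)
    also have "\<dots> = 576 / sx" using sx by (simp add: power2_eq_square)
    finally show "(\<Sum>k<m. integral {-1..-1/real m} (G (c + real k * sy + p))) \<le> 576 / sx" .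
  qed (rule integrable_const_ivl)
  also have "\<dots> = sy * (576 / sx)" using sy by simp
  also have "\<dots> \<le> sy * (576 / (1 / (2 * real m)))"
    using sx sy m by (intro mult_left_mono divide_left_mono) auto
  also have "\<dots> = 2304 * pi" using m by (simp add: sy_def)
  finally show ?thesis by (simp only: G_def[abs_def])
qed

text \<open>A curve of finite length has an end point: the lengths \<open>T n\<close> up to
  \<open>X n\<close> increase to a limit, and the remaining length bounds the oscillation of
  \<open>F\<close> beyond \<open>X N\<close>.\<close>

lemma convergent_at_left_0:
  fixes F :: "real \<Rightarrow> complex"
  assumes deriv: "\<And>x. x < 0 \<Longrightarrow> (F has_vector_derivative F' x) (at x)"
    and cont: "continuous_on {x. x < 0} F'"
    and bdd: "\<And>m::nat. m \<ge> 2 \<Longrightarrow> integral {-1..-1/real m} (\<lambda>x. cmod (F' x)) \<le> C"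
  shows "\<exists>l. (F \<longlongrightarrow> l) (at_left 0)"
proof -
  define X where "X n = - 1 / real (n + 2)" for n :: nat
  define T where "T n = integral {-1..X n} (\<lambda>x. cmod (F' x))" for n
  have X: "X n < 0" "-1 \<le> X n" for n by (auto simp: X_def field_simps)
  have X_mono: "X m \<le> X n" if "m \<le> n" for m n using that by (auto simp: X_def field_simps)
  have cabs: "continuous_on {x. x < 0} (\<lambda>x. cmod (F' x))" using cont by (intro continuous_intros)
  have int: "(\<lambda>x. cmod (F' x)) integrable_on {u..v}" "F' integrable_on {u..v}" if "v < 0" for u v
    using that by (auto intro!: integrable_continuous_interval continuous_on_subset[OF cabs] continuous_on_subset[OF cont])
  have diff: "cmod (F v - F u) \<le> integral {u..v} (\<lambda>x. cmod (F' x))" if "u \<le> v" "v < 0" for u v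
  proof -
    have "(F' has_integral (F v - F u)) {u..v}"
      using that deriv by (intro fundamental_theorem_of_calculus) (auto intro: has_vector_derivative_at_within)
    then have "F v - F u = integral {u..v} F'" by (simp add: integral_unique)
    then show ?thesis using integral_norm_bound_integral[OF int(2,1)[OF that(2)]] by simp
  qed
  have split: "integral {-1..u} (\<lambda>x. cmod (F' x)) + integral {u..v} (\<lambda>x. cmod (F' x)) = integral {-1..v} (\<lambda>x. cmod (F' x))"
    if "-1 \<le> u" "u \<le> v" "v < 0" for u v
    using that int(1) by (intro Henstock_Kurzweil_Integration.integral_combine) auto
  have nonneg: "0 \<le> integral {u..v} (\<lambda>x. cmod (F' x))" if "v < 0" for u v
    using that int(1) by (intro integral_nonneg) auto
  have key: "cmod (F (X n) - F x) \<le> T n - T N" if "X N \<le> x" "x \<le> X n" for x n N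
  proof -
    have "integral {x..X n} (\<lambda>x. cmod (F' x)) \<le> integral {X N..X n} (\<lambda>x. cmod (F' x))"
      using that X int(1) by (intro integral_subset_le) auto
    also have "\<dots> = T n - T N" using split[of "X N" "X n"] that X[of n] X[of N] by (simp add: T_def)
    finally show ?thesis using diff[of x "X n"] that X[of n] by linarith
  qed
  have T_mono: "T m \<le> T n" if "m \<le> n" for m n
    using split[of "X m" "X n"] nonneg[of "X n" "X m"] X X_mono[OF that] by (simp add: T_def)
  have "incseq T" using T_mono by (auto simp: incseq_def)
  moreover have "T n \<le> C" for n unfolding T_def X_def using bdd[of "n + 2"] by simp
  ultimately obtain t where t: "T \<longlonglongrightarrow> t" by (meson incseq_convergent)
  have T_le: "T n \<le> t" for n using incseq_le[OF \<open>incseq T\<close> t] .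
  have "Cauchy (\<lambda>n. F (X n))"
  proof (rule metric_CauchyI)
    fix e :: real assume "e > 0"
    then obtain N where N: "t - e / 2 < T N" 
      using order_tendstoD(1)[OF t, of "t - e/2"] by (auto simp: eventually_sequentially)
    have "dist (F (X n)) (F (X N)) < e / 2" if "n \<ge> N" for n
      using key[of N "X N" n] X_mono[OF that] T_le[of n] N by (auto simp: dist_norm)
    then show "\<exists>M. \<forall>m\<ge>M. \<forall>n\<ge>M. dist (F (X m)) (F (X n)) < e"
      by (intro exI[of _ N]) (meson dist_commute_lessI dist_triangle_half_r)
  qed
  then obtain l where l: "(\<lambda>n. F (X n)) \<longlonglongrightarrow> l" by (auto simp: Cauchy_convergent_iff convergent_def)
  have "(F \<longlongrightarrow> l) (at_left 0)"
  proof (rule tendstoI)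
    fix e :: real assume "e > 0"
    have "\<forall>\<^sub>F n in sequentially. t - e/2 < T n \<and> dist (F (X n)) l < e / 2"
      using order_tendstoD(1)[OF t, of "t - e/2"] tendstoD[OF l, of "e/2"] \<open>e > 0\<close>
      by (auto intro: eventually_conj)
    then obtain N where N: "\<And>n. n \<ge> N \<Longrightarrow> t - e/2 < T n \<and> dist (F (X n)) l < e / 2"
      by (auto simp: eventually_sequentially)
    have "dist (F x) l < e" if x: "X N < x" "x < 0" for x
    proof -
      have "X \<longlonglongrightarrow> 0" unfolding X_def by real_asymp
      then have "\<forall>\<^sub>F n in sequentially. x < X n \<and> n \<ge> N"
        using order_tendstoD(1)[of X 0 sequentially x] x by (auto intro: eventually_conj eventually_ge_at_top)
      then obtain n where n: "x < X n" "n \<ge> N" by (auto simp: eventually_sequentially)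
      have "dist (F x) (F (X n)) < e / 2"
        using key[of N x n] n x N[of N] T_le[of n] by (simp add: dist_norm norm_minus_commute)
      moreover have "dist (F (X n)) l < e / 2" using N n by blast
      ultimately show ?thesis using dist_triangle[of "F x" l "F (X n)"] by linarith
    qed
    then show "\<forall>\<^sub>F x in at_left 0. dist (F x) l < e"
      unfolding eventually_at_left_field using X by blast
  qed
  then show ?thesis by blast
qed

text \<open>In the logarithmic coordinate x + iy the radius at angle y is a horizontal ray, and
  \<open>\<Phi>\<close> is injective on strips of height 2 pi, so the area bound applies. The
  lengths \<open>J m y\<close> of the image curves increase in m and have bounded integrals over a
  period. By monotone convergence almost every such curve has finite length.\<close>

lemma radial_limits_almost_everywhere:
  assumes holo: "\<phi> holomorphic_on ball 0 1" and inj: "inj_on \<phi> (ball 0 1)" and im: "\<phi> ` ball 0 1 \<subseteq> ball 0 1"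
  shows "negligible {t. \<not> (\<exists>l. ((\<lambda>\<rho>. \<phi> (of_real \<rho> * cis t)) \<longlongrightarrow> l) (at_left 1))}"
proof -
  define \<Phi> where "\<Phi> z = \<phi> (exp z)" for z
  define H where "H = {z. Re z < 0}"
  have openH: "open H" unfolding H_def by (rule open_halfspace_Re_lt)
  have expH: "exp ` H \<subseteq> ball 0 1" by (auto simp: H_def norm_exp_eq_Re)
  have hol\<Phi>: "\<Phi> holomorphic_on H"
    using holomorphic_on_compose_gen[OF holomorphic_on_exp holo expH] by (simp only: \<Phi>_def[abs_def] o_def)
  have inj\<Phi>: "inj_on \<Phi> {z. Re z < 0 \<and> c < Im z \<and> Im z < c + 2*pi}" for c
  proof (rule inj_onI)
    fix z w assume zw: "z \<in> {z. Re z < 0 \<and> c < Im z \<and> Im z < c + 2*pi}" "w \<in> {z. Re z < 0 \<and> c < Im z \<and> Im z < c + 2*pi}"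
      and eq: "\<Phi> z = \<Phi> w"
    have "z \<in> H" "w \<in> H" using zw by (auto simp: H_def)
    then have "exp z \<in> ball 0 1" "exp w \<in> ball 0 1" using expH by blast+
    then have 1: "exp z = exp w" using inj_onD[OF inj eq[unfolded \<Phi>_def]] by blast
    have 2: "\<bar>Im z - Im w\<bar> < 2 * pi" using zw by (simp add: abs_less_iff)
    show "z = w" by (rule exp_complex_eqI[OF 2 1])
  qed
  have im\<Phi>: "\<Phi> ` H \<subseteq> ball 0 1" 
  proof (rule image_subsetI)
    fix z assume "z \<in> H"
    then have "exp z \<in> ball 0 1" using expH by blast
    then show "\<Phi> z \<in> ball 0 1" unfolding \<Phi>_def using im by blast
  qed
  have contd: "continuous_on H (deriv \<Phi>)"
    by (rule holomorphic_on_imp_continuous_on[OF holomorphic_deriv[OF hol\<Phi> openH]])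
  define g where "g y x = cmod (deriv \<Phi> (Complex x y))" for y x
  have contg: "continuous_on (UNIV \<times> {x. x < 0}) (\<lambda>(y, x). g y x)"
    unfolding g_def case_prod_unfold Complex_eq
    by (intro continuous_intros continuous_on_compose2[OF contd]) (auto simp: H_def)
  have contg2: "continuous_on (UNIV \<times> {x. x < 0}) (\<lambda>(y, x). (g y x)\<^sup>2)"
    using continuous_on_power[OF contg, of 2] by (simp add: case_prod_unfold)
  have contgx: "continuous_on {x. x < 0} (g y)" for y
    unfolding g_def Complex_eq by (intro continuous_intros continuous_on_compose2[OF contd]) (auto simp: H_def)
  define J where "J m y = integral {-1..-1/real (m+2)} (g y)" for m y
  have neg: "-1 / real (m+2) < 0" "- 1 \<le> -1 / real (m+2)" for m by (auto simp: field_simps)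
  have sub: "{-1..-1/real (m+2)} \<subseteq> {x. x < 0}" for m
  proof
    fix x assume "x \<in> {-1..-1/real (m+2)}"
    then have "x \<le> -1 / real (m+2)" unfolding atLeastAtMost_iff by (rule conjunct2)
    then show "x \<in> {x. x < 0}" using neg(1)[of m] unfolding mem_Collect_eq by linarith
  qed
  have contJ: "continuous_on UNIV (J m)" for m
    unfolding J_def cbox_interval[symmetric]
    using sub by (intro integral_continuous_on_param continuous_on_subset[OF contg]) auto
  have contJ2: "continuous_on UNIV (\<lambda>y. integral {-1..-1/real (m+2)} (\<lambda>x. (g y x)\<^sup>2))" for m
    unfolding cbox_interval[symmetric]
    using sub by (intro integral_continuous_on_param continuous_on_subset[OF contg2]) auto
  have intg: "g y integrable_on {-1..-1/real (m+2)}" "(\<lambda>x. (g y x)\<^sup>2) integrable_on {-1..-1/real (m+2)}" for y m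
    using sub by (auto intro!: integrable_continuous_interval continuous_on_subset[OF contgx] continuous_intros)
  have J_nonneg: "0 \<le> J m y" for m y
    unfolding J_def using intg(1) by (intro integral_nonneg) (auto simp: g_def)
  have J_mono: "J m y \<le> J n y" if "m \<le> n" for m n y
    unfolding J_def using that intg(1) 
    by (intro integral_subset_le) (auto simp: g_def field_simps)
  \<comment> \<open>The inequality g <= 1 + g^2 plays the part of the Cauchy-Schwarz inequality:
    only the finiteness of lengths matters, not their size.\<close>
  have J_le: "J m y \<le> 1 + integral {-1..-1/real (m+2)} (\<lambda>x. (g y x)\<^sup>2)" for m y
  proof -
    have "J m y \<le> integral {-1..-1/real (m+2)} (\<lambda>x. 1 + (g y x)\<^sup>2)"
      unfolding J_def
    proof (intro integral_le integrable_add intg integrable_const_ivl)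
      show "g y x \<le> 1 + (g y x)\<^sup>2" for x
      proof -
        have "0 \<le> (g y x - 1)\<^sup>2" "0 \<le> g y x" by (auto simp: g_def)
        then show ?thesis unfolding power2_diff one_power2 mult_1_right by linarith
      qed
    qed
    also have "\<dots> = (1 - 1 / real (m+2)) + integral {-1..-1/real (m+2)} (\<lambda>x. (g y x)\<^sup>2)"
      using neg(2)[of m] by (subst integral_add[OF integrable_const_ivl intg(2)]) simp
    finally show ?thesis by (smt (verit) divide_nonneg_nonneg of_nat_0_le_iff)
  qed
  define C where "C = 2 * pi + 2304 * pi"
  have int_J: "integral {c..c+2*pi} (J m) \<le> C" for c m
  proof -
    have "integral {c..c+2*pi} (J m) \<le> integral {c..c+2*pi} (\<lambda>y. 1 + integral {-1..-1/real (m+2)} (\<lambda>x. (g y x)\<^sup>2))"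
    proof (rule integral_le)
      show "J m integrable_on {c..c+2*pi}"
        by (rule integrable_continuous_interval[OF continuous_on_subset[OF contJ]]) simp
      show "(\<lambda>y. 1 + integral {-1..-1/real (m+2)} (\<lambda>x. (g y x)\<^sup>2)) integrable_on {c..c+2*pi}"
        by (rule integrable_add[OF integrable_const_ivl integrable_continuous_interval[OF continuous_on_subset[OF contJ2]]]) simp
    qed (rule J_le)
    also have "\<dots> = 2*pi + integral {c..c+2*pi} (\<lambda>y. integral {-1..-1/real (m+2)} (\<lambda>x. (g y x)\<^sup>2))"
      by (subst integral_add[OF integrable_const_ivl integrable_continuous_interval[OF continuous_on_subset[OF contJ2]]]) auto
    also have "\<dots> \<le> C"
      using iterated_integral_deriv_squared_le[OF hol\<Phi>[unfolded H_def] inj\<Phi> im\<Phi>[unfolded H_def], of "m+2" c]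
      by (simp add: C_def g_def)
    finally show ?thesis .
  qed
  have lim: "\<exists>l. ((\<lambda>\<rho>. \<phi> (of_real \<rho> * cis y)) \<longlongrightarrow> l) (at_left 1)" if bnd: "\<And>m. J m y \<le> B" for y B
  proof -
    have "\<exists>l. ((\<lambda>x. \<Phi> (Complex x y)) \<longlongrightarrow> l) (at_left 0)"
    proof (rule convergent_at_left_0)
      show "((\<lambda>x. \<Phi> (Complex x y)) has_vector_derivative deriv \<Phi> (Complex x y)) (at x)" if "x < 0" for x
      proof -
        have "(\<Phi> has_field_derivative deriv \<Phi> (Complex x y)) (at (Complex x y))"
          by (rule holomorphic_derivI[OF hol\<Phi> openH]) (use that in \<open>auto simp: H_def\<close>)
        moreover have "((\<lambda>x. Complex x y) has_vector_derivative 1) (at x)"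
          unfolding Complex_eq by (auto intro!: derivative_eq_intros)
        ultimately show ?thesis using field_vector_diff_chain_at by (fastforce simp: o_def)
      qed
      show "continuous_on {x. x < 0} (\<lambda>x. deriv \<Phi> (Complex x y))"
        unfolding Complex_eq by (intro continuous_intros continuous_on_compose2[OF contd]) (auto simp: H_def)
      show "integral {-1..-1/real m} (\<lambda>x. cmod (deriv \<Phi> (Complex x y))) \<le> B" if "m \<ge> 2" for m
        using bnd[of "m - 2"] that by (simp add: J_def g_def[abs_def])
    qed
    then obtain l where l: "((\<lambda>x. \<Phi> (Complex x y)) \<longlongrightarrow> l) (at_left 0)" by blast
    \<comment> \<open>The substitution \<rho> = e^x returns from the half-plane to the
      radius.\<close>
    have "filterlim ln (at_left 0) (at_left (1::real))" by real_asymp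
    from filterlim_compose[OF l this]
    have "((\<lambda>\<rho>. \<Phi> (Complex (ln \<rho>) y)) \<longlongrightarrow> l) (at_left 1)" .
    moreover have "\<forall>\<^sub>F \<rho> in at_left (1::real). \<Phi> (Complex (ln \<rho>) y) = \<phi> (of_real \<rho> * cis y)"
      unfolding eventually_at_left_field
      by (rule exI[of _ 0]) (auto simp: \<Phi>_def exp_eq_polar exp_of_real[symmetric])
    ultimately have "((\<lambda>\<rho>. \<phi> (of_real \<rho> * cis y)) \<longlongrightarrow> l) (at_left 1)"
      by (rule Lim_transform_eventually)
    then show ?thesis by blast
  qed
  define E where "E = {t. \<not> (\<exists>l. ((\<lambda>\<rho>. \<phi> (of_real \<rho> * cis t)) \<longlongrightarrow> l) (at_left 1))}"
  have "negligible (E \<inter> {c..c+2*pi})" for c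
  proof -
    define f where "f m y = ennreal (J m y) * indicator {c..c+2*pi} y" for m y
    have meas: "f m \<in> borel_measurable lborel" for m
      unfolding f_def using borel_measurable_continuous_onI[OF contJ[of m]] by measurable
    have "(\<integral>\<^sup>+ y. (SUP m. f m y) \<partial>lborel) = (SUP m. integral\<^sup>N lborel (f m))"
      using J_mono by (intro nn_integral_monotone_convergence_SUP meas)
        (auto simp: incseq_def le_fun_def f_def indicator_def intro!: ennreal_leI)
    also have "\<dots> \<le> ennreal C"
    proof (rule SUP_least)
      fix m
      have "(J m has_integral integral {c..c+2*pi} (J m)) {c..c+2*pi}"
        using contJ by (intro integrable_integral integrable_continuous_interval) (auto intro: continuous_on_subset)
      note eq = nn_integral_has_integral_lebesgue'[OF J_nonneg this]
      have "f m = (\<lambda>y. ennreal (J m y) * indicator {c..c+2*pi} y)" by (rule ext) (simp add: f_def)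
      then show "integral\<^sup>N lborel (f m) \<le> ennreal C"
        by (simp only: eq) (rule ennreal_leI[OF int_J])
    qed
    finally have "(\<integral>\<^sup>+ y. (SUP m. f m y) \<partial>lborel) < top" using ennreal_less_top by (rule le_less_trans)
    then have "(\<integral>\<^sup>+ y. (SUP m. f m y) \<partial>lborel) \<noteq> \<infinity>" by simp
    then have ae: "AE y in lborel. (SUP m. f m y) \<noteq> \<infinity>"
      using meas by (intro nn_integral_PInf_AE) auto
    then obtain N where N: "{y. (SUP m. f m y) = \<infinity>} \<subseteq> N" "N \<in> null_sets lborel"
      by (auto elim!: AE_E simp: null_sets_def)
    have "E \<inter> {c..c+2*pi} \<subseteq> N"
    proof
      fix y assume y: "y \<in> E \<inter> {c..c+2*pi}"
      have "(SUP m. f m y) = \<infinity>"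
      proof (rule ccontr)
        assume "(SUP m. f m y) \<noteq> \<infinity>"
        then obtain B where B: "(SUP m. f m y) = ennreal B" "B \<ge> 0" by (cases "SUP m. f m y") auto
        have "ennreal (J m y) \<le> ennreal B" for m
          using SUP_upper[of m UNIV "\<lambda>m. f m y"] B y by (simp add: f_def)
        then have "J m y \<le> B" for m using B by (simp add: ennreal_le_iff)
        from lim[OF this] y show False by (auto simp: E_def)
      qed
      then show "y \<in> N" using N by auto
    qed
    moreover have "negligible N" using N(2) by (simp add: negligible_iff_null_sets null_sets_completionI)
    ultimately show ?thesis by (rule negligible_subset[rotated])
  qed
  then have "negligible (\<Union>n::int. E \<inter> {2 * pi * of_int n..2 * pi * of_int n+2*pi})"
    by (intro negligible_countable_Union) auto
  moreover have "E \<subseteq> (\<Union>n::int. E \<inter> {2 * pi * of_int n..2 * pi * of_int n+2*pi})"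
  proof
    fix y assume "y \<in> E"
    define n where "n = \<lfloor>y / (2*pi)\<rfloor>"
    have "of_int n \<le> y / (2*pi)" "y / (2*pi) \<le> of_int n + 1" unfolding n_def by linarith+
    then have "2 * pi * of_int n \<le> y" "y \<le> 2 * pi * of_int n + 2*pi"
      by (auto simp: field_simps)
    then show "y \<in> (\<Union>n::int. E \<inter> {2 * pi * of_int n..2 * pi * of_int n+2*pi})" using \<open>y \<in> E\<close> by auto
  qed
  ultimately show ?thesis unfolding E_def[symmetric] by (rule negligible_subset)
qed

section \<open>Convex harmonic maps\<close>

text \<open>The domain \<open>U\<close> has to serve three ends. Its image \<open>W\<close> under
  \<open>f\<close> is convex, which makes the level sets of \<open>v\<close> connected; it is simply
  connected, which provides a Riemann map; and it lies in a compact subset \<open>Q\<close> of the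
  disk, which makes \<open>F\<close> bounded on it and continuous at every radial limit of
  \<open>\<phi>\<close>.\<close>

lemma half_plane_on_exhausting_map:
  fixes f F :: "complex \<Rightarrow> complex"
  assumes contf: "continuous_on (ball 0 1) f" and injf: "inj_on f (ball 0 1)" and conv: "convex (f ` ball 0 1)"
    and holF: "F holomorphic_on ball 0 1" and ImF: "\<And>z. z \<in> ball 0 1 \<Longrightarrow> Im (F z) = Im (f z)"
    and r: "0 < r" "r < 1" and "\<epsilon> > 0"
  obtains \<phi> \<kappa> p q where "\<phi> holomorphic_on ball 0 1" "\<phi> ` ball 0 1 \<subseteq> ball 0 1" "inj_on \<phi> (ball 0 1)"
    "\<phi> 0 = 0" "ball 0 r \<subseteq> \<phi> ` ball 0 1" "deriv \<phi> 0 = of_real (cmod (deriv \<phi> 0))"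
    "cmod \<kappa> = 1" "cmod p = 1" "cmod q = 1"
    "\<And>z. z \<in> ball 0 1 \<Longrightarrow> Re (\<kappa> * (z - p) * (z - q) * deriv (\<lambda>z. F (\<phi> z)) z) \<ge> - (20 * \<epsilon> / (1 - cmod z)^4)"
proof -
  obtain k where k: "homeomorphism (ball 0 1) (f ` ball 0 1) f k"
    using invariance_of_domain_homeomorphism[OF open_ball contf _ injf] by auto
  have kf: "k (f z) = z" if "z \<in> ball 0 1" for z using homeomorphism_apply1[OF k that] .
  have fk: "f (k w) = w" if "w \<in> f ` ball 0 1" for w using homeomorphism_apply2[OF k that] .
  have contk: "continuous_on (f ` ball 0 1) k" using k by (simp add: homeomorphism_def)
  have k_in: "k ` (f ` ball 0 1) = ball 0 1" using k by (simp add: homeomorphism_def)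
  define K where "K = convex hull (f ` cball 0 r)"
  have cr: "cball 0 r \<subseteq> ball (0::complex) 1" using r by auto
  have compK: "compact K" unfolding K_def
    by (intro compact_convex_hull compact_continuous_image continuous_on_subset[OF contf cr] compact_cball)
  have K_sub: "K \<subseteq> f ` ball 0 1" unfolding K_def by (rule hull_minimal[where S=convex, OF image_mono[OF cr] conv])
  define W where "W = interior K"
  have WK: "W \<subseteq> K" unfolding W_def by (rule interior_subset)
  have W: "open W" "convex W" unfolding W_def K_def by (auto intro: convex_interior)
  have br: "ball 0 r \<subseteq> ball (0::complex) 1" using r by auto
  have fbr: "f ` ball 0 r \<subseteq> W" unfolding W_def
  proof (rule interior_maximal)
    show "f ` ball 0 r \<subseteq> K" unfolding K_def by (rule order_trans[OF image_mono[OF ball_subset_cball] hull_subset])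
    show "open (f ` ball 0 r)"
      by (rule invariance_of_domain[OF continuous_on_subset[OF contf br] open_ball inj_on_subset[OF injf br]])
  qed
  define U where "U = k ` W"
  have W_sub: "W \<subseteq> f ` ball 0 1" using WK K_sub by (rule order_trans)
  have contkW: "continuous_on W k" by (rule continuous_on_subset[OF contk W_sub])
  have injk: "inj_on k W" by (rule inj_on_inverseI[of W f]) (use fk W_sub in blast)
  have openU: "open U" unfolding U_def by (rule invariance_of_domain[OF contkW W(1) injk])
  obtain g where "homeomorphism W U k g"
    using invariance_of_domain_homeomorphism[OF W(1) contkW _ injk] by (auto simp: U_def)
  then have "W homeomorphic U" unfolding homeomorphic_def by blast
  then have scU: "simply_connected U"
    using homeomorphic_simply_connected_eq convex_imp_simply_connected[OF W(2)] by blast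
  define Q where "Q = k ` K"
  have compQ: "compact Q" unfolding Q_def by (rule compact_continuous_image[OF continuous_on_subset[OF contk K_sub] compK])
  have Q_sub: "Q \<subseteq> ball 0 1" unfolding Q_def using image_mono[OF K_sub, of k] k_in by simp
  have UQ: "U \<subseteq> Q" unfolding U_def Q_def by (rule image_mono[OF WK])
  have brU: "ball 0 r \<subseteq> U"
  proof
    fix z :: complex assume "z \<in> ball 0 r"
    then have "f z \<in> W" "k (f z) = z" using fbr br kf by blast+
    then show "z \<in> U" unfolding U_def by (metis imageI)
  qed
  have zU: "0 \<in> U" using brU r by auto
  have U1: "U \<subseteq> ball 0 1" using UQ Q_sub by (rule order_trans)
  have "(2::complex) \<notin> U" using U1 by auto
  then have "U \<noteq> {}" "U \<noteq> UNIV" using zU by blast+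
  then obtain A B where AB: "A holomorphic_on U" "B holomorphic_on ball 0 1"
    "\<And>z. z \<in> U \<Longrightarrow> A z \<in> ball 0 1 \<and> B (A z) = z" "\<And>z. z \<in> ball 0 1 \<Longrightarrow> B z \<in> U \<and> A (B z) = z"
    using Riemann_mapping_theorem[of U] openU scU by metis
  \<comment> \<open>A disk automorphism moves \<open>A 0\<close> to 0, so that the inverse Riemann
    map can be made to fix 0.\<close>
  obtain m n where mn: "m (A 0) = 0" "m holomorphic_on ball 0 1" "m ` ball 0 1 \<subseteq> ball 0 1" "n holomorphic_on ball 0 1" "n ` ball 0 1 \<subseteq> ball 0 1"
    "\<And>z. z \<in> ball 0 1 \<Longrightarrow> m (n z) = z" "\<And>z. z \<in> ball 0 1 \<Longrightarrow> n (m z) = z"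
    using ball_biholomorphism_exists[of "A 0"] AB(3)[OF zU] by metis
  define \<phi>0 where "\<phi>0 z = B (n z)" for z
  have hol\<phi>0: "\<phi>0 holomorphic_on ball 0 1"
    using holomorphic_on_compose_gen[OF mn(4) AB(2) mn(5)] by (simp only: \<phi>0_def[abs_def] o_def)
  define d where "d = deriv \<phi>0 0"
  \<comment> \<open>A rotation that makes the derivative at 0 nonnegative, as
    \<open>close_to_identity\<close> demands; the default 1 keeps \<open>u\<close> unimodular if d =
    0.\<close>
  define u where "u = (if d = 0 then 1 else of_real (cmod d) / d)"
  have u: "cmod u = 1" by (simp add: u_def norm_divide)
  define \<phi> where "\<phi> z = \<phi>0 (u * z)" for z
  have u_in: "(\<lambda>z. u * z) ` ball 0 1 \<subseteq> ball 0 1" using u by (auto simp: norm_mult)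
  have hol\<phi>: "\<phi> holomorphic_on ball 0 1"
    using holomorphic_on_compose_gen[OF _ hol\<phi>0 u_in] unfolding \<phi>_def[abs_def] o_def by (auto intro: holomorphic_intros)
  have n_in: "n z \<in> ball 0 1" if "z \<in> ball 0 1" for z using mn(5) that by blast
  have uz: "u * z \<in> ball 0 1" if "z \<in> ball 0 1" for z using u_in that by blast
  have \<phi>_in: "\<phi> z \<in> U" if "z \<in> ball 0 1" for z
    unfolding \<phi>_def \<phi>0_def using AB(4) n_in uz that by blast
  have inj\<phi>: "inj_on \<phi> (ball 0 1)"
  proof (rule inj_on_inverseI)
    fix z :: complex assume z: "z \<in> ball 0 1"
    have "A (\<phi> z) = n (u * z)" unfolding \<phi>_def \<phi>0_def using AB(4) n_in uz z by blast
    then have "m (A (\<phi> z)) = u * z" using mn(6) uz z by simp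
    then show "m (A (\<phi> z)) / u = z" using u by auto
  qed
  have \<phi>_surj: "\<phi> ` ball 0 1 = U"
  proof
    show "\<phi> ` ball 0 1 \<subseteq> U" using \<phi>_in by blast
    show "U \<subseteq> \<phi> ` ball 0 1"
    proof
      fix w assume w: "w \<in> U"
      have "m (A w) \<in> ball 0 1" using AB(3)[OF w] mn(3) by blast
      moreover from this have "m (A w) / u \<in> ball 0 1" using u by (simp add: norm_divide)
      moreover have "\<phi> (m (A w) / u) = w" 
        using u AB(3)[OF w] mn(7)[of "A w"] by (auto simp: \<phi>_def \<phi>0_def)
      ultimately show "w \<in> \<phi> ` ball 0 1" by (metis imageI)
    qed
  qed
  have \<phi>_0: "\<phi> 0 = 0"
    using mn(7)[of "A 0"] mn(1) AB(3)[OF zU] by (simp add: \<phi>_def \<phi>0_def)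
  have "(\<phi>0 has_field_derivative d) (at 0)"
    unfolding d_def by (rule holomorphic_derivI[OF hol\<phi>0]) auto
  then have "(\<phi> has_field_derivative d * u) (at 0)"
    unfolding \<phi>_def using DERIV_chain2[of \<phi>0 d "\<lambda>z. u * z" 0 u UNIV] by (auto intro!: derivative_eq_intros)
  then have "deriv \<phi> 0 = d * u" by (rule DERIV_imp_deriv)
  then have d\<phi>: "deriv \<phi> 0 = of_real (cmod (deriv \<phi> 0))" by (simp add: u_def)

  obtain \<psi> where \<psi>: "homeomorphism (ball 0 1) U \<phi> \<psi>"
    using invariance_of_domain_homeomorphism[OF open_ball holomorphic_on_imp_continuous_on[OF hol\<phi>] _ inj\<phi>] \<phi>_surj by auto
  have cont\<psi>: "continuous_on U \<psi>" and \<phi>\<psi>: "\<And>w. w \<in> U \<Longrightarrow> \<phi> (\<psi> w) = w" and \<psi>\<phi>: "\<And>z. z \<in> ball 0 1 \<Longrightarrow> \<psi> (\<phi> z) = z"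
    and \<psi>U: "\<psi> ` U = ball 0 1"
    using \<psi> homeomorphism_apply1[OF \<psi>] homeomorphism_apply2[OF \<psi>] by (simp_all add: homeomorphism_def)
  define v where "v z = Im (F (\<phi> z))" for z
  have v_f: "v z = Im (f (\<phi> z))" if "z \<in> ball 0 1" for z
    unfolding v_def using ImF \<phi>_in[OF that] U1 by blast
  \<comment> \<open>Through the inverse homeomorphisms \<open>k\<close> and \<open>\<psi>\<close>
    the set is a continuous image of the intersection of two convex sets. With half-planes for
    \<open>S\<close> this settles all level sets of \<open>v\<close>.\<close>
  have pc: "path_connected {z\<in>ball 0 1. f (\<phi> z) \<in> S}" if "convex S" for S
  proof -
    have "{z\<in>ball 0 1. f (\<phi> z) \<in> S} = \<psi> ` k ` (W \<inter> S)"
    proof (intro set_eqI iffI)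
      fix z assume z: "z \<in> {z\<in>ball 0 1. f (\<phi> z) \<in> S}"
      then have "\<phi> z \<in> U" using \<phi>_in by blast
      then obtain w where w: "w \<in> W" "\<phi> z = k w" unfolding U_def by blast
      then have "f (\<phi> z) = w" using fk W_sub by auto
      then have "w \<in> W \<inter> S" using w z by blast
      moreover have "z = \<psi> (k w)" using \<psi>\<phi> z w by (metis (no_types, lifting) mem_Collect_eq)
      ultimately show "z \<in> \<psi> ` k ` (W \<inter> S)" by blast
    next
      fix z assume "z \<in> \<psi> ` k ` (W \<inter> S)"
      then obtain w where w: "w \<in> W" "w \<in> S" "z = \<psi> (k w)" by blast
      have kw: "k w \<in> U" unfolding U_def using w by blast
      then have "z \<in> ball 0 1" using \<psi>U w by blast
      moreover have "f (\<phi> z) = w" using \<phi>\<psi>[OF kw] fk W_sub w by auto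
      ultimately show "z \<in> {z\<in>ball 0 1. f (\<phi> z) \<in> S}" using w by simp
    qed
    moreover have "path_connected (\<psi> ` k ` (W \<inter> S))"
    proof (intro path_connected_continuous_image convex_imp_path_connected convex_Int W that)
      show "continuous_on (W \<inter> S) k" by (rule continuous_on_subset[OF contkW]) blast
      show "continuous_on (k ` (W \<inter> S)) \<psi>" by (rule continuous_on_subset[OF cont\<psi>]) (auto simp: U_def)
    qed
    ultimately show ?thesis by simp
  qed
  have pc_gt: "path_connected {z\<in>ball 0 1. v z > c}" for c
  proof -
    have "{z\<in>ball 0 1. v z > c} = {z\<in>ball 0 1. f (\<phi> z) \<in> {w. Im w > c}}"
      using v_f by auto
    then show ?thesis using pc[OF convex_halfspace_Im_gt] by simp
  qed
  have pc_lt: "path_connected {z\<in>ball 0 1. v z < c}" for c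
  proof -
    have "{z\<in>ball 0 1. v z < c} = {z\<in>ball 0 1. f (\<phi> z) \<in> {w. Im w < c}}"
      using v_f by auto
    then show ?thesis using pc[OF convex_halfspace_Im_lt] by simp
  qed
  define E where "E = {t. \<exists>l. ((\<lambda>\<rho>. \<phi> (of_real \<rho> * cis t)) \<longlongrightarrow> l) (at_left 1)}"
  have \<phi>_ball: "\<phi> ` ball 0 1 \<subseteq> ball 0 1" using \<phi>_surj U1 by simp
  have negE: "negligible (- E)"
    using radial_limits_almost_everywhere[OF hol\<phi> inj\<phi> \<phi>_ball] unfolding E_def by (subst Collect_neg_eq[symmetric])
  have "\<exists>l. ((\<lambda>\<rho>. \<phi> (of_real \<rho> * cis t)) \<longlongrightarrow> l) (at_left 1)" if "t \<in> E" for t using that by (simp add: E_def)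
  then obtain l where l: "\<And>t. t \<in> E \<Longrightarrow> ((\<lambda>\<rho>. \<phi> (of_real \<rho> * cis t)) \<longlongrightarrow> l t) (at_left 1)" by metis
  have ev: "\<forall>\<^sub>F \<rho> in at_left (1::real). of_real \<rho> * cis t \<in> ball 0 1" for t
    unfolding eventually_at_left_field by (rule exI[of _ 0]) (auto simp: norm_mult)
  \<comment> \<open>Radial limits of \<open>\<phi>\<close> land in the compact set \<open>Q\<close>
    inside the disk, so \<open>F\<close> is continuous there and \<open>v\<close> inherits the
    limits.\<close>
  have lQ: "l t \<in> Q" if "t \<in> E" for t
  proof (rule Lim_in_closed_set[OF compact_imp_closed[OF compQ] _ _ l[OF that]])
    show "\<forall>\<^sub>F \<rho> in at_left (1::real). \<phi> (of_real \<rho> * cis t) \<in> Q"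
      using ev[of t] by (rule eventually_mono) (use \<phi>_in UQ in blast)
  qed auto
  define L where "L t = Im (F (l t))" for t
  have contF: "isCont F z" if "z \<in> ball 0 1" for z
    using holomorphic_on_imp_continuous_on[OF holF] that by (simp add: continuous_on_eq_continuous_at)
  have lim: "((\<lambda>\<rho>. v (of_real \<rho> * cis t)) \<longlongrightarrow> L t) (at_left 1)" if "t \<in> E" for t
    unfolding v_def L_def
    by (intro tendsto_Im isCont_tendsto_compose[OF contF l[OF that]]) (use lQ[OF that] Q_sub in blast)
  have "compact (F ` Q)"
    by (rule compact_continuous_image[OF continuous_on_subset[OF holomorphic_on_imp_continuous_on[OF holF] Q_sub] compQ])
  then obtain M where M: "\<And>z. z \<in> Q \<Longrightarrow> cmod (F z) \<le> M"
    by (meson bounded_iff compact_imp_bounded imageI)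
  have M': "\<bar>Im (F z)\<bar> \<le> M" if "z \<in> Q" for z using M[OF that] abs_Im_le_cmod[of "F z"] by linarith
  have cis_per: "cis (t + 2*pi) = cis t" "cis (t - 2*pi) = cis t" for t
    by (simp_all add: complex_eq_iff sin_diff cos_diff)
  have per: "t + 2*pi \<in> E" "t - 2*pi \<in> E" if "t \<in> E" for t
    using that cis_per by (simp_all add: E_def)
  have Lper: "L (t + 2*pi) = L t" if "t \<in> E" for t
  proof -
    have "((\<lambda>\<rho>. \<phi> (of_real \<rho> * cis t)) \<longlongrightarrow> l (t + 2*pi)) (at_left 1)"
      using l[OF per(1)[OF that]] by (simp add: cis_per)
    then have "l (t + 2*pi) = l t" using l[OF that] by (rule tendsto_unique[rotated]) simp
    then show ?thesis by (simp add: L_def)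
  qed
  \<comment> \<open>A set with negligible complement meets every interval; this supplies two points
    of \<open>E\<close> within one period.\<close>
  have ex: "\<exists>t\<in>E. x < t \<and> t < y" if "x < y" for x y
  proof (rule ccontr)
    assume "\<not> (\<exists>t\<in>E. x < t \<and> t < y)"
    then have "box x y \<subseteq> - E" by (auto simp: box_real)
    then have "negligible (box x y)" using negE negligible_subset by blast
    then show False using that open_not_negligible[of "box x y"] by (auto simp: box_real)
  qed
  obtain s0 where s0: "s0 \<in> E" "0 < s0" "s0 < 1" using ex[of 0 1] by auto
  obtain t0 where t0: "t0 \<in> E" "1 < t0" "t0 < 2" using ex[of 1 2] by auto
  have t0s0: "s0 < t0" "t0 < s0 + 2*pi" using s0 t0 pi_gt3 by auto
  have bddL: "\<bar>L t\<bar> \<le> M" if "t \<in> E" for t unfolding L_def by (rule M'[OF lQ[OF that]])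
  have alt: "\<not> (L t1 > c \<and> L t2 < c \<and> L t3 > c \<and> L t4 < c)"
    if "{t1,t2,t3,t4} \<subseteq> E" "t1 < t2" "t2 < t3" "t3 < t4" "t4 < t1 + 2*pi" for c t1 t2 t3 t4
    by (rule radial_limits_not_alternating[OF pc_gt pc_lt lim lim lim lim that(2-5)]) (use that(1) in auto)
  obtain a b w1 w2 where ab: "a < b" "b < a + 2*pi"
    "\<And>s t. \<lbrakk>a \<le> s; s \<le> t; t \<le> b\<rbrakk> \<Longrightarrow> w1 s \<le> w1 t"
    "\<And>s t. \<lbrakk>b \<le> s; s \<le> t; t \<le> a + 2*pi\<rbrakk> \<Longrightarrow> w2 t \<le> (w2 s :: real)"
    "\<And>t. \<lbrakk>t \<in> E; a \<le> t; t \<le> b\<rbrakk> \<Longrightarrow> \<bar>L t - w1 t\<bar> \<le> \<epsilon>"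
    "\<And>t. \<lbrakk>t \<in> E; b \<le> t; t \<le> a + 2*pi\<rbrakk> \<Longrightarrow> \<bar>L t - w2 t\<bar> \<le> \<epsilon>"
    by (rule unimodal_approximation[where A=E and L=L and B=M and \<epsilon>=\<epsilon>])
      ((rule per Lper s0(1) t0(1) t0s0 bddL alt \<open>\<epsilon> > 0\<close> that; assumption)+)
  have holF\<phi>: "(\<lambda>z. F (\<phi> z)) holomorphic_on ball 0 1"
    using holomorphic_on_compose_gen[OF hol\<phi> holF \<phi>_ball] by (simp only: o_def)
  have bddF\<phi>: "\<bar>Im (F (\<phi> z))\<bar> \<le> M" if "cmod z < 1" for z
    by (rule M') (use \<phi>_in UQ that in auto)
  show thesis
  proof (rule that[of \<phi> "cis (-(a+b)/2)" "cis a" "cis b"])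
    show "Re (cis (-(a+b)/2) * (z - cis a) * (z - cis b) * deriv (\<lambda>z. F (\<phi> z)) z) \<ge> - (20 * \<epsilon> / (1 - cmod z)^4)"
      if "z \<in> ball 0 1" for z
      by (rule half_plane_of_unimodal_boundary_values[where L=L and A=E and M=M, OF holF\<phi> bddF\<phi> lim[unfolded v_def] negE ab _ \<open>\<epsilon> > 0\<close>])
        (use that in auto)
  qed (use hol\<phi> \<phi>_ball inj\<phi> \<phi>_0 brU \<phi>_surj d\<phi> in auto)
qed

text \<open>The radius tends to 1 and the error to 0 along the same sequence \<open>e\<close>. By
  \<open>close_to_identity\<close> the maps \<open>\<phi> n\<close> and their derivatives converge
  to those of the identity, and along a subsequence \<kappa>, p, q converge on the unit circle. Only
  the weak inequality passes to the limit.\<close>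

lemma half_plane_of_convex_image:
  fixes f F :: "complex \<Rightarrow> complex"
  assumes contf: "continuous_on (ball 0 1) f" and injf: "inj_on f (ball 0 1)" and conv: "convex (f ` ball 0 1)"
    and holF: "F holomorphic_on ball 0 1" and ImF: "\<And>z. z \<in> ball 0 1 \<Longrightarrow> Im (F z) = Im (f z)"
  obtains \<kappa> p q where "cmod \<kappa> = 1" "cmod p = 1" "cmod q = 1"
    "\<And>z. z \<in> ball 0 1 \<Longrightarrow> Re (\<kappa> * (z - p) * (z - q) * deriv F z) \<ge> 0"
proof -
  define r where "r n = 1 - 1 / real (n+2)" for n :: nat
  define e where "e n = 1 / real (n+2)" for n :: nat
  have r: "0 < r n" "r n < 1" and e: "e n > 0" for n by (auto simp: r_def e_def)
  have e_lim: "e \<longlonglongrightarrow> 0" unfolding e_def by real_asymp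
  have re: "1 - r n = e n" for n by (simp add: r_def e_def)
  define good where "good n \<phi> \<kappa> p q \<longleftrightarrow> \<phi> holomorphic_on ball 0 1 \<and> \<phi> ` ball 0 1 \<subseteq> ball 0 1 \<and> inj_on \<phi> (ball 0 1) \<and>
    \<phi> 0 = 0 \<and> ball 0 (r n) \<subseteq> \<phi> ` ball 0 1 \<and> deriv \<phi> 0 = of_real (cmod (deriv \<phi> 0)) \<and>
    cmod \<kappa> = 1 \<and> cmod p = 1 \<and> cmod q = 1 \<and>
    (\<forall>z\<in>ball 0 1. Re (\<kappa> * (z - p) * (z - q) * deriv (\<lambda>z. F (\<phi> z)) z) \<ge> - (20 * e n / (1 - cmod z)^4))" for n \<phi> \<kappa> p q
  have "\<exists>\<phi> \<kappa> p q. good n \<phi> \<kappa> p q" for n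
    by (rule half_plane_on_exhausting_map[OF contf injf conv holF ImF r e, of n n]) (unfold good_def, blast+)
  then obtain \<phi> \<kappa> p q where good: "\<And>n. good n (\<phi> n) (\<kappa> n) (p n) (q n)" by metis
  note g = good[unfolded good_def]
  have "compact (sphere (0::complex) 1 \<times> sphere (0::complex) 1 \<times> sphere (0::complex) 1)"
    by (intro compact_Times compact_sphere)
  moreover have "\<forall>n. (\<kappa> n, p n, q n) \<in> sphere (0::complex) 1 \<times> sphere (0::complex) 1 \<times> sphere (0::complex) 1"
    using g by simp
  ultimately obtain l s where l: "l \<in> sphere (0::complex) 1 \<times> sphere (0::complex) 1 \<times> sphere (0::complex) 1"
    and s: "strict_mono (s :: nat \<Rightarrow> nat)" and lim: "((\<lambda>n. (\<kappa> n, p n, q n)) \<circ> s) \<longlonglongrightarrow> l"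
    unfolding compact_def by meson
  obtain \<kappa>' p' q' where l_eq: "l = (\<kappa>', p', q')" by (cases l)
  have l\<kappa>: "(\<lambda>n. \<kappa> (s n)) \<longlonglongrightarrow> \<kappa>'" and lp: "(\<lambda>n. p (s n)) \<longlonglongrightarrow> p'" and lq: "(\<lambda>n. q (s n)) \<longlonglongrightarrow> q'"
    using tendsto_fst[OF lim] tendsto_fst[OF tendsto_snd[OF lim]] tendsto_snd[OF tendsto_snd[OF lim]]
    by (simp_all add: l_eq o_def)
  have es: "(\<lambda>n. e (s n)) \<longlonglongrightarrow> 0" using LIMSEQ_subseq_LIMSEQ[OF e_lim s] by (simp add: o_def)
  show thesis
  proof (rule that[of \<kappa>' p' q'])
    show "cmod \<kappa>' = 1" "cmod p' = 1" "cmod q' = 1" using l by (auto simp: l_eq)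
    fix z :: complex assume z: "z \<in> ball 0 1"
    have null: "X \<longlonglongrightarrow> 0" if "\<And>n. cmod (X n) \<le> c * e (s n)" for X :: "nat \<Rightarrow> complex" and c
      by (rule Lim_null_comparison[of _ "\<lambda>n. c * e (s n)"])
        (use that tendsto_mult[OF tendsto_const[of c] es] in auto)
    have "(\<lambda>n. \<phi> (s n) z - z) \<longlonglongrightarrow> 0"
      by (rule null[of _ "6 / (1 - cmod z)"])
        (use close_to_identity(1)[of "\<phi> (s _)" "r (s _)" z] g r z in \<open>simp add: re\<close>)
    then have l\<phi>: "(\<lambda>n. \<phi> (s n) z) \<longlonglongrightarrow> z" by (rule LIM_zero_cancel)
    have "(\<lambda>n. deriv (\<phi> (s n)) z - 1) \<longlonglongrightarrow> 0"
      by (rule null[of _ "24 / (1 - cmod z)\<^sup>2"])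
        (use close_to_identity(2)[of "\<phi> (s _)" "r (s _)" z] g r z in \<open>simp add: re\<close>)
    then have l\<phi>': "(\<lambda>n. deriv (\<phi> (s n)) z) \<longlonglongrightarrow> 1" by (rule LIM_zero_cancel)
    have "isCont (deriv F) z"
      using continuous_on_eq_continuous_at[of "ball 0 1" "deriv F"] z
        holomorphic_on_imp_continuous_on[OF holomorphic_deriv[OF holF open_ball]] by auto
    from isCont_tendsto_compose[OF this l\<phi>]
    have lF: "(\<lambda>n. deriv F (\<phi> (s n) z)) \<longlonglongrightarrow> deriv F z" .
    have chain: "deriv (\<lambda>z. F (\<phi> n z)) z = deriv F (\<phi> n z) * deriv (\<phi> n) z" for n
    proof (rule DERIV_imp_deriv, rule DERIV_chain2[where g="\<phi> n"])
      show "(F has_field_derivative deriv F (\<phi> n z)) (at (\<phi> n z))"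
        by (rule holomorphic_derivI[OF holF open_ball]) (use g[of n] z in blast)
      show "(\<phi> n has_field_derivative deriv (\<phi> n) z) (at z)"
        by (rule holomorphic_derivI[OF _ open_ball z]) (use g[of n] in blast)
    qed
    have a: "(\<lambda>n. Re (\<kappa> (s n) * (z - p (s n)) * (z - q (s n)) * (deriv F (\<phi> (s n) z) * deriv (\<phi> (s n)) z)))
        \<longlonglongrightarrow> Re (\<kappa>' * (z - p') * (z - q') * (deriv F z * 1))"
      by (intro tendsto_intros l\<kappa> lp lq lF l\<phi>')
    have b: "(\<lambda>n. - (20 * e (s n) / (1 - cmod z)^4)) \<longlonglongrightarrow> 0"
      using tendsto_mult[OF tendsto_const[of "- (20 / (1 - cmod z)^4)"] es] by simp
    have c: "\<exists>N. \<forall>n\<ge>N. - (20 * e (s n) / (1 - cmod z)^4) \<le> Re (\<kappa> (s n) * (z - p (s n)) * (z - q (s n)) * (deriv F (\<phi> (s n) z) * deriv (\<phi> (s n)) z))"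
      using g z by (intro exI[of _ 0] allI impI) (simp only: chain[symmetric])
    have "0 \<le> Re (\<kappa>' * (z - p') * (z - q') * (deriv F z * 1))"
      by (rule LIMSEQ_le[OF b a c])
    then show "Re (\<kappa>' * (z - p') * (z - q') * deriv F z) \<ge> 0" by simp
  qed
qed

text \<open>A nonconstant \<open>P\<close> is open, so \<kappa> P cannot touch the imaginary axis
  without crossing it. A constant \<open>P\<close> equals 1; then \<kappa> may be purely imaginary
  and has to be replaced by 1.\<close>

lemma half_plane_strict:
  assumes holo: "P holomorphic_on ball 0 1" and P0: "P 0 = 1" and \<kappa>: "cmod \<kappa> = 1"
    and nonneg: "\<And>z. z \<in> ball 0 1 \<Longrightarrow> Re (\<kappa> * P z) \<ge> 0"
  obtains \<kappa>' where "cmod \<kappa>' = 1" "\<And>z. z \<in> ball 0 1 \<Longrightarrow> Re (\<kappa>' * P z) > 0"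
proof (cases "P constant_on ball 0 1")
  case True
  then have "P z = 1" if "z \<in> ball 0 1" for z using that P0 unfolding constant_on_def by (metis centre_in_ball zero_less_one)
  then show ?thesis using that[of 1] by simp
next
  case False
  have op: "open (P ` ball 0 1)"
    by (rule open_mapping_thm[OF holo _ _ _ order_refl False]) auto
  have "Re (\<kappa> * P z) > 0" if z: "z \<in> ball 0 1" for z
  proof (rule ccontr)
    assume "\<not> Re (\<kappa> * P z) > 0"
    then have 0: "Re (\<kappa> * P z) = 0" using nonneg[OF z] by linarith
    obtain d where d: "d > 0" "cball (P z) d \<subseteq> P ` ball 0 1"
      using op z open_contains_cball by (metis imageI)
    \<comment> \<open>The direction -cnj \<kappa> is the one in which Re (\<kappa> w) decreases
      fastest; a step of length \<open>d\<close> lowers it by d.\<close>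
    have "P z - of_real d * cnj \<kappa> \<in> cball (P z) d" using d \<kappa> by (simp add: dist_norm norm_mult)
    then obtain w where w: "w \<in> ball 0 1" "P z - of_real d * cnj \<kappa> = P w" using d by blast
    have "\<kappa> * P w = \<kappa> * P z - of_real d * (\<kappa> * cnj \<kappa>)" by (simp only: w(2)[symmetric] right_diff_distrib mult.left_commute)
    also have "\<kappa> * cnj \<kappa> = 1" using complex_norm_square[of \<kappa>] \<kappa> by simp
    finally have "Re (\<kappa> * P w) = - d" using 0 by simp
    then show False using nonneg[OF w(1)] d by simp
  qed
  then show ?thesis using that \<kappa> by blast
qed

text \<open>Since u \<epsilon> = - cnj u, the function u G is u h - cnj u g, whose imaginary part
  agrees with that of u f; rotation preserves convexity of the range. The factors z - p are
  rewritten as -p (1 - cnj p z), which is why the conjugates of \<open>p\<close> and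
  \<open>q\<close> are returned. That g'(0) = 0 gives the normalization at 0 for every
  \<epsilon>.\<close>

lemma convex_harmonic_close_to_convex:
  assumes f: "f \<in> class_K_H0" and dec: "decomposition f h g" and \<epsilon>: "cmod \<epsilon> = 1"
  obtains \<kappa> p q where "cmod \<kappa> = 1" "cmod p = 1" "cmod q = 1"
    "\<And>z. z \<in> ball 0 1 \<Longrightarrow> Re (\<kappa> * ((1 - p * z) * (1 - q * z) * deriv (\<lambda>z. h z + \<epsilon> * g z) z)) > 0"
    "deriv (\<lambda>z. h z + \<epsilon> * g z) 0 = 1"
proof -
  have hol: "h holomorphic_on ball 0 1" "g holomorphic_on ball 0 1" and h0: "deriv h 0 = 1"
    and f_eq: "\<And>z. z \<in> ball 0 1 \<Longrightarrow> f z = h z + cnj (g z)"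
    using dec by (auto simp: decomposition_def)
  have inj: "inj_on f (ball 0 1)" and conv: "convex (f ` ball 0 1)" and dz: "dzbar f 0 = 0"
    using f by (auto simp: class_K_H0_def class_S_H0_def class_S_H_def)
  have g0: "deriv g 0 = 0" using dzbar_decomposition[OF dec, of 0] dz by simp
  define G where "G z = h z + \<epsilon> * g z" for z
  have holG: "G holomorphic_on ball 0 1" unfolding G_def by (intro holomorphic_intros hol)
  have G0: "deriv G 0 = 1"
  proof -
    have "(h has_field_derivative 1) (at 0)" "(g has_field_derivative 0) (at 0)"
      using holomorphic_derivI[OF hol(1) open_ball, of 0] holomorphic_derivI[OF hol(2) open_ball, of 0] h0 g0 by simp_all
    then show ?thesis unfolding G_def by (intro DERIV_imp_deriv) (auto intro!: derivative_eq_intros)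
  qed
  \<comment> \<open>A conjugated square root of -\<epsilon>, so that multiplying by \<open>u\<close>
    and using u cnj u = 1 turns u \<epsilon> into - cnj u.\<close>
  define u where "u = cnj (csqrt (- \<epsilon>))"
  have u2: "cnj u * cnj u = - \<epsilon>" using power2_csqrt[of "- \<epsilon>"] by (simp add: u_def power2_eq_square)
  then have "cmod u * cmod u = 1" using \<epsilon> by (metis complex_mod_cnj norm_minus_cancel norm_mult)
  then have u1: "cmod u = 1" by (metis abs_norm_cancel mult.right_neutral real_sqrt_abs2 real_sqrt_one)
  have uc: "u * cnj u = 1" using complex_norm_square[of u] u1 by simp
  have uG: "u * G z = u * h z - cnj u * g z" for z
  proof -
    have "u * \<epsilon> = - (u * cnj u) * cnj u" using u2 by (simp add: mult.assoc)
    then have "u * \<epsilon> = - cnj u" by (simp add: uc)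
    then show ?thesis unfolding G_def by (metis (no_types, opaque_lifting) diff_minus_eq_add distrib_left mult.assoc mult_minus_left minus_minus)
  qed
  have cf: "continuous_on (ball 0 1) (\<lambda>z. h z + cnj (g z))"
    using hol by (intro continuous_intros holomorphic_on_imp_continuous_on)
  have contf: "continuous_on (ball 0 1) (\<lambda>z. u * f z)"
    using continuous_on_cong[of "ball 0 1" "ball 0 1" f "\<lambda>z. h z + cnj (g z)"] cf f_eq by (intro continuous_intros) auto
  have injf: "inj_on (\<lambda>z. u * f z) (ball 0 1)" using inj u1 unfolding inj_on_def by (metis mult_cancel_left norm_zero zero_neq_one)
  have convf: "convex ((\<lambda>z. u * f z) ` ball 0 1)"
    using convex_linear_image[OF bounded_linear.linear[OF bounded_linear_mult_right[of u]] conv] by (simp add: image_image)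
  have holuG: "(\<lambda>z. u * G z) holomorphic_on ball 0 1" by (intro holomorphic_intros holG)
  have Im: "Im (u * G z) = Im (u * f z)" if "z \<in> ball 0 1" for z
    unfolding uG f_eq[OF that] by (simp add: algebra_simps)
  obtain \<kappa> p q where k: "cmod \<kappa> = 1" "cmod p = 1" "cmod q = 1"
    and re: "\<And>z. z \<in> ball 0 1 \<Longrightarrow> Re (\<kappa> * (z - p) * (z - q) * deriv (\<lambda>z. u * G z) z) \<ge> 0"
    using half_plane_of_convex_image[OF contf injf convf holuG Im] by blast
  have pc: "p * cnj p = 1" "q * cnj q = 1" using complex_norm_square[of p] complex_norm_square[of q] k by auto
  define P where "P z = (1 - cnj p * z) * (1 - cnj q * z) * deriv G z" for z
  have holP: "P holomorphic_on ball 0 1" unfolding P_def by (intro holomorphic_intros holomorphic_deriv holG) auto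
  have "Re ((\<kappa> * u * p * q) * P z) \<ge> 0" if z: "z \<in> ball 0 1" for z
  proof -
    have "(z - p) = - p * (1 - cnj p * z)" "(z - q) = - q * (1 - cnj q * z)"
      using pc by (simp_all add: algebra_simps)
    moreover have "deriv (\<lambda>z. u * G z) z = u * deriv G z"
      using holomorphic_on_imp_differentiable_at[OF holG open_ball z] by (simp add: deriv_cmult)
    ultimately have eq: "\<kappa> * (z - p) * (z - q) * deriv (\<lambda>z. u * G z) z = (\<kappa> * u * p * q) * P z"
      unfolding P_def by (simp add: mult_ac)
    show ?thesis using re[OF z] by (simp only: eq)
  qed
  then obtain \<kappa>' where "cmod \<kappa>' = 1" "\<And>z. z \<in> ball 0 1 \<Longrightarrow> Re (\<kappa>' * P z) > 0"
    using half_plane_strict[OF holP, of "\<kappa> * u * p * q"] k u1 G0 by (auto simp: P_def norm_mult)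
  then show thesis using that[of \<kappa>' "cnj p" "cnj q"] k G0 by (simp add: P_def G_def[abs_def])
qed

section \<open>Coefficients of functions with values in a half-plane\<close>

text \<open>Cauchy's formula read as a Fourier coefficient, so that conjugates can be added under
  the integral.\<close>

lemma fps_nth_has_integral:
  assumes holo: "Q holomorphic_on ball 0 1" and \<rho>: "0 < \<rho>" "\<rho> < 1"
  shows "((\<lambda>t. Q (of_real \<rho> * cis t) * cis (- (real j * t))) has_integral (2 * of_real pi * (fps_nth (fps_expansion Q 0) j * of_real \<rho> ^ j))) {0..2*pi}"
proof -
  have sub: "cball 0 \<rho> \<subseteq> ball (0::complex) 1" using \<rho> by auto
  have "((\<lambda>u. Q u / (u - 0) ^ Suc j) has_contour_integral ((2 * pi * \<i>) / fact j * (deriv ^^ j) Q 0)) (circlepath 0 \<rho>)"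
    by (rule Cauchy_has_contour_integral_higher_derivative_circlepath)
      (use \<rho> sub holo in \<open>auto intro: holomorphic_on_subset holomorphic_on_imp_continuous_on\<close>)
  then have "((\<lambda>t. Q (0 + of_real \<rho> * cis t) / (0 + of_real \<rho> * cis t - 0) ^ Suc j * of_real \<rho> * \<i> * cis t) has_integral
      ((2 * pi * \<i>) / fact j * (deriv ^^ j) Q 0)) {0..2*pi}"
    unfolding circlepath_def by (subst (asm) has_contour_integral_part_circlepath_iff) auto
  then have "((\<lambda>t. Q (of_real \<rho> * cis t) / (of_real \<rho> * cis t) ^ Suc j * (of_real \<rho> * \<i> * cis t)) has_integral
      ((2 * pi * \<i>) / fact j * (deriv ^^ j) Q 0)) {0..2*pi}"
    by (simp only: add_0_left diff_0_right mult.assoc)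
  from has_integral_mult_right[OF this, of "- \<i> * of_real \<rho> ^ j"]
  have I: "((\<lambda>t. (- \<i> * of_real \<rho> ^ j) * (Q (of_real \<rho> * cis t) / (of_real \<rho> * cis t) ^ Suc j * (of_real \<rho> * \<i> * cis t))) has_integral
      ((- \<i> * of_real \<rho> ^ j) * ((2 * pi * \<i>) / fact j * (deriv ^^ j) Q 0))) {0..2*pi}" .
  have 1: "(- \<i> * of_real \<rho> ^ j) * (Q (of_real \<rho> * cis t) / (of_real \<rho> * cis t) ^ Suc j * (of_real \<rho> * \<i> * cis t)) =
      Q (of_real \<rho> * cis t) * cis (- (real j * t))" for t
  proof -
    have c: "cis (- (real j * t)) = inverse (cis t ^ j)" by (simp add: Complex.DeMoivre cis_inverse)
    have e: "(of_real \<rho> * cis t) ^ Suc j = of_real \<rho> ^ j * cis t ^ j * (of_real \<rho> * cis t)"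
      by (simp add: power_mult_distrib)
    have w: "of_real \<rho> * \<i> * cis t = (of_real \<rho> * cis t) * \<i>" by simp
    have alg: "(- \<i> * X) * (q / (X * Y * W) * (W * \<i>)) = q * inverse Y" if "X \<noteq> 0" "W \<noteq> 0" for X Y W q :: complex
    proof -
      have "(- \<i> * X) * (q / (X * Y * W) * (W * \<i>)) = (- \<i> * \<i>) * q * (X * W) / (X * W * Y)" by (simp add: mult_ac)
      also have "\<dots> = q / Y" using that by simp
      finally show ?thesis by (simp add: divide_inverse)
    qed
    show ?thesis unfolding c e w by (rule alg) (use \<rho> in auto)
  qed
  have 2: "(- \<i> * of_real \<rho> ^ j) * ((2 * pi * \<i>) / fact j * (deriv ^^ j) Q 0) = 2 * of_real pi * (fps_nth (fps_expansion Q 0) j * of_real \<rho> ^ j)"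
    by (simp add: fps_expansion_def field_simps)
  show ?thesis using I unfolding 1 2 .
qed

text \<open>The Fourier coefficients of negative index vanish: up to a power of \<rho>, the one of
  index -j is the coefficient of index j of Q z^(2j), whose expansion begins at degree 2j >
  j.\<close>

lemma has_integral_cis_mult_zero:
  assumes holo: "Q holomorphic_on ball 0 1" and \<rho>: "0 < \<rho>" "\<rho> < 1" and "j \<ge> 1"
  shows "((\<lambda>t. Q (of_real \<rho> * cis t) * cis (real j * t)) has_integral 0) {0..2*pi}"
proof -
  define R where "R z = Q z * z ^ (2 * j)" for z
  have holR: "R holomorphic_on ball 0 1" unfolding R_def by (intro holomorphic_intros holo)
  have "Q has_fps_expansion fps_expansion Q 0" by (rule has_fps_expansion_fps_expansion[OF open_ball _ holo]) simp
  then have "R has_fps_expansion fps_expansion Q 0 * fps_X ^ (2 * j)" unfolding R_def by (intro fps_expansion_intros)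
  then have "fps_nth (fps_expansion R 0) j = 0"
    using \<open>j \<ge> 1\<close> by (simp add: fps_expansion_eqI fps_X_power_mult_right_nth)
  with fps_nth_has_integral[OF holR \<rho>, of j]
  have "((\<lambda>t. R (of_real \<rho> * cis t) * cis (- (real j * t))) has_integral 0) {0..2*pi}" by simp
  from has_integral_mult_left[OF this, of "inverse (of_real \<rho> ^ (2 * j))"]
  have "((\<lambda>t. R (of_real \<rho> * cis t) * cis (- (real j * t)) * inverse (of_real \<rho> ^ (2 * j))) has_integral 0) {0..2*pi}" by simp
  moreover have "R (of_real \<rho> * cis t) * cis (- (real j * t)) * inverse (of_real \<rho> ^ (2 * j)) = Q (of_real \<rho> * cis t) * cis (real j * t)" for t
  proof -
    have "cis t ^ (2 * j) * cis (- (real j * t)) = cis (real j * t)"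
      by (simp add: Complex.DeMoivre cis_mult mult.commute)
    then show ?thesis using \<rho> by (simp add: R_def power_mult_distrib field_simps)
  qed
  ultimately show ?thesis by simp
qed

text \<open>Caratheodory's argument. Adding the conjugate of a vanishing coefficient replaces
  \<open>Y\<close> by 2 Re Y in the integral. As this is positive, the coefficient is at most its
  mean, which is 2 Re \<kappa>.\<close>

lemma half_plane_coeff_le_2:
  assumes holo: "P holomorphic_on ball 0 1" and P0: "P 0 = 1" and \<kappa>: "cmod \<kappa> = 1"
    and pos: "\<And>z. z \<in> ball 0 1 \<Longrightarrow> Re (\<kappa> * P z) > 0" and "j \<ge> 1"
  shows "cmod (fps_nth (fps_expansion P 0) j) \<le> 2"
proof -
  define Q where "Q z = \<kappa> * P z" for z
  have holQ: "Q holomorphic_on ball 0 1" unfolding Q_def by (intro holomorphic_intros holo)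
  have Qe: "fps_nth (fps_expansion Q 0) j = \<kappa> * fps_nth (fps_expansion P 0) j" for j
  proof -
    have "P has_fps_expansion fps_expansion P 0" by (rule has_fps_expansion_fps_expansion[OF open_ball _ holo]) simp
    then have "Q has_fps_expansion fps_const \<kappa> * fps_expansion P 0" unfolding Q_def by (intro fps_expansion_intros)
    then show ?thesis by (simp add: fps_expansion_eqI)
  qed
  have main: "cmod (fps_nth (fps_expansion P 0) j) * \<rho> ^ j \<le> 2" if \<rho>: "0 < \<rho>" "\<rho> < 1" for \<rho>
  proof -
    define a where "a = fps_nth (fps_expansion Q 0) j * of_real \<rho> ^ j"
    have in_d: "of_real \<rho> * cis t \<in> ball 0 1" for t using \<rho> by (simp add: norm_mult)
    define Y where "Y t = Q (of_real \<rho> * cis t)" for t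
    have I1: "((\<lambda>t. Y t * cis (- (real j * t))) has_integral (2 * of_real pi * a)) {0..2*pi}"
      unfolding a_def Y_def by (rule fps_nth_has_integral[OF holQ \<rho>])
    have I2: "((\<lambda>t. cnj (Y t * cis (real j * t))) has_integral cnj 0) {0..2*pi}"
      using has_integral_linear[OF has_integral_cis_mult_zero[OF holQ \<rho> \<open>j \<ge> 1\<close>] bounded_linear_cnj] by (simp add: o_def Y_def)
    have I: "((\<lambda>t. of_real (2 * Re (Y t)) * cis (- (real j * t))) has_integral (2 * of_real pi * a)) {0..2*pi}"
    proof -
      have "Y t * cis (- (real j * t)) + cnj (Y t * cis (real j * t)) =
          of_real (2 * Re (Y t)) * cis (- (real j * t))" for t
      proof -
        have "cnj (Y t * cis (real j * t)) = cnj (Y t) * cis (- (real j * t))"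
          by (simp add: cis_cnj)
        then show ?thesis by (simp only: distrib_right[symmetric] complex_add_cnj)
      qed
      then show ?thesis using has_integral_add[OF I1 I2] by simp
    qed
    have J: "((\<lambda>t. 2 * Re (Y t)) has_integral (4 * pi * Re \<kappa>)) {0..2*pi}"
    proof -
      have "((\<lambda>t. Y t) has_integral (2 * of_real pi * \<kappa>)) {0..2*pi}"
        using fps_nth_has_integral[OF holQ \<rho>, of 0] by (simp add: fps_expansion_def Y_def Q_def P0)
      from has_integral_linear[OF this bounded_linear_Re]
      have "((\<lambda>t. Re (Y t)) has_integral (2 * pi * Re \<kappa>)) {0..2*pi}" by (simp add: o_def)
      from has_integral_mult_right[OF this, of 2] show ?thesis by (simp add: mult.assoc)
    qed
    have "norm (integral {0..2*pi} (\<lambda>t. of_real (2 * Re (Y t)) * cis (- (real j * t)))) \<le>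
        integral {0..2*pi} (\<lambda>t. 2 * Re (Y t))"
    proof (rule integral_norm_bound_integral)
      show "(\<lambda>t. of_real (2 * Re (Y t)) * cis (- (real j * t))) integrable_on {0..2*pi}"
        using I by (rule has_integral_integrable)
      show "(\<lambda>t. 2 * Re (Y t)) integrable_on {0..2*pi}" using J by (rule has_integral_integrable)
      show "norm (of_real (2 * Re (Y t)) * cis (- (real j * t))) \<le> 2 * Re (Y t)" for t
        using pos[OF in_d[of t]] unfolding norm_mult norm_of_real norm_cis Y_def Q_def by simp
    qed
    then have "cmod (2 * of_real pi * a) \<le> 4 * pi * Re \<kappa>"
      unfolding integral_unique[OF I] integral_unique[OF J] .
    then have "2 * pi * cmod a \<le> 2 * pi * (2 * Re \<kappa>)" by (simp add: norm_mult)
    then have "cmod a \<le> 2 * Re \<kappa>" by (subst (asm) mult_le_cancel_left_pos) auto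
    moreover have "Re \<kappa> \<le> 1" using complex_Re_le_cmod[of \<kappa>] \<kappa> by simp
    moreover have "cmod a = cmod (fps_nth (fps_expansion P 0) j) * \<rho> ^ j"
      using \<rho> \<kappa> by (simp add: a_def Qe norm_mult norm_power)
    ultimately show ?thesis by linarith
  qed
  have "((\<lambda>\<rho>. cmod (fps_nth (fps_expansion P 0) j) * \<rho> ^ j) \<longlongrightarrow> cmod (fps_nth (fps_expansion P 0) j) * 1 ^ j) (at_left 1)"
    by (intro tendsto_intros)
  moreover have "\<forall>\<^sub>F \<rho> in at_left (1::real). cmod (fps_nth (fps_expansion P 0) j) * \<rho> ^ j \<le> 2"
    unfolding eventually_at_left_field by (rule exI[of _ 0]) (use main in auto)
  ultimately have "cmod (fps_nth (fps_expansion P 0) j) * 1 ^ j \<le> 2"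
    by (rule tendsto_upperbound) simp
  then show ?thesis by simp
qed

text \<open>The Schwarz-Pick inequality at 0. The factor s < 1 forces values into the open disk,
  also when \<tau> is a unimodular constant, and tends to 1 at the end.\<close>

lemma deriv_0_le_1_minus_square:
  assumes holo: "\<tau> holomorphic_on ball 0 1" and le: "\<And>z. z \<in> ball 0 1 \<Longrightarrow> cmod (\<tau> z) \<le> 1"
  shows "cmod (deriv \<tau> 0) \<le> 1 - (cmod (\<tau> 0))\<^sup>2"
proof -
  define c where "c = \<tau> 0"
  have c1: "cmod c \<le> 1" unfolding c_def by (rule le) simp
  have main: "s * cmod (deriv \<tau> 0) \<le> 1 - s\<^sup>2 * (cmod c)\<^sup>2" if s: "0 < s" "s < 1" for s
  proof -
    have lt: "cmod (of_real s * \<tau> z) < 1" if "z \<in> ball 0 1" for z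
    proof -
      have "cmod (of_real s * \<tau> z) \<le> s * 1" unfolding norm_mult using le[OF that] s by (intro mult_mono) auto
      then show ?thesis using s by simp
    qed
    have sc: "cmod (of_real s * c) < 1" unfolding c_def by (rule lt) simp
    define m where "m z = Moebius_function 0 (of_real s * c) (of_real s * \<tau> z)" for z
    have "(Moebius_function 0 (of_real s * c) \<circ> (\<lambda>z. of_real s * \<tau> z)) holomorphic_on ball 0 1"
      by (rule holomorphic_on_compose_gen[OF _ Moebius_function_holomorphic[OF sc]])
        (use lt in \<open>auto intro!: holomorphic_intros holo\<close>)
    then have holm: "m holomorphic_on ball 0 1" by (simp only: m_def[abs_def] o_def)
    have m0: "m 0 = 0" by (simp add: m_def c_def Moebius_function_eq_zero)
    have mlt: "cmod (m z) < 1" if "cmod z < 1" for z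
      unfolding m_def by (rule Moebius_function_norm_lt_1[OF sc lt]) (use that in simp)
    have den: "1 - cnj (of_real s * c) * (of_real s * c) = of_real (1 - s\<^sup>2 * (cmod c)\<^sup>2)"
      using complex_norm_square[of c] by (simp add: power2_eq_square mult_ac)
    have pos: "1 - s\<^sup>2 * (cmod c)\<^sup>2 > 0"
    proof -
      have "(cmod (of_real s * c))\<^sup>2 < 1" using sc by (simp add: power_less_one_iff)
      then show ?thesis using s by (simp add: norm_mult power_mult_distrib)
    qed
    have "cmod (deriv m 0) \<le> 1" by (rule Schwarz_Lemma(2)[OF holm m0 mlt, of 0]) auto
    moreover have "deriv m 0 = of_real s * deriv \<tau> 0 / (1 - cnj (of_real s * c) * (of_real s * c))"
    proof (rule DERIV_imp_deriv)
      have cancel: "a * K / (K * K) = a / K" for a K :: complex by simp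
      have d: "(\<tau> has_field_derivative deriv \<tau> 0) (at 0)" by (rule holomorphic_derivI[OF holo open_ball]) simp
      have d0: "1 - cnj (of_real s * c) * (of_real s * \<tau> 0) \<noteq> 0"
        using den pos unfolding c_def by (metis less_irrefl of_real_eq_0_iff)
      have "((\<lambda>z. of_real s * \<tau> z - of_real s * c) has_field_derivative of_real s * deriv \<tau> 0) (at 0)"
        by (auto intro!: derivative_eq_intros d)
      moreover have "((\<lambda>z. 1 - cnj (of_real s * c) * (of_real s * \<tau> z)) has_field_derivative
          - (cnj (of_real s * c) * (of_real s * deriv \<tau> 0))) (at 0)"
        by (auto intro!: derivative_eq_intros d)
      ultimately have "(m has_field_derivative (of_real s * deriv \<tau> 0 * (1 - cnj (of_real s * c) * (of_real s * \<tau> 0)) -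
          (of_real s * \<tau> 0 - of_real s * c) * - (cnj (of_real s * c) * (of_real s * deriv \<tau> 0))) /
          ((1 - cnj (of_real s * c) * (of_real s * \<tau> 0)) * (1 - cnj (of_real s * c) * (of_real s * \<tau> 0)))) (at 0)"
        unfolding m_def Moebius_function_simple using d0 by (rule DERIV_divide)
      moreover have "of_real s * \<tau> 0 - of_real s * c = 0" by (simp add: c_def)
      ultimately show "(m has_field_derivative of_real s * deriv \<tau> 0 / (1 - cnj (of_real s * c) * (of_real s * c))) (at 0)"
        by (simp only: mult_zero_left diff_0_right c_def[symmetric] cancel)
    qed
    ultimately have "s * cmod (deriv \<tau> 0) / (1 - s\<^sup>2 * (cmod c)\<^sup>2) \<le> 1"
      using s pos by (simp only: den norm_divide norm_mult norm_of_real abs_of_pos)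
    then show ?thesis using pos by (simp add: pos_divide_le_eq)
  qed
  have "((\<lambda>s. s * cmod (deriv \<tau> 0)) \<longlongrightarrow> 1 * cmod (deriv \<tau> 0)) (at_left 1)"
    "((\<lambda>s. 1 - s\<^sup>2 * (cmod c)\<^sup>2) \<longlongrightarrow> 1 - 1\<^sup>2 * (cmod c)\<^sup>2) (at_left (1::real))"
    by (intro tendsto_intros)+
  moreover have "\<forall>\<^sub>F s in at_left (1::real). s * cmod (deriv \<tau> 0) \<le> 1 - s\<^sup>2 * (cmod c)\<^sup>2"
    unfolding eventually_at_left_field by (rule exI[of _ 0]) (use main in auto)
  ultimately have "1 * cmod (deriv \<tau> 0) \<le> 1 - 1\<^sup>2 * (cmod c)\<^sup>2"
    by (intro tendsto_le[of "at_left (1::real)"]) auto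
  then show ?thesis by (simp add: c_def)
qed

text \<open>Here \<omega> = z h(z), \<open>b1\<close> = h(0) and \<open>b2\<close> = h'(0); the
  coefficient formulas come from comparing powers in P (1 - \<omega>) = 1 + \<mu> \<omega>. The
  joint bound for b1 and b2 is finer than separate bounds for the coefficients and is what the
  estimate of a3 - a2^2 requires.\<close>

lemma half_plane_second_coeff:
  assumes holo: "P holomorphic_on ball 0 1" and P0: "P 0 = 1" and \<kappa>: "cmod \<kappa> = 1"
    and pos: "\<And>z. z \<in> ball 0 1 \<Longrightarrow> Re (\<kappa> * P z) > 0"
  obtains \<mu> b1 b2 where "cmod \<mu> = 1" "cmod b1 \<le> 1" "cmod b2 \<le> 1 - (cmod b1)\<^sup>2"
    "fps_nth (fps_expansion P 0) 1 = (1 + \<mu>) * b1" "fps_nth (fps_expansion P 0) 2 = (1 + \<mu>) * (b2 + b1\<^sup>2)"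
proof -
  obtain \<mu> \<omega> where \<mu>: "cmod \<mu> = 1" and \<omega>: "\<omega> holomorphic_on ball 0 1" "\<omega> 0 = 0"
    "\<And>z. z \<in> ball 0 1 \<Longrightarrow> cmod (\<omega> z) \<le> cmod z"
    "\<And>z. z \<in> ball 0 1 \<Longrightarrow> P z * (1 - \<omega> z) = 1 + \<mu> * \<omega> z"
    using half_plane_subordination[OF holo P0 \<kappa> pos] by metis
  obtain h where h: "h holomorphic_on ball 0 1" "\<And>z. cmod z < 1 \<Longrightarrow> \<omega> z = z * h z"
    using Schwarz3[OF \<omega>(1,2)] by blast
  have hle0: "cmod (h z) \<le> 1" if "z \<in> ball 0 1" "z \<noteq> 0" for z
  proof -
    have "cmod z * cmod (h z) \<le> cmod z * 1" using \<omega>(3)[OF that(1)] h(2)[of z] that by (simp add: norm_mult)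
    then show ?thesis using that by simp
  qed
  \<comment> \<open>Division by z gives the bound off 0 only; at 0 it follows by continuity.\<close>
  have hle: "cmod (h z) \<le> 1" if "z \<in> ball 0 1" for z
  proof (cases "z = 0")
    case True
    have "isCont h 0" using holomorphic_on_imp_continuous_on[OF h(1)] by (simp add: continuous_on_eq_continuous_at)
    then have "((\<lambda>z. cmod (h z)) \<longlongrightarrow> cmod (h 0)) (at 0)" by (intro tendsto_norm) (simp add: isCont_def)
    moreover have "\<forall>\<^sub>F z in at 0. cmod (h z) \<le> 1"
      unfolding eventually_at by (rule exI[of _ 1]) (use hle0 in auto)
    ultimately show ?thesis using True by (intro tendsto_upperbound[of "\<lambda>z. cmod (h z)" _ "at 0"]) auto
  qed (use hle0 that in auto)
  define H where "H = fps_expansion h 0"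
  define Pf where "Pf = fps_expansion P 0"
  have hH: "h has_fps_expansion H" unfolding H_def by (rule has_fps_expansion_fps_expansion[OF open_ball _ h(1)]) simp
  have hP: "P has_fps_expansion Pf" unfolding Pf_def by (rule has_fps_expansion_fps_expansion[OF open_ball _ holo]) simp
  have "(\<lambda>z. P z * (1 - z * h z)) has_fps_expansion Pf * (1 - fps_X * H)"
    by (intro fps_expansion_intros hH hP)
  moreover have "(\<lambda>z. 1 + \<mu> * (z * h z)) has_fps_expansion 1 + fps_const \<mu> * (fps_X * H)"
    by (intro fps_expansion_intros hH)
  moreover have "\<forall>\<^sub>F z in nhds 0. P z * (1 - z * h z) = 1 + \<mu> * (z * h z)"
  proof -
    have "\<forall>\<^sub>F z in nhds (0::complex). z \<in> ball 0 1" by (rule eventually_nhds_in_open) auto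
    then show ?thesis by eventually_elim (use \<omega>(4) h(2) in auto)
  qed
  ultimately have "(\<lambda>z. 1 + \<mu> * (z * h z)) has_fps_expansion Pf * (1 - fps_X * H)"
    "(\<lambda>z. 1 + \<mu> * (z * h z)) has_fps_expansion 1 + fps_const \<mu> * (fps_X * H)"
    using has_fps_expansion_cong[of "\<lambda>z. P z * (1 - z * h z)" "\<lambda>z. 1 + \<mu> * (z * h z)" "Pf * (1 - fps_X * H)"] by simp_all
  then have eq: "Pf * (1 - fps_X * H) = 1 + fps_const \<mu> * (fps_X * H)"
    by (metis fps_expansion_eqI)
  have Pf0: "fps_nth Pf 0 = 1" using P0 by (simp add: Pf_def fps_expansion_def)
  have "fps_nth (Pf * (1 - fps_X * H)) 1 = fps_nth Pf 1 - fps_nth H 0"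
    by (simp add: fps_mult_nth Pf0)
  moreover have "fps_nth (1 + fps_const \<mu> * (fps_X * H)) 1 = \<mu> * fps_nth H 0" by simp
  ultimately have p1: "fps_nth Pf 1 = (1 + \<mu>) * fps_nth H 0" unfolding eq by (simp add: algebra_simps)
  have "fps_nth (Pf * (1 - fps_X * H)) 2 = fps_nth Pf 2 - fps_nth Pf 1 * fps_nth H 0 - fps_nth H 1"
    by (simp add: fps_mult_nth Pf0 numeral_2_eq_2)
  moreover have "fps_nth (1 + fps_const \<mu> * (fps_X * H)) 2 = \<mu> * fps_nth H 1" by (simp add: numeral_2_eq_2)
  ultimately have p2: "fps_nth Pf 2 = (1 + \<mu>) * (fps_nth H 1 + (fps_nth H 0)\<^sup>2)"
    unfolding eq p1 by (simp add: algebra_simps power2_eq_square)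
  have H01: "fps_nth H 0 = h 0" "fps_nth H 1 = deriv h 0" by (simp_all add: H_def fps_expansion_def)
  show thesis
    by (rule that[OF \<mu> _ _ p1[unfolded Pf_def] p2[unfolded Pf_def]])
      (use hle[of 0] deriv_0_le_1_minus_square[OF h(1) hle] in \<open>simp_all add: H01 H01(2)[simplified]\<close>)
qed

section \<open>Functions subordinate to a convex univalent primitive\<close>

lemma one_minus_mult_nonzero:
  fixes u z :: complex
  assumes "cmod u = 1" "z \<in> ball 0 1"
  shows "1 - u * z \<noteq> 0"
proof
  assume "1 - u * z = 0"
  then have "cmod (u * z) = 1" by (metis eq_iff_diff_eq_0 norm_one)
  then show False using assms by (simp add: norm_mult)
qed

text \<open>For p = q the primitive is a Moebius map onto a half-plane. Otherwise it is a multiple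
  of the logarithm of a Moebius map \<open>y\<close> onto the right half-plane, and its range is a
  strip.\<close>

lemma ex_convex_univalent_primitive:
  fixes p q :: complex
  assumes p: "cmod p = 1" and q: "cmod q = 1"
  obtains \<Psi> where "\<And>z. z \<in> ball 0 1 \<Longrightarrow> (\<Psi> has_field_derivative 1 / ((1 - p * z) * (1 - q * z))) (at z)"
    "inj_on \<Psi> (ball 0 1)" "convex (\<Psi> ` ball 0 1)"
proof -
  note nz = one_minus_mult_nonzero
  have pc: "p * cnj p = 1" using complex_norm_square[of p] p by simp
  show thesis
  proof (cases "p = q")
    case True
    define \<Psi> where "\<Psi> z = z / (1 - p * z)" for z
    have key: "1 + p * \<Psi> z = 1 / (1 - p * z)" if "z \<in> ball 0 1" for z
      using nz[OF p that] by (simp add: \<Psi>_def field_simps)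
    have img: "\<Psi> ` ball 0 1 = {w. - 1/2 < Re (p * w)}"
    proof (intro set_eqI iffI)
      fix w assume "w \<in> \<Psi> ` ball 0 1"
      then obtain z where z: "z \<in> ball 0 1" "w = \<Psi> z" by blast
      have "(cmod (1 - p * z))\<^sup>2 * (1 + 2 * Re (p * w)) = 1 - (cmod z)\<^sup>2"
      proof -
        have "(1 - p * z) * (p * w) = p * z" using nz[OF p z(1)] by (simp add: z(2) \<Psi>_def)
        then have "cmod (1 - p * z) * cmod (p * w) = cmod z" by (metis norm_mult p mult_1)
        moreover have "cmod (1 - p * z) * cmod (1 + p * w) = 1" using key[OF z(1)] nz[OF p z(1)] z(2) by (simp add: norm_divide)
        moreover have "(cmod (1 + p * w))\<^sup>2 - (cmod (p * w))\<^sup>2 = 1 + 2 * Re (p * w)"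
          unfolding cmod_power2 by (simp add: power2_eq_square algebra_simps)
        ultimately show ?thesis by (metis mult_1 power_mult_distrib power_one right_diff_distrib)
      qed
      moreover have "1 - (cmod z)\<^sup>2 > 0" using z by (simp add: power_less_one_iff)
      ultimately have "1 + 2 * Re (p * w) > 0" by (metis zero_le_power2 linorder_not_less mult_nonneg_nonpos)
      then show "w \<in> {w. - 1/2 < Re (p * w)}" by simp
    next
      fix w assume "w \<in> {w. - 1/2 < Re (p * w)}"
      then have w: "1 + 2 * Re (p * w) > 0" by simp
      define z where "z = w / (1 + p * w)"
      have diff: "(cmod (1 + p * w))\<^sup>2 - (cmod (p * w))\<^sup>2 = 1 + 2 * Re (p * w)"
        unfolding cmod_power2 by (simp add: power2_eq_square algebra_simps)
      then have "(cmod (p * w))\<^sup>2 < (cmod (1 + p * w))\<^sup>2" using w by linarith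
      then have lt: "cmod w < cmod (1 + p * w)" using p by (simp add: norm_mult power2_less_imp_less)
      then have n: "1 + p * w \<noteq> 0" by (metis norm_ge_zero norm_zero not_less)
      have zin: "z \<in> ball 0 1" using lt n by (simp add: z_def norm_divide)
      have "1 - p * z = 1 / (1 + p * w)" using n by (simp add: z_def field_simps)
      then have "\<Psi> z = w" using n by (simp add: \<Psi>_def z_def)
      then show "w \<in> \<Psi> ` ball 0 1" using zin by blast
    qed
    have "convex ((\<lambda>w. p * w) -` {w. - 1/2 < Re w})"
      by (intro convex_linear_vimage bounded_linear.linear[OF bounded_linear_mult_right] convex_halfspace_Re_gt)
    then have "convex {w. - 1/2 < Re (p * w)}" by (simp only: vimage_def mem_Collect_eq)
    moreover have "inj_on \<Psi> (ball 0 1)"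
    proof (rule inj_onI)
      fix x y assume xy: "x \<in> ball 0 1" "y \<in> ball 0 1" "\<Psi> x = \<Psi> y"
      have "x * (1 - p * y) = y * (1 - p * x)" using xy(3) nz[OF p xy(1)] nz[OF p xy(2)] by (simp add: \<Psi>_def frac_eq_eq)
      then show "x = y" by (simp add: algebra_simps)
    qed
    moreover have "(\<Psi> has_field_derivative 1 / ((1 - p * z) * (1 - q * z))) (at z)" if "z \<in> ball 0 1" for z
      unfolding \<Psi>_def True[symmetric] using nz[OF p that] by (auto intro!: derivative_eq_intros simp: field_simps)
    ultimately show thesis using that img by metis
  next
    case False
    \<comment> \<open>The map (1 - q z) / (1 - p z) sends the disk onto a half-plane bounded by a
      line through 0; multiplication by cnj \<eta> turns it into the right half-plane.\<close>
    define \<eta> where "\<eta> = csqrt (- q * cnj p)"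
    have \<eta>2: "\<eta> * \<eta> = - q * cnj p" using power2_csqrt[of "- q * cnj p"] by (simp add: \<eta>_def power2_eq_square)
    have "cmod \<eta> * cmod \<eta> = 1" using arg_cong[OF \<eta>2, of cmod] p q by (simp add: norm_mult)
    then have \<eta>1: "cmod \<eta> = 1" by (metis abs_norm_cancel mult.right_neutral real_sqrt_abs2 real_sqrt_one)
    have \<eta>c: "\<eta> * cnj \<eta> = 1" using complex_norm_square[of \<eta>] \<eta>1 by simp
    have q_eq: "q = - \<eta> * \<eta> * p" 
    proof -
      have "\<eta> * \<eta> * p = - q * (p * cnj p)" unfolding \<eta>2 by (simp add: mult_ac)
      then show ?thesis by (simp add: pc)
    qed
    have Re\<eta>: "Re \<eta> > 0"
    proof -
      \<comment> \<open>The principal root gives the sign. Vanishing real part would mean \<eta>^2 =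
        -1, that is p = q.\<close>
      have "Re \<eta> \<ge> 0" unfolding \<eta>_def by (rule Re_csqrt)
      moreover have "Re \<eta> \<noteq> 0"
      proof
        assume "Re \<eta> = 0"
        moreover from this have "(Im \<eta>)\<^sup>2 = 1" using \<eta>1 cmod_power2[of \<eta>] by simp
        ultimately have "\<eta> * \<eta> = -1" by (simp add: complex_eq_iff power2_eq_square)
        then show False using q_eq False by simp
      qed
      ultimately show ?thesis by simp
    qed
    define y where "y z = cnj \<eta> * (1 - q * z) / (1 - p * z)" for z
    have y_Re: "(cmod (1 - p * z))\<^sup>2 * Re (y z) = Re \<eta> * (1 - (cmod z)\<^sup>2)" if "1 - p * z \<noteq> 0" for z
    proof -
      have "of_real ((cmod (1 - p * z))\<^sup>2) * y z = cnj \<eta> * (1 - q * z) * cnj (1 - p * z)"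
        unfolding complex_norm_square y_def using that by simp
      also have "\<dots> = cnj \<eta> + (cnj \<eta> * \<eta>) * \<eta> * p * z - cnj \<eta> * cnj p * cnj z - (cnj \<eta> * \<eta>) * \<eta> * (p * cnj p) * (z * cnj z)"
        unfolding q_eq by (simp add: algebra_simps)
      also have "\<dots> = cnj \<eta> + (\<eta> * p * z - cnj (\<eta> * p * z)) - \<eta> * of_real ((cmod z)\<^sup>2)"
        using \<eta>c pc by (simp only: complex_norm_square) (simp add: mult.commute)
      finally have "Re (of_real ((cmod (1 - p * z))\<^sup>2) * y z) = Re (cnj \<eta> + (\<eta> * p * z - cnj (\<eta> * p * z)) - \<eta> * of_real ((cmod z)\<^sup>2))"
        by (rule arg_cong)
      moreover have "Re (of_real a * b) = a * Re b" "Re (b * of_real a) = Re b * a" "Re (b - cnj b) = 0" for a b by simp_all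
      ultimately have "(cmod (1 - p * z))\<^sup>2 * Re (y z) = Re \<eta> - Re \<eta> * (cmod z)\<^sup>2"
        by (simp only: plus_complex.sel minus_complex.sel complex_cnj cnj.sel)
      then show ?thesis by (simp add: right_diff_distrib)
    qed
    have y_pos: "Re (y z) > 0" if "z \<in> ball 0 1" for z
    proof -
      have "Re \<eta> * (1 - (cmod z)\<^sup>2) > 0" using Re\<eta> that by (intro mult_pos_pos) (simp_all add: power_less_one_iff)
      then show ?thesis using y_Re[OF nz[OF p that]] by (metis zero_le_power2 linorder_not_less mult_nonneg_nonpos)
    qed
    have y_nz: "y z \<noteq> 0" if "z \<in> ball 0 1" for z using y_pos[OF that] by auto
    define \<Psi> where "\<Psi> z = Ln (y z) / (p - q)" for z
    have pq: "p - q \<noteq> 0" using False by simp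
    have deriv: "(\<Psi> has_field_derivative 1 / ((1 - p * z) * (1 - q * z))) (at z)" if z: "z \<in> ball 0 1" for z
    proof -
      have n: "1 - p * z \<noteq> 0" "1 - q * z \<noteq> 0" using nz[OF p z] nz[OF q z] by auto
      have e0: "\<eta> \<noteq> 0" using \<eta>1 by auto
      have "y z \<notin> \<real>\<^sub>\<le>\<^sub>0" using y_pos[OF z] by (auto simp: complex_nonpos_Reals_iff)
      moreover have "(y has_field_derivative (cnj \<eta> * (p - q) / (1 - p * z)^2)) (at z)"
        unfolding y_def using n by (auto intro!: derivative_eq_intros simp: field_simps power2_eq_square)
      ultimately have "((\<lambda>z. Ln (y z)) has_field_derivative inverse (y z) * (cnj \<eta> * (p - q) / (1 - p * z)^2)) (at z)"
        by (intro DERIV_chain2[where f=Ln and g=y] has_field_derivative_Ln)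
      then have "(\<Psi> has_field_derivative (1 / y z * (cnj \<eta> * (p - q) / (1 - p * z)^2)) / (p - q)) (at z)"
        unfolding \<Psi>_def by (intro DERIV_cdivide) (simp add: divide_inverse)
      moreover have "(1 / y z * (cnj \<eta> * (p - q) / (1 - p * z)^2)) / (p - q) = 1 / ((1 - p * z) * (1 - q * z))"
        using n e0 pq by (simp add: y_def power2_eq_square divide_simps)
      ultimately show ?thesis by simp
    qed
    have inj: "inj_on \<Psi> (ball 0 1)"
    proof (rule inj_onI)
      fix a b assume ab: "a \<in> ball 0 1" "b \<in> ball 0 1" "\<Psi> a = \<Psi> b"
      have "Ln (y a) = Ln (y b)" using ab(3) pq by (simp add: \<Psi>_def)
      then have "y a = y b" using y_nz ab by (metis exp_Ln)
      moreover have "cnj \<eta> \<noteq> 0" using \<eta>1 by auto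
      ultimately have "(1 - q * a) * (1 - p * b) = (1 - q * b) * (1 - p * a)"
        using nz[OF p ab(1)] nz[OF p ab(2)] by (simp add: y_def frac_eq_eq)
      then have "(p - q) * (a - b) = 0" by (simp add: algebra_simps)
      then show "a = b" using pq by simp
    qed
    have img: "\<Psi> ` ball 0 1 = {w. - pi/2 < Im ((p - q) * w) \<and> Im ((p - q) * w) < pi/2}"
    proof (intro set_eqI iffI)
      fix w assume "w \<in> \<Psi> ` ball 0 1"
      then obtain z where z: "z \<in> ball 0 1" "w = \<Psi> z" by blast
      have eq: "(p - q) * w = Ln (y z)" using pq by (simp add: z(2) \<Psi>_def)
      have "\<bar>Im (Ln (y z))\<bar> < pi/2" using Re_Ln_pos_lt[OF y_nz[OF z(1)]] y_pos[OF z(1)] by simp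
      then show "w \<in> {w. - pi/2 < Im ((p - q) * w) \<and> Im ((p - q) * w) < pi/2}"
        unfolding mem_Collect_eq eq by linarith
    next
      fix w assume w: "w \<in> {w. - pi/2 < Im ((p - q) * w) \<and> Im ((p - q) * w) < pi/2}"
      define Z where "Z = (p - q) * w"
      have Z: "- (pi/2) < Im Z" "Im Z < pi/2" using w unfolding mem_Collect_eq Z_def[symmetric] by auto
      define Y where "Y = exp Z"
      have YRe: "Re Y > 0" using cos_gt_zero_pi[OF Z] by (simp add: Y_def Re_exp)
      define x where "x = \<eta> * Y"
      \<comment> \<open>Solution of (1 - q z) / (1 - p z) = x.\<close>
      define z where "z = (1 - x) / (q - p * x)"
      have n: "q - p * x \<noteq> 0"
      proof
        assume "q - p * x = 0"
        moreover have "p * (\<eta> * (Y + \<eta>)) = - (q - p * x)" by (simp add: q_eq x_def algebra_simps)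
        ultimately have "p * (\<eta> * (Y + \<eta>)) = 0" by simp
        then have "Y = - \<eta>" using p \<eta>1 by (auto simp: add_eq_0_iff2)
        then show False using YRe Re\<eta> by simp
      qed
      have 1: "1 - p * z = (q - p) / (q - p * x)" using n by (simp add: z_def field_simps)
      have 2: "1 - q * z = x * (q - p) / (q - p * x)" using n by (simp add: z_def field_simps)
      have n1: "1 - p * z \<noteq> 0" using 1 pq n by simp
      have "(1 - q * z) / (1 - p * z) = x" using 1 2 pq n by simp
      moreover have "y z = cnj \<eta> * ((1 - q * z) / (1 - p * z))" by (simp add: y_def)
      ultimately have "y z = (\<eta> * cnj \<eta>) * Y" by (simp add: x_def mult_ac)
      then have yz: "y z = Y" by (simp add: \<eta>c)
      have "Re \<eta> * (1 - (cmod z)\<^sup>2) > 0" using y_Re[OF n1] YRe n1 yz by (metis mult_pos_pos zero_less_norm_iff zero_less_power)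
      then have "(cmod z)\<^sup>2 < 1" using Re\<eta> by (simp add: zero_less_mult_iff)
      then have zin: "z \<in> ball 0 1" by (simp add: power_less_one_iff)
      have "- pi < Im Z" "Im Z \<le> pi" using Z pi_gt_zero by linarith+
      then have "Ln Y = Z" unfolding Y_def by (rule Ln_exp)
      then have "\<Psi> z = w" using pq by (simp add: \<Psi>_def yz Z_def)
      then show "w \<in> \<Psi> ` ball 0 1" using zin by blast
    qed
    have "convex ((\<lambda>w. (p - q) * w) -` ({w. - pi/2 < Im w} \<inter> {w. Im w < pi/2}))"
      by (intro convex_linear_vimage bounded_linear.linear[OF bounded_linear_mult_right] convex_Int
          convex_halfspace_Im_gt convex_halfspace_Im_lt)
    then have "convex {w. - pi/2 < Im ((p - q) * w) \<and> Im ((p - q) * w) < pi/2}"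
      by (simp only: vimage_def Int_def mem_Collect_eq)
    then show thesis using that deriv inj img by metis
  qed
qed

section \<open>Coefficients and divided differences of close-to-convex functions\<close>

lemma nth_linear_factor:
  "fps_nth ((1 - fps_const c * fps_X) * G) 0 = fps_nth G 0"
  "fps_nth ((1 - fps_const c * fps_X) * G) (Suc n) = fps_nth G (Suc n) - c * fps_nth G n" for c :: complex
  by (simp_all add: left_diff_distrib mult.assoc)

text \<open>Close-to-convexity of \<open>F\<close> with respect to the convex primitive of 1 / ((1 -
  p z) (1 - q z)): the quotient of the two derivatives, called \<open>P\<close> below, has its
  values in a half-plane.\<close>

locale directional =
  fixes F :: "complex \<Rightarrow> complex" and \<kappa> p q :: complex
  assumes holF: "F holomorphic_on ball 0 1" and dF0: "deriv F 0 = 1"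
    and \<kappa>: "cmod \<kappa> = 1" and p: "cmod p = 1" and q: "cmod q = 1"
    and pos: "\<And>z. z \<in> ball 0 1 \<Longrightarrow> Re (\<kappa> * ((1 - p * z) * (1 - q * z) * deriv F z)) > 0"
begin

definition P where "P z = (1 - p * z) * (1 - q * z) * deriv F z"
definition coeff where "coeff k = fps_nth (fps_expansion F 0) k"

lemma holP: "P holomorphic_on ball 0 1"
  unfolding P_def by (intro holomorphic_intros holomorphic_deriv holF) auto

lemma P0: "P 0 = 1" by (simp add: P_def dF0)

lemma P_pos: "z \<in> ball 0 1 \<Longrightarrow> Re (\<kappa> * P z) > 0"
  using pos by (simp add: P_def)

lemma fps_P: "fps_expansion P 0 = (1 - fps_const p * fps_X) * ((1 - fps_const q * fps_X) * fps_deriv (fps_expansion F 0))"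
proof -
  have F: "F has_fps_expansion fps_expansion F 0"
    by (rule has_fps_expansion_fps_expansion[OF open_ball _ holF]) simp
  have "(\<lambda>z. (1 - p * z) * ((1 - q * z) * deriv F z)) has_fps_expansion
      (1 - fps_const p * fps_X) * ((1 - fps_const q * fps_X) * fps_deriv (fps_expansion F 0))"
    by (intro fps_expansion_intros F)
  then show ?thesis by (intro fps_expansion_eqI) (simp add: P_def[abs_def] mult.assoc)
qed

lemma coeff_1: "coeff 1 = 1" by (simp add: coeff_def fps_expansion_def dF0)

text \<open>Dividing by 1 - p z sums coefficients with unimodular weights. From the bounds 1, 2, 2,
  ... for \<open>P\<close>, two such divisions lead to 1 + 2 j and then to (j + 1)^2 for the
  derivative of \<open>F\<close>.\<close>

lemma cmod_coeff_le:
  assumes "k \<ge> 1"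
  shows "cmod (coeff k) \<le> real k"
proof -
  obtain m where Suc: "k = Suc m" using assms by (cases k) auto
  define G where "G = fps_deriv (fps_expansion F 0)"
  define D where "D = (1 - fps_const q * fps_X) * G"
  have Pf: "fps_expansion P 0 = (1 - fps_const p * fps_X) * D" unfolding D_def G_def by (rule fps_P)
  have P_le: "cmod (fps_nth (fps_expansion P 0) (Suc j)) \<le> 2" for j
    by (rule half_plane_coeff_le_2[OF holP P0 \<kappa> P_pos]) auto
  have G0: "fps_nth G 0 = 1" using coeff_1 by (simp add: G_def coeff_def)
  have D0: "fps_nth D 0 = 1" unfolding D_def nth_linear_factor G0 ..
  have D_le: "cmod (fps_nth D j) \<le> 1 + 2 * real j" for j
  proof (induction j)
    case (Suc j)
    have "fps_nth D (Suc j) = fps_nth (fps_expansion P 0) (Suc j) + p * fps_nth D j"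
      unfolding Pf nth_linear_factor by simp
    then have "cmod (fps_nth D (Suc j)) \<le> cmod (fps_nth (fps_expansion P 0) (Suc j)) + cmod (fps_nth D j)"
      using norm_triangle_ineq[of "fps_nth (fps_expansion P 0) (Suc j)" "p * fps_nth D j"] p by (simp add: norm_mult)
    then show ?case using Suc P_le[of j] by simp
  qed (simp add: D0)
  have G_le: "cmod (fps_nth G j) \<le> (real j + 1)\<^sup>2" for j
  proof (induction j)
    case (Suc j)
    have "fps_nth G (Suc j) = fps_nth D (Suc j) + q * fps_nth G j"
      unfolding D_def nth_linear_factor by simp
    then have "cmod (fps_nth G (Suc j)) \<le> cmod (fps_nth D (Suc j)) + cmod (fps_nth G j)"
      using norm_triangle_ineq[of "fps_nth D (Suc j)" "q * fps_nth G j"] q by (simp add: norm_mult)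
    then show ?case using Suc D_le[of "Suc j"] by (simp add: power2_eq_square algebra_simps)
  qed (simp add: G0)
  have "fps_nth G m = of_nat (Suc m) * coeff (Suc m)" by (simp add: G_def coeff_def)
  then have "real (Suc m) * cmod (coeff (Suc m)) \<le> real (Suc m) * real (Suc m)"
    using G_le[of m] by (simp add: norm_mult power2_eq_square add.commute del: of_nat_Suc) (simp add: add.commute)
  then show ?thesis using Suc by (simp del: of_nat_Suc)
qed

text \<open>All quantities are expressed by \<mu>, b1, b2, p and q; the factor 12 clears
  denominators. After the triangle inequality, with x = |b1|, C = |1 + \<mu>| / 2 and s = |p + q| /
  2, the bound becomes 12 minus a square minus a product of nonnegative factors.\<close>

lemma cmod_coeff_3_le: "cmod (coeff 3 - (coeff 2)\<^sup>2) \<le> 1"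
proof -
  define G where "G = fps_deriv (fps_expansion F 0)"
  have Pf: "fps_expansion P 0 = (1 - fps_const p * fps_X) * ((1 - fps_const q * fps_X) * G)" unfolding G_def by (rule fps_P)
  have G0: "fps_nth G 0 = 1" using coeff_1 by (simp add: G_def coeff_def)
  have G1: "fps_nth G 1 = 2 * coeff 2" and G2: "fps_nth G 2 = 3 * coeff 3"
    by (simp_all add: G_def coeff_def numeral_2_eq_2 numeral_3_eq_3)
  obtain \<mu> b1 b2 where \<mu>: "cmod \<mu> = 1" and b: "cmod b1 \<le> 1" "cmod b2 \<le> 1 - (cmod b1)\<^sup>2"
    and P1: "fps_nth (fps_expansion P 0) 1 = (1 + \<mu>) * b1" and P2: "fps_nth (fps_expansion P 0) 2 = (1 + \<mu>) * (b2 + b1\<^sup>2)"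
    by (rule half_plane_second_coeff[OF holP P0 \<kappa> P_pos])
  have e1: "2 * coeff 2 = (1 + \<mu>) * b1 + (p + q)"
    using P1 unfolding Pf One_nat_def nth_linear_factor G0 using G1 by (simp add: algebra_simps)
  have e2: "3 * coeff 3 = (1 + \<mu>) * (b2 + b1\<^sup>2) + (p + q) * (2 * coeff 2) - p * q"
    using P2 unfolding Pf numeral_2_eq_2 One_nat_def nth_linear_factor G0 using G1 G2
    by (simp add: numeral_2_eq_2 algebra_simps)
  define m where "m = 1 + \<mu>"
  have id: "12 * (coeff 3 - (coeff 2)\<^sup>2) = 4 * m * b2 + m * b1\<^sup>2 * (4 - 3 * m) - 2 * m * b1 * (p + q) + (p - q)\<^sup>2"
  proof -
    have c2: "coeff 2 = (m * b1 + (p + q)) / 2" unfolding m_def e1[symmetric] by simp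
    have c3: "coeff 3 = (m * (b2 + b1\<^sup>2) + (p + q) * (m * b1 + (p + q)) - p * q) / 3"
      unfolding m_def e1[symmetric] e2[symmetric] by simp
    show ?thesis unfolding c2 c3 by (simp add: power2_eq_square field_simps)
  qed
  define x where "x = cmod b1"
  define C where "C = cmod m / 2"
  define s where "s = cmod (p + q) / 2"
  have x: "0 \<le> x" "x \<le> 1" using b by (auto simp: x_def)
  have C: "0 \<le> C" "C \<le> 1" using norm_triangle_ineq[of 1 \<mu>] \<mu> by (auto simp: C_def m_def)
  have s: "0 \<le> s" by (simp add: s_def)
  have cm: "cmod m = 2 * C" by (simp add: C_def)
  have pq: "(cmod (p - q))\<^sup>2 = 4 - 4 * s\<^sup>2"
  proof -
    have "(cmod (p + q))\<^sup>2 + (cmod (p - q))\<^sup>2 = 2 * (cmod p)\<^sup>2 + 2 * (cmod q)\<^sup>2"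
      unfolding cmod_power2 by (simp add: power2_eq_square algebra_simps)
    then show ?thesis using p q by (simp add: s_def power_divide)
  qed
  \<comment> \<open>Both |m|^2 and |4 - 3 m|^2 are affine in Re \<mu>, so the squared claim involves
    \<open>C\<close> alone, and the two sides differ by 16 (1 - C^2)^2.\<close>
  have w: "C * cmod (4 - 3 * m) \<le> 4 - 2 * C\<^sup>2"
  proof -
    have "(Re \<mu>)\<^sup>2 + (Im \<mu>)\<^sup>2 = 1" using \<mu> cmod_power2[of \<mu>] by simp
    then have r1: "(cmod m)\<^sup>2 = 2 + 2 * Re \<mu>" and r2: "(cmod (4 - 3 * m))\<^sup>2 = 10 - 6 * Re \<mu>"
      unfolding cmod_power2 m_def by (simp_all add: power2_eq_square algebra_simps)
    have r3: "(cmod (4 - 3 * m))\<^sup>2 = 16 - 12 * C\<^sup>2" using r1 r2 by (simp add: cm power_mult_distrib)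
    have C2: "C\<^sup>2 \<le> 1" using C by (simp add: power_le_one)
    have "(C * cmod (4 - 3 * m))\<^sup>2 = C\<^sup>2 * (16 - 12 * C\<^sup>2)" by (simp add: power_mult_distrib r3)
    also have "\<dots> = (4 - 2 * C\<^sup>2)\<^sup>2 - 16 * (1 - C\<^sup>2)\<^sup>2" by (simp add: power2_eq_square algebra_simps)
    also have "\<dots> \<le> (4 - 2 * C\<^sup>2)\<^sup>2" by simp
    finally show ?thesis by (rule power2_le_imp_le) (use C2 in simp)
  qed
  have "12 * cmod (coeff 3 - (coeff 2)\<^sup>2) = cmod (4 * m * b2 + m * b1\<^sup>2 * (4 - 3 * m) - 2 * m * b1 * (p + q) + (p - q)\<^sup>2)"
    using arg_cong[OF id, of cmod] by (simp only: norm_mult norm_numeral)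
  also have "\<dots> \<le> cmod (4 * m * b2) + cmod (m * b1\<^sup>2 * (4 - 3 * m)) + cmod (2 * m * b1 * (p + q)) + cmod ((p - q)\<^sup>2)"
    by (meson norm_triangle_ineq norm_triangle_ineq4 order_trans add_mono order_refl)
  also have "\<dots> = 8 * C * cmod b2 + 2 * (C * cmod (4 - 3 * m)) * x\<^sup>2 + 8 * C * x * s + (4 - 4 * s\<^sup>2)"
    by (simp add: norm_mult norm_power cm x_def[symmetric] pq) (simp add: s_def)
  also have "\<dots> \<le> 8 * C * (1 - x\<^sup>2) + 2 * (4 - 2 * C\<^sup>2) * x\<^sup>2 + 8 * C * x * s + (4 - 4 * s\<^sup>2)"
    using w b(2) C by (intro add_mono mult_left_mono mult_right_mono order_refl) (auto simp: x_def)
  also have "\<dots> = 12 - 4 * (s - C * x)\<^sup>2 - 8 * ((1 - C) * (1 - x\<^sup>2))"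
    by (simp add: power2_eq_square algebra_simps)
  also have "\<dots> \<le> 12"
  proof -
    have "x\<^sup>2 \<le> 1" using x by (simp add: power_le_one)
    then have "0 \<le> (1 - C) * (1 - x\<^sup>2)" using C by (intro mult_nonneg_nonneg) auto
    then show ?thesis using zero_le_power2[of "s - C * x"] by linarith
  qed
  finally show ?thesis by simp
qed

text \<open>Write z1, z2 as r a1, r a2 and let r vary over the disk as \<zeta>. The divided
  difference of \<open>F\<close> is then R / V, where \<open>R\<close> compares F with the convex
  primitive and has values in a half-plane, and \<open>V\<close> is the reciprocal divided
  difference of that primitive, bounded by 4. Both equal 1 at 0, so each is controlled at \<zeta> =
  r by a Schwarz-type estimate.\<close>

lemma divided_difference_lower_bound:
  assumes r: "0 < r" "r < 1" and z1: "cmod z1 \<le> r" and z2: "cmod z2 \<le> r"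
  shows "(1 - r) / (1 + r) * ((5 - r) / (5 * (5 * r + 1))) * cmod (z1 - z2) \<le> cmod (F z1 - F z2)"
proof (cases "z1 = z2")
  case False
  obtain \<Psi> where d\<Psi>: "\<And>z. z \<in> ball 0 1 \<Longrightarrow> (\<Psi> has_field_derivative 1 / ((1 - p * z) * (1 - q * z))) (at z)"
    and inj: "inj_on \<Psi> (ball 0 1)" and conv: "convex (\<Psi> ` ball 0 1)"
    using ex_convex_univalent_primitive[OF p q] by blast
  note nz = one_minus_mult_nonzero
  have hol\<Psi>: "\<Psi> holomorphic_on ball 0 1"
    unfolding holomorphic_on_def field_differentiable_def using d\<Psi> by (blast intro: has_field_derivative_at_within)
  have deriv\<Psi>: "deriv \<Psi> z = 1 / ((1 - p * z) * (1 - q * z))" if "z \<in> ball 0 1" for z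
    using d\<Psi>[OF that] by (rule DERIV_imp_deriv)
  define W where "W = \<Psi> ` ball 0 1"
  have openW: "open W" unfolding W_def by (rule open_mapping_thm3[OF hol\<Psi> open_ball inj])
  obtain \<Phi> where \<Phi>: "\<Phi> holomorphic_on W" "\<And>z. z \<in> ball 0 1 \<Longrightarrow> deriv \<Psi> z * deriv \<Phi> (\<Psi> z) = 1"
    "\<And>z. z \<in> ball 0 1 \<Longrightarrow> \<Phi> (\<Psi> z) = z"
    using holomorphic_has_inverse[OF hol\<Psi> open_ball inj] unfolding W_def by metis
  have \<Phi>_in: "\<Phi> w \<in> ball 0 1" if "w \<in> W" for w using that \<Phi>(3) unfolding W_def by auto
  have d\<Phi>: "(\<Phi> has_field_derivative (1 - p * \<Phi> w) * (1 - q * \<Phi> w)) (at w)" if "w \<in> W" for w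
  proof -
    obtain z where z: "z \<in> ball 0 1" "w = \<Psi> z" using \<open>w \<in> W\<close> unfolding W_def by blast
    have "deriv \<Phi> w = (1 - p * z) * (1 - q * z)"
      using \<Phi>(2)[OF z(1)] deriv\<Psi>[OF z(1)] nz[OF p z(1)] nz[OF q z(1)] by (simp add: z(2) field_simps)
    then show ?thesis using holomorphic_derivI[OF \<Phi>(1) openW \<open>w \<in> W\<close>] \<Phi>(3)[OF z(1)] z(2) by simp
  qed
  \<comment> \<open>The inverse of the primitive lives on a convex set, so the bound 4 for its
    derivative (1 - p z) (1 - q z) is a Lipschitz constant.\<close>
  have \<Phi>_lip: "cmod (\<Phi> w1 - \<Phi> w2) \<le> 4 * cmod (w1 - w2)" if "w1 \<in> W" "w2 \<in> W" for w1 w2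
  proof (rule field_differentiable_bound[OF conv[folded W_def] _ _ that(1,2)])
    fix w assume w: "w \<in> W"
    show "(\<Phi> has_field_derivative (1 - p * \<Phi> w) * (1 - q * \<Phi> w)) (at w within W)"
      using d\<Phi>[OF w] by (rule has_field_derivative_at_within)
    have "cmod (\<Phi> w) < 1" using \<Phi>_in[OF w] by simp
    then have "cmod (1 - p * \<Phi> w) \<le> 2" "cmod (1 - q * \<Phi> w) \<le> 2"
      using norm_triangle_ineq4[of 1 "p * \<Phi> w"] norm_triangle_ineq4[of 1 "q * \<Phi> w"] p q by (auto simp: norm_mult)
    then have "cmod (1 - p * \<Phi> w) * cmod (1 - q * \<Phi> w) \<le> 2 * 2" by (intro mult_mono) auto
    then show "cmod ((1 - p * \<Phi> w) * (1 - q * \<Phi> w)) \<le> 4" by (simp add: norm_mult)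
  qed
  \<comment> \<open>Along the segment between the images, which lies in the convex set
    \<open>W\<close>, the function F o \<Phi> has derivative P o \<Phi>. The mean value theorem for
    real parts gives Re (\<kappa> P) at one point of the disk.\<close>
  have F_pos: "Re (\<kappa> * ((F x1 - F x2) / (\<Psi> x1 - \<Psi> x2))) > 0" if x: "x1 \<in> ball 0 1" "x2 \<in> ball 0 1" "x1 \<noteq> x2" for x1 x2
  proof -
    define c where "c = \<kappa> / (\<Psi> x1 - \<Psi> x2)"
    have ne: "\<Psi> x1 - \<Psi> x2 \<noteq> 0" using inj x by (auto simp: inj_on_def)
    have W12: "\<Psi> x1 \<in> W" "\<Psi> x2 \<in> W" unfolding W_def using x by auto
    have seg: "closed_segment (\<Psi> x2) (\<Psi> x1) \<subseteq> W"
      by (rule closed_segment_subset[OF W12(2,1) conv[folded W_def]])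
    have "((\<lambda>w. c * F (\<Phi> w)) has_field_derivative c * P (\<Phi> w)) (at w)" if "w \<in> closed_segment (\<Psi> x2) (\<Psi> x1)" for w
    proof -
      have w: "w \<in> W" using seg that by blast
      have "(F has_field_derivative deriv F (\<Phi> w)) (at (\<Phi> w))" by (rule holomorphic_derivI[OF holF open_ball \<Phi>_in[OF w]])
      from DERIV_chain2[OF this d\<Phi>[OF w]]
      have "((\<lambda>w. F (\<Phi> w)) has_field_derivative P (\<Phi> w)) (at w)" by (simp add: P_def mult_ac)
      then show ?thesis by (rule DERIV_cmult)
    qed
    from complex_mvt_line[OF this] obtain w where w: "w \<in> closed_segment (\<Psi> x2) (\<Psi> x1)"
      "Re (c * F (\<Phi> (\<Psi> x1))) - Re (c * F (\<Phi> (\<Psi> x2))) = Re (c * P (\<Phi> w) * (\<Psi> x1 - \<Psi> x2))" by auto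
    have eqc: "c * P (\<Phi> w) * (\<Psi> x1 - \<Psi> x2) = \<kappa> * P (\<Phi> w)" using ne by (simp add: c_def)
    have "Re (\<kappa> * P (\<Phi> w)) > 0" using w(1) seg by (intro P_pos \<Phi>_in) blast
    then have "Re (c * F x1 - c * F x2) > 0"
      using w(2) by (simp only: \<Phi>(3)[OF x(1)] \<Phi>(3)[OF x(2)] eqc minus_complex.sel)
    moreover have "c * F x1 - c * F x2 = \<kappa> * ((F x1 - F x2) / (\<Psi> x1 - \<Psi> x2))" by (simp add: c_def diff_divide_distrib algebra_simps)
    ultimately show ?thesis by simp
  qed
  define a1 where "a1 = z1 / of_real r"
  define a2 where "a2 = z2 / of_real r"
  have a: "cmod a1 \<le> 1" "cmod a2 \<le> 1" using r z1 z2 by (simp_all add: a1_def a2_def norm_divide divide_le_eq)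
  have a12: "a1 \<noteq> a2" using False r by (simp add: a1_def a2_def)
  have in_ball: "\<zeta> * b \<in> ball 0 1" if "\<zeta> \<in> ball 0 1" "cmod b \<le> 1" for \<zeta> b :: complex
  proof -
    have "cmod \<zeta> * cmod b \<le> cmod \<zeta> * 1" using that by (intro mult_left_mono) auto
    then show ?thesis using that by (simp add: norm_mult)
  qed
  have holc: "(\<lambda>\<zeta>. f (\<zeta> * b)) holomorphic_on ball 0 1" if "f holomorphic_on ball 0 1" "cmod b \<le> 1" for f b
  proof -
    have "(f \<circ> (\<lambda>\<zeta>. \<zeta> * b)) holomorphic_on ball 0 1"
      by (rule holomorphic_on_compose_gen[OF _ that(1)]) (use in_ball that(2) in \<open>auto intro!: holomorphic_intros simp del: mem_ball\<close>)
    then show ?thesis by (simp only: o_def)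
  qed
  \<comment> \<open>\<open>Schwarz3\<close> removes the zero at \<zeta> = 0 from the difference, so
    that \<open>R\<close> and \<open>V\<close> are holomorphic at 0 as well.\<close>
  have quotient: "\<exists>g. g holomorphic_on ball 0 1 \<and> (\<forall>\<zeta>. cmod \<zeta> < 1 \<longrightarrow> f (\<zeta> * a1) - f (\<zeta> * a2) = \<zeta> * g \<zeta>) \<and> g 0 = deriv f 0 * (a1 - a2)"
    if f: "f holomorphic_on ball 0 1" for f
  proof -
    define N where "N \<zeta> = f (\<zeta> * a1) - f (\<zeta> * a2)" for \<zeta>
    have "N holomorphic_on ball 0 1" unfolding N_def by (intro holomorphic_intros holc f a)
    moreover have "N 0 = 0" by (simp add: N_def)
    ultimately obtain g where g: "g holomorphic_on ball 0 1" "\<And>\<zeta>. cmod \<zeta> < 1 \<Longrightarrow> N \<zeta> = \<zeta> * g \<zeta>" "deriv N 0 = g 0"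
      using Schwarz3[of N 1] by metis
    have "deriv N 0 = deriv f 0 * a1 - deriv f 0 * a2"
    proof (rule DERIV_imp_deriv)
      have "(f has_field_derivative deriv f 0) (at (0 * b))" for b using holomorphic_derivI[OF f open_ball, of 0] by simp
      then have d: "((\<lambda>\<zeta>. f (\<zeta> * b)) has_field_derivative deriv f 0 * b) (at 0)" for b
        by (rule DERIV_chain2[where g="\<lambda>\<zeta>. \<zeta> * b"]) (auto intro!: derivative_eq_intros)
      show "(N has_field_derivative deriv f 0 * a1 - deriv f 0 * a2) (at 0)"
        unfolding N_def by (intro DERIV_diff d)
    qed
    then show ?thesis using g by (intro exI[of _ g]) (auto simp: N_def right_diff_distrib)
  qed
  obtain nF where nF: "nF holomorphic_on ball 0 1" "\<And>\<zeta>. cmod \<zeta> < 1 \<Longrightarrow> F (\<zeta> * a1) - F (\<zeta> * a2) = \<zeta> * nF \<zeta>" "nF 0 = a1 - a2"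
    using quotient[OF holF] dF0 by auto
  obtain nP where nP: "nP holomorphic_on ball 0 1" "\<And>\<zeta>. cmod \<zeta> < 1 \<Longrightarrow> \<Psi> (\<zeta> * a1) - \<Psi> (\<zeta> * a2) = \<zeta> * nP \<zeta>" "nP 0 = a1 - a2"
    using quotient[OF hol\<Psi>] deriv\<Psi>[of 0] by auto
  have ne: "\<zeta> * a1 \<noteq> \<zeta> * a2" if "\<zeta> \<noteq> 0" for \<zeta> using a12 that by simp
  have nP_nz: "nP \<zeta> \<noteq> 0" if \<zeta>: "\<zeta> \<in> ball 0 1" for \<zeta>
  proof (cases "\<zeta> = 0")
    case False
    have "\<Psi> (\<zeta> * a1) \<noteq> \<Psi> (\<zeta> * a2)"
      using inj_onD[OF inj _ in_ball[OF \<zeta> a(1)] in_ball[OF \<zeta> a(2)]] ne[OF False] by blast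
    then show ?thesis using nP(2)[of \<zeta>] \<zeta> by auto
  qed (use nP(3) a12 in simp)
  define R where "R \<zeta> = nF \<zeta> / nP \<zeta>" for \<zeta>
  define V where "V \<zeta> = (a1 - a2) / nP \<zeta>" for \<zeta>
  have holR: "R holomorphic_on ball 0 1" unfolding R_def by (intro holomorphic_intros nF nP nP_nz)
  have R0: "R 0 = 1" using a12 by (simp add: R_def nF nP)
  have R_pos: "Re (\<kappa> * R \<zeta>) > 0" if \<zeta>: "\<zeta> \<in> ball 0 1" for \<zeta>
  proof (cases "\<zeta> = 0")
    case True
    then show ?thesis using P_pos[of 0] P0 R0 by simp
  next
    case False
    have "R \<zeta> = (\<zeta> * nF \<zeta>) / (\<zeta> * nP \<zeta>)" using False by (simp add: R_def)
    also have "\<dots> = (F (\<zeta> * a1) - F (\<zeta> * a2)) / (\<Psi> (\<zeta> * a1) - \<Psi> (\<zeta> * a2))" using nF(2)[of \<zeta>] nP(2)[of \<zeta>] \<zeta> by simp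
    finally show ?thesis using F_pos[OF in_ball[OF \<zeta> a(1)] in_ball[OF \<zeta> a(2)] ne[OF False]] by simp
  qed
  have V4: "cmod (V \<zeta>) \<le> 4" if \<zeta>: "\<zeta> \<in> ball 0 1" for \<zeta>
  proof (cases "\<zeta> = 0")
    case True
    then show ?thesis using a12 by (simp add: V_def nP)
  next
    case False
    have "cmod (\<Phi> (\<Psi> (\<zeta> * a1)) - \<Phi> (\<Psi> (\<zeta> * a2))) \<le> 4 * cmod (\<Psi> (\<zeta> * a1) - \<Psi> (\<zeta> * a2))"
      by (rule \<Phi>_lip) (use in_ball[OF \<zeta>] a in \<open>auto simp: W_def simp del: mem_ball\<close>)
    then have "cmod (\<zeta> * a1 - \<zeta> * a2) \<le> 4 * cmod (\<zeta> * nP \<zeta>)"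
      using \<Phi>(3) in_ball[OF \<zeta>] a nP(2)[of \<zeta>] \<zeta> by simp
    then have "cmod \<zeta> * cmod (a1 - a2) \<le> cmod \<zeta> * (4 * cmod (nP \<zeta>))"
      by (simp add: norm_mult right_diff_distrib[symmetric] mult_ac)
    then have "cmod (a1 - a2) \<le> 4 * cmod (nP \<zeta>)" using False by simp
    then show ?thesis using nP_nz[OF \<zeta>] by (simp add: V_def norm_divide pos_divide_le_eq)
  qed
  have rb: "of_real r \<in> ball (0::complex) 1" using r by simp
  have R_low: "(1 - r) / (1 + r) \<le> cmod (R (of_real r))"
    using half_plane_bounds(2)[OF holR R0 \<kappa> R_pos rb] r by simp
  have V_up: "cmod (V (of_real r)) \<le> 5 * (5 * r + 1) / (5 - r)"
  proof -
    (* |V| < 5 is strict on all of the disk, so no maximum principle is needed before applying Schwarz to V/5 *)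
    define m where "m \<zeta> = (5 * V \<zeta> - 5) / (25 - V \<zeta>)" for \<zeta>
    have holV: "V holomorphic_on ball 0 1" unfolding V_def by (intro holomorphic_intros nP nP_nz)
    have den: "25 - V \<zeta> \<noteq> 0" if "\<zeta> \<in> ball 0 1" for \<zeta>
      using V4[OF that] by (auto simp: eq_iff_diff_eq_0[symmetric])
    have holm: "m holomorphic_on ball 0 1" unfolding m_def by (intro holomorphic_intros holV den)
    have m0: "m 0 = 0" using a12 by (simp add: m_def V_def nP)
    have mlt: "cmod (m \<zeta>) < 1" if "cmod \<zeta> < 1" for \<zeta>
    proof -
      have \<zeta>: "\<zeta> \<in> ball 0 1" using that by simp
      have "(cmod (25 - V \<zeta>))\<^sup>2 - (cmod (5 * V \<zeta> - 5))\<^sup>2 = 24 * (25 - (cmod (V \<zeta>))\<^sup>2)"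
        unfolding cmod_power2 by (simp add: power2_eq_square algebra_simps)
      moreover have "(cmod (V \<zeta>))\<^sup>2 \<le> 4\<^sup>2" using V4[OF \<zeta>] by (intro power_mono) auto
      ultimately have "(cmod (5 * V \<zeta> - 5))\<^sup>2 < (cmod (25 - V \<zeta>))\<^sup>2" by simp
      then have "cmod (5 * V \<zeta> - 5) < cmod (25 - V \<zeta>)" by (rule power2_less_imp_less) simp
      then show ?thesis using den[OF \<zeta>] by (simp add: m_def norm_divide)
    qed
    have mr: "cmod (m (of_real r)) \<le> r" using Schwarz_Lemma(1)[OF holm m0 mlt, of "of_real r"] r by simp
    define v where "v = V (of_real r)"
    \<comment> \<open>\<open>m\<close> is the Moebius transform of V / 5 that sends its value 1/5 at
      0 to 0. Solving for \<open>v\<close> gives 5 (1 + 5 m) / (5 + m), and |m| <= r yields the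
      stated bound.\<close>
    have "m (of_real r) * (25 - v) = 5 * v - 5" using den[OF rb] by (simp add: m_def v_def)
    then have "5 * v = 5 + m (of_real r) * (25 - v)" by simp
    then have "cmod (5 * v) \<le> cmod 5 + cmod (m (of_real r) * (25 - v))" by (metis norm_triangle_ineq)
    then have 1: "5 * cmod v \<le> 5 + cmod (m (of_real r)) * cmod (25 - v)" by (simp add: norm_mult)
    have "cmod (m (of_real r)) * cmod (25 - v) \<le> r * (25 + cmod v)"
      using mr norm_triangle_ineq4[of 25 v] r by (intro mult_mono) auto
    then have "cmod v * (5 - r) \<le> 5 * (5 * r + 1)" using 1 by (simp add: algebra_simps)
    then show ?thesis using r by (simp add: v_def pos_le_divide_eq)
  qed
  have ra: "of_real r * a1 = z1" "of_real r * a2 = z2" using r by (simp_all add: a1_def a2_def)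
  have "F z1 - F z2 = of_real r * nF (of_real r)" using nF(2)[of "of_real r"] r ra by simp
  moreover have "z1 - z2 = of_real r * (a1 - a2)" by (simp add: right_diff_distrib ra)
  moreover have "nF (of_real r) * V (of_real r) = R (of_real r) * (a1 - a2)" by (simp add: R_def V_def)
  ultimately have eq: "(F z1 - F z2) * V (of_real r) = R (of_real r) * (z1 - z2)" by (metis mult.assoc mult.commute)
  define T where "T = 5 * (5 * r + 1) / (5 - r)"
  have T: "T > 0" using r by (simp add: T_def)
  have "(1 - r) / (1 + r) * cmod (z1 - z2) \<le> cmod (R (of_real r)) * cmod (z1 - z2)"
    using R_low by (rule mult_right_mono) simp
  also have "\<dots> = cmod (F z1 - F z2) * cmod (V (of_real r))" using arg_cong[OF eq, of cmod] by (simp only: norm_mult)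
  also have "\<dots> \<le> cmod (F z1 - F z2) * T" using V_up unfolding T_def by (rule mult_left_mono) simp
  finally have "(1 - r) / (1 + r) * cmod (z1 - z2) \<le> cmod (F z1 - F z2) * T" .
  then have "(1 - r) / (1 + r) * cmod (z1 - z2) / T \<le> cmod (F z1 - F z2)"
    by (rule iffD2[OF pos_divide_le_eq[OF T]])
  then show ?thesis by (simp add: T_def mult_ac)
qed simp

end

section \<open>Injectivity of sections\<close>

text \<open>With these \<open>A\<close>, \<open>B\<close>, \<open>C\<close> the summand is a difference of consecutive values of the right-hand side.\<close>

lemma tail_sums:
  fixes r A B C :: real
  assumes lim: "(\<lambda>m. r ^ m * (A * (real m + 1)\<^sup>2 + B * (real m + 1) + C)) \<longlonglongrightarrow> 0"
    and eq: "A = r * A + 1" "B = r * (2 * A + B)" "C = r * (A + B + C)"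
  shows "(\<lambda>k. (real (k + n) + 1)\<^sup>2 * r ^ (k + n)) sums (r ^ n * (A * (real n + 1)\<^sup>2 + B * (real n + 1) + C))"
proof -
  define G where "G m = r ^ m * (A * (real m + 1)\<^sup>2 + B * (real m + 1) + C)" for m
  have "(\<lambda>k. G (k + n)) \<longlonglongrightarrow> 0" using lim unfolding G_def[symmetric] by (rule LIMSEQ_ignore_initial_segment)
  from telescope_sums'[OF this] have s: "(\<lambda>k. G (k + n) - G (Suc k + n)) sums G n" by simp
  have d: "G m - G (Suc m) = (real m + 1)\<^sup>2 * r ^ m" for m
  proof -
    define M where "M = real m + 1"
    have "G m - G (Suc m) = r ^ m * (A * M\<^sup>2 + B * M + C - (r * A * M\<^sup>2 + r * (2 * A + B) * M + r * (A + B + C)))"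
      by (simp add: G_def M_def power2_eq_square algebra_simps)
    also have "A * M\<^sup>2 + B * M + C - (r * A * M\<^sup>2 + r * (2 * A + B) * M + r * (A + B + C)) = (A - r * A) * M\<^sup>2"
      unfolding eq(2)[symmetric] eq(3)[symmetric] by (simp add: left_diff_distrib)
    also have "A - r * A = 1" using eq(1) by simp
    finally show ?thesis by (simp add: M_def mult.commute)
  qed
  show ?thesis using s unfolding add_Suc d by (simp only: G_def)
qed

text \<open>This settles n = 3, where the competing terms sum to at most (1 - |s|^2) / 4 + 3/16 =
  7/16 - |s|^2 / 4. For fixed |s| the squared modulus on the right is quadratic in Re s; its minimum
  exceeds the square of the left side by a polynomial in 1 - |s|^2 with positive
  coefficients.\<close>

lemma quadratic_lower_bound:
  fixes s :: complex
  assumes "cmod s \<le> 1"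
  shows "7/16 - (cmod s)\<^sup>2 / 4 < cmod (1 + s + 3/4 * s\<^sup>2)"
proof -
  define X where "X = Re s"
  define y where "y = (cmod s)\<^sup>2"
  have y: "0 \<le> y" "y \<le> 1" using assms by (auto simp: y_def power_le_one)
  have Im: "(Im s)\<^sup>2 = y - X\<^sup>2" by (simp add: y_def X_def cmod_power2)
  have "(cmod (1 + s + 3/4 * s\<^sup>2))\<^sup>2 = (1 + X + 3/4 * (X\<^sup>2 - (Im s)\<^sup>2))\<^sup>2 + (Im s)\<^sup>2 * (1 + 3/2 * X)\<^sup>2"
    unfolding cmod_power2 by (simp add: X_def power2_eq_square field_simps)
  also have "\<dots> = 3 * X\<^sup>2 + (2 + 3/2 * y) * X + 1 - y/2 + 9/16 * y\<^sup>2"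
    unfolding Im by (simp add: power2_eq_square field_simps)
  also have "\<dots> = 3 * (X + (2 + 3/2 * y) / 6)\<^sup>2 + (2/3 - y + 3/8 * y\<^sup>2)"
    by (simp add: power2_eq_square field_simps)
  also have "\<dots> \<ge> 2/3 - y + 3/8 * y\<^sup>2" by simp
  finally have 1: "2/3 - y + 3/8 * y\<^sup>2 \<le> (cmod (1 + s + 3/4 * s\<^sup>2))\<^sup>2" .
  have "2/3 - y + 3/8 * y\<^sup>2 - (7/16 - y/4)\<^sup>2 = 5/16 * (1 - y)\<^sup>2 + 5/32 * (1 - y) + 5/768"
    by (simp add: power2_eq_square field_simps)
  moreover have "5/16 * (1 - y)\<^sup>2 + 5/32 * (1 - y) + 5/768 > 0" using y by (intro add_nonneg_pos add_nonneg_nonneg) auto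
  ultimately have "(7/16 - y/4)\<^sup>2 < (cmod (1 + s + 3/4 * s\<^sup>2))\<^sup>2" using 1 by linarith
  then have "7/16 - y/4 < cmod (1 + s + 3/4 * s\<^sup>2)" by (rule power2_less_imp_less) simp
  then show ?thesis by (simp add: y_def)
qed

section \<open>Comparison of tails with divided differences\<close>

context directional begin

lemma section_of_F: "section_of n F z = (\<Sum>k=1..n. coeff k * z ^ k)"
  by (simp add: section_of_def coeff_def)

lemma F_sums: "z \<in> ball 0 1 \<Longrightarrow> (\<lambda>k. coeff k * z ^ k) sums F z"
  using holomorphic_power_series[OF holF] by (simp add: coeff_def fps_expansion_def)

text \<open>If a section takes equal values, the difference of \<open>F\<close> at the two points is
  that of the tails. With |a_k| <= k and |z1^k - z2^k| <= k r^(k-1) |z1 - z2| this contradicts the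
  lower bound. The tail sum decreases in \<open>n\<close>, so one numerical check at the threshold
  \<open>m\<close> suffices.\<close>

lemma section_neq:
  assumes r: "0 < r" "r < 1"
    and lim: "(\<lambda>m. r ^ m * (A * (real m + 1)\<^sup>2 + B * (real m + 1) + C)) \<longlonglongrightarrow> 0"
    and eq: "A = r * A + 1" "B = r * (2 * A + B)" "C = r * (A + B + C)"
    and small: "r ^ m * (A * (real m + 1)\<^sup>2 + B * (real m + 1) + C) < (1 - r) / (1 + r) * ((5 - r) / (5 * (5 * r + 1)))"
    and "m \<le> n" and z: "cmod z1 \<le> r" "cmod z2 \<le> r" "z1 \<noteq> z2"
  shows "section_of n F z1 \<noteq> section_of n F z2"
proof
  assume eq0: "section_of n F z1 = section_of n F z2"
  define L where "L = (1 - r) / (1 + r) * ((5 - r) / (5 * (5 * r + 1)))"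
  have zb: "z1 \<in> ball 0 1" "z2 \<in> ball 0 1" using z r by auto
  define c where "c k = coeff k * z1 ^ k - coeff k * z2 ^ k" for k
  have c_sums: "c sums (F z1 - F z2)" unfolding c_def by (intro sums_diff F_sums zb)
  have "(\<Sum>k<Suc n. c k) = 0"
  proof -
    have "(\<Sum>k<Suc n. c k) = c 0 + (\<Sum>k=1..n. c k)"
      by (simp add: lessThan_Suc_atMost atMost_atLeast0 sum.atLeast_Suc_atMost)
    also have "(\<Sum>k=1..n. c k) = section_of n F z1 - section_of n F z2" by (simp add: c_def section_of_F sum_subtractf)
    finally show ?thesis using eq0 by (simp add: c_def)
  qed
  then have tail: "(\<lambda>k. c (k + Suc n)) sums (F z1 - F z2)"
    using c_sums by (subst sums_iff_shift) simp
  \<comment> \<open>Index \<open>k\<close> stands for the term of degree k + n + 1, the first one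
    beyond the section being k = 0.\<close>
  define b where "b k = (real (k + n) + 1)\<^sup>2 * r ^ (k + n)" for k
  define T where "T k = r ^ k * (A * (real k + 1)\<^sup>2 + B * (real k + 1) + C)" for k
  have b_sums: "b sums T n" unfolding b_def T_def by (rule tail_sums[OF lim eq])
  have "T n \<le> T m"
  proof -
    have bm: "(\<lambda>k. (real (k + m) + 1)\<^sup>2 * r ^ (k + m)) sums T m" unfolding T_def by (rule tail_sums[OF lim eq])
    have idx: "k + (n - m) + m = k + n" for k using \<open>m \<le> n\<close> by simp
    have "(\<lambda>k. (real (k + (n - m) + m) + 1)\<^sup>2 * r ^ (k + (n - m) + m)) sums (T m - (\<Sum>k<n - m. (real (k + m) + 1)\<^sup>2 * r ^ (k + m)))"
      using sums_split_initial_segment[OF bm, of "n - m"] .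
    then have "b sums (T m - (\<Sum>k<n - m. (real (k + m) + 1)\<^sup>2 * r ^ (k + m)))"
      by (simp only: idx b_def[abs_def])
    then have "T n = T m - (\<Sum>k<n - m. (real (k + m) + 1)\<^sup>2 * r ^ (k + m))" using b_sums sums_unique2 by blast
    moreover have "(\<Sum>k<n - m. (real (k + m) + 1)\<^sup>2 * r ^ (k + m)) \<ge> 0" using r by (intro sum_nonneg) auto
    ultimately show ?thesis by linarith
  qed
  have "cmod (c (k + Suc n)) \<le> b k * cmod (z1 - z2)" for k
  proof -
    define j where "j = k + n"
    have "cmod (z1 ^ Suc j - z2 ^ Suc j) \<le> real (Suc j) * r ^ j * cmod (z1 - z2)"
    proof -
      have "z1 ^ Suc j - z2 ^ Suc j = (z1 - z2) * (\<Sum>p<Suc j. z1 ^ p * z2 ^ (j - p))" by (rule diff_power_eq_sum)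
      moreover have "cmod (\<Sum>p<Suc j. z1 ^ p * z2 ^ (j - p)) \<le> (\<Sum>p<Suc j. r ^ j)"
      proof (rule sum_norm_le)
        fix p assume p: "p \<in> {..<Suc j}"
        have "cmod (z1 ^ p * z2 ^ (j - p)) \<le> r ^ p * r ^ (j - p)"
          unfolding norm_mult norm_power using z r by (intro mult_mono power_mono) auto
        also have "\<dots> = r ^ j" using p by (simp add: power_add[symmetric])
        finally show "cmod (z1 ^ p * z2 ^ (j - p)) \<le> r ^ j" .
      qed
      ultimately have "cmod (z1 ^ Suc j - z2 ^ Suc j) \<le> cmod (z1 - z2) * (\<Sum>p<Suc j. r ^ j)"
        by (simp only: norm_mult) (intro mult_left_mono, auto)
      then show ?thesis by (simp add: mult_ac)
    qed
    moreover have "cmod (coeff (Suc j)) \<le> real (Suc j)" by (rule cmod_coeff_le) simp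
    ultimately have "cmod (coeff (Suc j)) * cmod (z1 ^ Suc j - z2 ^ Suc j) \<le> real (Suc j) * (real (Suc j) * r ^ j * cmod (z1 - z2))"
      by (intro mult_mono) auto
    moreover have "c (k + Suc n) = coeff (Suc j) * (z1 ^ Suc j - z2 ^ Suc j)" by (simp add: c_def j_def algebra_simps)
    ultimately show ?thesis by (simp add: norm_mult b_def j_def power2_eq_square mult_ac add_ac)
  qed
  moreover have b2: "(\<lambda>k. b k * cmod (z1 - z2)) sums (T n * cmod (z1 - z2))" by (rule sums_mult2[OF b_sums])
  ultimately have "norm (suminf (\<lambda>k. c (k + Suc n))) \<le> suminf (\<lambda>k. b k * cmod (z1 - z2))"
    by (intro norm_suminf_le sums_summable[OF b2])
  then have "cmod (F z1 - F z2) \<le> T n * cmod (z1 - z2)"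
    unfolding sums_unique[OF tail, symmetric] sums_unique[OF b2, symmetric] .
  moreover have "L * cmod (z1 - z2) \<le> cmod (F z1 - F z2)"
    unfolding L_def by (rule divided_difference_lower_bound[OF r z(1,2)])
  moreover have "T n < L" using \<open>T n \<le> T m\<close> small unfolding T_def L_def by linarith
  then have "T n * cmod (z1 - z2) < L * cmod (z1 - z2)" using z(3) by (intro mult_strict_right_mono) auto
  ultimately show False by linarith
qed

text \<open>The divided difference is 1 + a2 (z1 + z2), and the last term has modulus below 2 *
  (1/2).\<close>

lemma section_2_neq:
  assumes z: "cmod z1 < 1/4" "cmod z2 < 1/4" "z1 \<noteq> z2"
  shows "section_of 2 F z1 \<noteq> section_of 2 F z2"
proof
  assume "section_of 2 F z1 = section_of 2 F z2"
  moreover have "section_of 2 F z1 - section_of 2 F z2 = (z1 - z2) * (1 + coeff 2 * (z1 + z2))"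
    by (simp add: section_of_F numeral_2_eq_2 coeff_1[simplified] power2_eq_square algebra_simps)
  ultimately have "1 + coeff 2 * (z1 + z2) = 0" using z(3) by simp
  then have "cmod (coeff 2 * (z1 + z2)) = 1" by (metis add_eq_0_iff norm_minus_cancel norm_one)
  moreover have "cmod (coeff 2) * cmod (z1 + z2) \<le> 2 * cmod (z1 + z2)"
    using cmod_coeff_le[of 2] by (intro mult_right_mono) auto
  moreover have "cmod (z1 + z2) < 1/2" using norm_triangle_ineq[of z1 z2] z by linarith
  ultimately show False by (simp add: norm_mult)
qed

text \<open>Bounding moduli term by term leaves nothing, as |a2 (z1 + z2)| may come close to 1.
  Splitting a3 into a2^2 + c, and z1^2 + z1 z2 + z2^2 into 3/4 (z1 + z2)^2 + 1/4 (z1 - z2)^2, shows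
  that \<open>s\<close> and \<open>d\<close> compete: the parallelogram law gives |s|^2 + |d|^2 <=
  1.\<close>

lemma section_3_neq:
  assumes z: "cmod z1 < 1/4" "cmod z2 < 1/4" "z1 \<noteq> z2"
  shows "section_of 3 F z1 \<noteq> section_of 3 F z2"
proof
  assume "section_of 3 F z1 = section_of 3 F z2"
  define a where "a = coeff 2"
  define c where "c = coeff 3 - a\<^sup>2"
  define s where "s = a * (z1 + z2)"
  define d where "d = a * (z1 - z2)"
  define t where "t = z1\<^sup>2 + z1 * z2 + z2\<^sup>2"
  have "section_of 3 F z1 - section_of 3 F z2 = (z1 - z2) * (1 + a * (z1 + z2) + coeff 3 * t)"
    by (simp add: section_of_F a_def t_def numeral_3_eq_3 coeff_1[simplified] power2_eq_square power3_eq_cube algebra_simps numeral_2_eq_2)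
  then have "1 + a * (z1 + z2) + coeff 3 * t = 0" using z(3) \<open>section_of 3 F z1 = section_of 3 F z2\<close> by simp
  moreover have "coeff 3 * t = 3/4 * s\<^sup>2 + d\<^sup>2 / 4 + c * t"
    by (simp add: c_def s_def d_def t_def power2_eq_square field_simps)
  ultimately have "1 + s + 3/4 * s\<^sup>2 = - (d\<^sup>2 / 4 + c * t)" by (simp add: s_def algebra_simps eq_neg_iff_add_eq_0)
  then have "cmod (1 + s + 3/4 * s\<^sup>2) = cmod (d\<^sup>2 / 4 + c * t)" by (simp only: norm_minus_cancel)
  also have "\<dots> \<le> (cmod d)\<^sup>2 / 4 + cmod c * cmod t"
    using norm_triangle_ineq[of "d\<^sup>2 / 4" "c * t"] by (simp add: norm_mult norm_power norm_divide)
  finally have le: "cmod (1 + s + 3/4 * s\<^sup>2) \<le> (cmod d)\<^sup>2 / 4 + cmod c * cmod t" .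
  have sq: "(cmod z1)\<^sup>2 \<le> 1/16" "(cmod z2)\<^sup>2 \<le> 1/16" "cmod z1 * cmod z2 \<le> 1/16"
    using power_mono[of "cmod z1" "1/4" 2] power_mono[of "cmod z2" "1/4" 2] mult_mono[of "cmod z1" "1/4" "cmod z2" "1/4"] z
    by (auto simp: power2_eq_square)
  have "cmod t \<le> cmod (z1\<^sup>2) + cmod (z1 * z2) + cmod (z2\<^sup>2)" unfolding t_def
    by (rule order_trans[OF norm_triangle_ineq add_right_mono[OF norm_triangle_ineq]])
  also have "\<dots> \<le> 3/16" using sq by (simp add: norm_mult norm_power)
  finally have t: "cmod t \<le> 3/16" .
  have "cmod c * cmod t \<le> 1 * (3/16)" using cmod_coeff_3_le t by (intro mult_mono) (auto simp: c_def a_def)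
  moreover have sd: "(cmod s)\<^sup>2 + (cmod d)\<^sup>2 \<le> 1"
  proof -
    have "(cmod (z1 + z2))\<^sup>2 + (cmod (z1 - z2))\<^sup>2 = 2 * (cmod z1)\<^sup>2 + 2 * (cmod z2)\<^sup>2"
      unfolding cmod_power2 by (simp add: power2_eq_square algebra_simps)
    then have "(cmod (z1 + z2))\<^sup>2 + (cmod (z1 - z2))\<^sup>2 \<le> 1/4" using sq by linarith
    moreover have "(cmod a)\<^sup>2 \<le> 2\<^sup>2" using cmod_coeff_le[of 2] by (intro power_mono) (auto simp: a_def)
    moreover have "(cmod s)\<^sup>2 + (cmod d)\<^sup>2 = (cmod a)\<^sup>2 * ((cmod (z1 + z2))\<^sup>2 + (cmod (z1 - z2))\<^sup>2)"
      by (simp only: s_def d_def norm_mult power_mult_distrib distrib_left[symmetric])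
    ultimately have "(cmod s)\<^sup>2 + (cmod d)\<^sup>2 \<le> 2\<^sup>2 * (1/4)" by (simp only:) (intro mult_mono, auto)
    then show ?thesis by simp
  qed
  moreover have "cmod s \<le> 1"
  proof -
    have "(cmod s)\<^sup>2 \<le> 1\<^sup>2" using sd zero_le_power2[of "cmod d"] unfolding power_one by linarith
    then show ?thesis by (rule power2_le_imp_le) simp
  qed
  ultimately show False using quadratic_lower_bound[of s] le by linarith
qed

lemma section_inj:
  "n \<ge> 2 \<Longrightarrow> inj_on (section_of n F) (ball 0 (1/4))"
  "n \<ge> 17 \<Longrightarrow> inj_on (section_of n F) (ball 0 (1/2))"
  "n \<ge> 46 \<Longrightarrow> inj_on (section_of n F) (ball 0 (3/4))"
proof -
  \<comment> \<open>The triples solve the recursions of \<open>tail_sums\<close>: A = 1 / (1 - r), B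
    = 2 r A / (1 - r), C = r (A + B) / (1 - r).\<close>
  have lims: "(\<lambda>m. (1/4::real) ^ m * (4/3 * (real m + 1)\<^sup>2 + 8/9 * (real m + 1) + 20/27)) \<longlonglongrightarrow> 0"
    "(\<lambda>m. (1/2::real) ^ m * (2 * (real m + 1)\<^sup>2 + 4 * (real m + 1) + 6)) \<longlonglongrightarrow> 0"
    "(\<lambda>m. (3/4::real) ^ m * (4 * (real m + 1)\<^sup>2 + 24 * (real m + 1) + 84)) \<longlonglongrightarrow> 0"
    by real_asymp+
  \<comment> \<open>For r = 1/4 the tail is about 0.15 at 4 against a lower bound of about 0.25, but
    about 0.40 at 3; this is why n = 2 and n = 3 are treated apart. For r = 3/4 the comparison at 46
    is about 0.018 against 0.0256.\<close>
  have small: "(1/4::real) ^ 4 * (4/3 * (real 4 + 1)\<^sup>2 + 8/9 * (real 4 + 1) + 20/27) < (1 - 1/4) / (1 + 1/4) * ((5 - 1/4) / (5 * (5 * (1/4) + 1)))"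
    "(1/2::real) ^ 17 * (2 * (real 17 + 1)\<^sup>2 + 4 * (real 17 + 1) + 6) < (1 - 1/2) / (1 + 1/2) * ((5 - 1/2) / (5 * (5 * (1/2) + 1)))"
    "(3/4::real) ^ 46 * (4 * (real 46 + 1)\<^sup>2 + 24 * (real 46 + 1) + 84) < (1 - 3/4) / (1 + 3/4) * ((5 - 3/4) / (5 * (5 * (3/4) + 1)))"
    by (simp_all add: power_divide)
  show "inj_on (section_of n F) (ball 0 (1/4))" if n: "n \<ge> 2"
  proof (rule inj_onI, rule ccontr)
    fix z1 z2 assume z: "z1 \<in> ball 0 (1/4)" "z2 \<in> ball 0 (1/4)" "section_of n F z1 = section_of n F z2" "z1 \<noteq> z2"
    consider "n = 2" | "n = 3" | "4 \<le> n" using n by linarith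
    then show False
    proof cases
      case 1
      then show ?thesis using section_2_neq[of z1 z2] z by simp
    next
      case 2
      then show ?thesis using section_3_neq[of z1 z2] z by simp
    next
      case 3
      have "section_of n F z1 \<noteq> section_of n F z2"
        by (rule section_neq[OF _ _ lims(1) _ _ _ small(1) 3]) (use z(1,2,4) in simp_all)
      then show ?thesis using z by blast
    qed
  qed
  show "inj_on (section_of n F) (ball 0 (1/2))" if "n \<ge> 17"
  proof (rule inj_onI, rule ccontr)
    fix z1 z2 assume z: "z1 \<in> ball 0 (1/2)" "z2 \<in> ball 0 (1/2)" "section_of n F z1 = section_of n F z2" "z1 \<noteq> z2"
    have "section_of n F z1 \<noteq> section_of n F z2"
      by (rule section_neq[OF _ _ lims(2) _ _ _ small(2) that]) (use z(1,2,4) in simp_all)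
    then show False using z by blast
  qed
  show "inj_on (section_of n F) (ball 0 (3/4))" if "n \<ge> 46"
  proof (rule inj_onI, rule ccontr)
    fix z1 z2 assume z: "z1 \<in> ball 0 (3/4)" "z2 \<in> ball 0 (3/4)" "section_of n F z1 = section_of n F z2" "z1 \<noteq> z2"
    have "section_of n F z1 \<noteq> section_of n F z2"
      by (rule section_neq[OF _ _ lims(3) _ _ _ small(3) that]) (use z(1,2,4) in simp_all)
    then show False using z by blast
  qed
qed

end

lemma section_of_add_mult:
  assumes "h holomorphic_on ball 0 1" "g holomorphic_on ball 0 1"
  shows "section_of n (\<lambda>z. h z + \<epsilon> * g z) z = section_of n h z + \<epsilon> * section_of n g z"
proof -
  have "h has_fps_expansion fps_expansion h 0" "g has_fps_expansion fps_expansion g 0"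
    using assms by (auto intro!: has_fps_expansion_fps_expansion[OF open_ball])
  then have "(\<lambda>z. h z + \<epsilon> * g z) has_fps_expansion fps_expansion h 0 + fps_const \<epsilon> * fps_expansion g 0"
    by (intro fps_expansion_intros)
  then have "fps_expansion (\<lambda>z. h z + \<epsilon> * g z) 0 = fps_expansion h 0 + fps_const \<epsilon> * fps_expansion g 0"
    by (rule fps_expansion_eqI)
  then show ?thesis
    by (simp add: section_of_def distrib_right sum.distrib sum_distrib_left mult.assoc)
qed

text \<open>Two points identified by the harmonic section give increments of the two analytic sections of
  equal modulus, and these cancel for a suitable unimodular \<open>\<epsilon>\<close>.\<close>

lemma inj_on_harmonic_section:
  assumes hol: "h holomorphic_on ball 0 1" "g holomorphic_on ball 0 1"
    and inj: "\<And>\<epsilon>. cmod \<epsilon> = 1 \<Longrightarrow> inj_on (section_of n (\<lambda>z. h z + \<epsilon> * g z)) X"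
  shows "inj_on (harmonic_section n h g \<theta>) X"
proof (rule inj_onI)
  fix z w assume zw: "z \<in> X" "w \<in> X" and eq: "harmonic_section n h g \<theta> z = harmonic_section n h g \<theta> w"
  define a where "a = section_of n h z - section_of n h w"
  define b where "b = section_of n g z - section_of n g w"
  have "a + exp (\<i> * of_real \<theta>) * cnj b = 0"
    using eq by (simp add: harmonic_section_def a_def b_def algebra_simps)
  then have "cmod a = cmod (exp (\<i> * of_real \<theta>) * cnj b)" by (metis add_eq_0_iff2 norm_minus_cancel)
  then have ab: "cmod a = cmod b" by (simp add: norm_mult)
  \<comment> \<open>If b = 0, then a = 0 by equality of moduli, and any unimodular value will
    do.\<close>
  define \<epsilon> where "\<epsilon> = (if b = 0 then 1 else - a / b)"
  have \<epsilon>: "cmod \<epsilon> = 1" using ab by (simp add: \<epsilon>_def norm_divide)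
  have "a + \<epsilon> * b = 0" using ab by (cases "b = 0") (simp_all add: \<epsilon>_def)
  then have "section_of n (\<lambda>z. h z + \<epsilon> * g z) z = section_of n (\<lambda>z. h z + \<epsilon> * g z) w"
    unfolding section_of_add_mult[OF hol] a_def b_def by (simp add: algebra_simps)
  then show "z = w" using inj_onD[OF inj[OF \<epsilon>] _ zw] by blast
qed

theorem corollary2:
  fixes f h g :: "complex \<Rightarrow> complex" and \<theta> :: real
  assumes "f \<in> class_K_H0" and "decomposition f h g"
  shows "(\<forall>n\<ge>2. inj_on (harmonic_section n h g \<theta>) (ball 0 (1/4))) \<and>
         (\<forall>n\<ge>17. inj_on (harmonic_section n h g \<theta>) (ball 0 (1/2))) \<and>
         (\<forall>n\<ge>46. inj_on (harmonic_section n h g \<theta>) (ball 0 (3/4)))"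
proof -
  have hol: "h holomorphic_on ball 0 1" "g holomorphic_on ball 0 1"
    using assms(2) by (auto simp: decomposition_def)
  have "\<exists>\<kappa> p q. directional (\<lambda>z. h z + \<epsilon> * g z) \<kappa> p q" if \<epsilon>: "cmod \<epsilon> = 1" for \<epsilon>
  proof -
    obtain \<kappa> p q where "cmod \<kappa> = 1" "cmod p = 1" "cmod q = 1"
      "\<And>z. z \<in> ball 0 1 \<Longrightarrow> Re (\<kappa> * ((1 - p * z) * (1 - q * z) * deriv (\<lambda>z. h z + \<epsilon> * g z) z)) > 0"
      "deriv (\<lambda>z. h z + \<epsilon> * g z) 0 = 1"
      using convex_harmonic_close_to_convex[OF assms \<epsilon>] by blast
    moreover have "(\<lambda>z. h z + \<epsilon> * g z) holomorphic_on ball 0 1" by (intro holomorphic_intros hol)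
    ultimately have "directional (\<lambda>z. h z + \<epsilon> * g z) \<kappa> p q" by unfold_locales
    then show ?thesis by blast
  qed
  then show ?thesis
    by (intro conjI allI impI; intro inj_on_harmonic_section[OF hol])
      (blast intro: directional.section_inj)+
qed

end
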